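(* Let $F$ be strongly convex with modulus $\gamma_1>0$. Let $X_0\times Y_0\subset \operatorname{dom}F\times\operatorname{dom}G$ be bounded and contain a saddle-point $(x',y')$ of $L$. Let $\{(x^k,y^k)\}$ be generated by the accelerated Douglas--Rachford iteration (aDR), and let $$\lambda_k=\prod_{k'=0}^{k-1}\frac1{\vartheta_{k'}},\qquad \nu_k=\Bigl[\sum_{k'=0}^{k-1}\lambda_{k'}\Bigr]^{-1}.$$ Then the ergodic sequences $$x^k_{\mathrm{erg}}=\nu_k\sum_{k'=0}^{k-1}\lambda_{k'}x^{k'+1},\qquad y^k_{\mathrm{erg}}=\nu_k\sum_{k'=0}^{k-1}\lambda_{k'}y^{k'+1}$$ converge to the same limit $(x^*,y^* )$ as $\{(x^k,y^k)\}$ (a saddle-point of $L$ with $x^k\to x^*$ strongly and $y^k\rightharpoonup y^*$ weakly), in the sense that $\|x^k_{\mathrm{erg}}-x^*\|^2=O(1/k^2)$ and $y^k_{\mathrm{erg}}\rightharpoonup y^*$ weakly as $k\to\infty$. The associated restricted primal-dual gap satisfies, for some $k_0\ge 0$ and some $\rho\in(0,1]$, the estimate $$\mathfrak G_{X_0\times Y_0}(x^k_{\mathrm{erg}},y^k_{\mathrm{erg}})\le \nu_k\sup_{(x,y)\in X_0\times Y_0}\Bigl[\frac{\sigma_0}{2\rho\sigma_{k_0}^2}\|\hat x^{k_0}-x_\rho+\sigma_{k_0}K^*y_\rho\|^2+\frac1{2\rho\tau_0}\|\hat y^{k_0}-y_\rho-\tau_{k_0}Kx_\rho\|^2+\sum_{k'=0}^{k_0-1}\lambda_{k'}\bigl(L(x^{k'+1},y)-L(x,y^{k'+1})\bigr)\Bigr]=O(1/k^2),$$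 where $x_\rho=\rho x+(1-\rho)x'$ and $y_\rho=\rho y+(1-\rho)y'$.
   Context: $X,Y$ are real Hilbert spaces, $K:X\to Y$ is linear and continuous with adjoint $K^*$, and $F:X\to(-\infty,\infty]$, $G:Y\to(-\infty,\infty]$ are proper, convex and lower semi-continuous. The Lagrangian is $L(x,y)=\langle Kx,y\rangle+F(x)-G(y)$ on $\operatorname{dom}F\times\operatorname{dom}G$; a saddle-point is $(x^*,y^* )\in\operatorname{dom}F\times\operatorname{dom}G$ with $L(x^*,y)\le L(x^*,y^* )\le L(x,y^* )$ for all $(x,y)\in\operatorname{dom}F\times\operatorname{dom}G$. Restricted primal-dual gap: $\mathfrak G_{X_0\times Y_0}(x,y)=\sup_{(x',y')\in X_0\times Y_0}\,[L(x,y')-L(x',y)]$. $F$ is strongly convex with modulus $\gamma_1$ if $F(\lambda x+(1-\lambda)\bar x)\le\lambda F(x)+(1-\lambda)F(\bar x)-\gamma_1\lambda(1-\lambda)\|x-\bar x\|^2/2$ for all $x,\bar x\in\operatorname{dom}F$, $\lambda\in[0,1]$. Iteration (aDR): choose $(\hat x^0,\hat y^0)\in X\times Y$, $\sigma_0,\tau_0>0$, $0<\gamma<\frac{2\gamma_1}{1+\sigma_0\tau_0\|K\|^2}$, $\vartheta_0=\frac1{\sqrt{1+\sigma_0\gamma}}$, and for $k\ge0$ set $x^{k+1}=(\mathrm{id}+\sigma_k\partial F)^{-1}(\hat x^k)$, $y^{k+1}=(\mathrm{id}+\tau_k\partial G)^{-1}(\hat y^k)$, $b^{k+1}=((1+\vartheta_k)x^{k+1}-\vartheta_k\hat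 x^k)-\sigma_kK^*((1+\vartheta_k)y^{k+1}-\hat y^k)$, $d^{k+1}=(\mathrm{id}+\sigma_0\tau_0K^*K)^{-1}b^{k+1}$, $\hat x^{k+1}=\vartheta_k(\hat x^k-x^{k+1})+d^{k+1}$, $\hat y^{k+1}=y^{k+1}+\vartheta_k^{-1}\tau_kKd^{k+1}$, $\sigma_{k+1}=\vartheta_k\sigma_k$, $\tau_{k+1}=\vartheta_k^{-1}\tau_k$, $\vartheta_{k+1}=\frac1{\sqrt{1+\sigma_{k+1}\gamma}}$. Here $(\mathrm{id}+\sigma\partial F)^{-1}$ denotes the resolvent (proximal map) of the subdifferential. *)

theory Defs
  imports "HOL-Analysis.Analysis" "HOL-Library.Landau_Symbols"
begin

section \<open>Extended-real-valued convex functions\<close>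

definition edom :: "('a \<Rightarrow> ereal) \<Rightarrow> 'a set" where
  "edom F = {x. F x < \<infinity>}"

definition proper :: "('a \<Rightarrow> ereal) \<Rightarrow> bool" where
  "proper F \<longleftrightarrow> (\<forall>x. F x \<noteq> -\<infinity>) \<and> edom F \<noteq> {}"

text \<open>The library's \<open>convex_on\<close> is for real-valued functions only. The inequality below is the
  usual one on functions that never take the value \<open>-\<infinity>\<close>; at the endpoints it relies on the
  convention \<open>0 * \<infinity> = 0\<close> of \<open>ereal\<close>.\<close>

definition convex_fun :: "('a::real_vector \<Rightarrow> ereal) \<Rightarrow> bool" where
  "convex_fun F \<longleftrightarrow> (\<forall>x x'. \<forall>t\<in>{0..1::real}.
     F (t *\<^sub>R x + (1 - t) *\<^sub>R x') \<le> ereal t * F x + ereal (1 - t) * F x')"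

definition lower_semicontinuous :: "('a::topological_space \<Rightarrow> ereal) \<Rightarrow> bool" where
  "lower_semicontinuous F \<longleftrightarrow> (\<forall>x. F x \<le> Liminf (at x) F)"

definition strongly_convex :: "real \<Rightarrow> ('a::real_normed_vector \<Rightarrow> ereal) \<Rightarrow> bool" where
  "strongly_convex \<mu> F \<longleftrightarrow> (\<forall>x\<in>edom F. \<forall>x'\<in>edom F. \<forall>t\<in>{0..1::real}.
     F (t *\<^sub>R x + (1 - t) *\<^sub>R x')
       \<le> ereal t * F x + ereal (1 - t) * F x' - ereal (\<mu> * t * (1 - t) * (norm (x - x'))\<^sup>2 / 2))"

definition subdifferential :: "('a::real_inner \<Rightarrow> ereal) \<Rightarrow> 'a \<Rightarrow> 'a set" where
  "subdifferential F x = {p. \<forall>z. F x + ereal (p \<bullet> (z - x)) \<le> F z}"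

text \<open>The resolvent \<open>(id + s A)\<^sup>-\<^sup>1\<close> of a set-valued operator \<open>A\<close>. It is meant for
  subdifferentials of proper, convex, lower semicontinuous functions on a Hilbert space and
  \<open>s > 0\<close>, where the inverse is single-valued and defined everywhere.\<close>

definition resolvent :: "real \<Rightarrow> ('a::real_vector \<Rightarrow> 'a set) \<Rightarrow> 'a \<Rightarrow> 'a" where
  "resolvent s A z = (THE x. \<exists>p\<in>A x. z = x + s *\<^sub>R p)"

definition weakly_tendsto :: "(nat \<Rightarrow> 'a::real_normed_vector) \<Rightarrow> 'a \<Rightarrow> bool" where
  "weakly_tendsto u l \<longleftrightarrow>
     (\<forall>f :: 'a \<Rightarrow> real. bounded_linear f \<longrightarrow> (\<lambda>k. f (u k)) \<longlonglongrightarrow> f l)"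


section \<open>The saddle-point problem\<close>

text \<open>On \<open>edom F \<times> edom G\<close>, which is where it is used, the Lagrangian is finite.\<close>

definition lagrangian ::
  "('a::real_inner \<Rightarrow> 'b::real_inner) \<Rightarrow> ('a \<Rightarrow> ereal) \<Rightarrow> ('b \<Rightarrow> ereal) \<Rightarrow> 'a \<Rightarrow> 'b \<Rightarrow> ereal" where
  "lagrangian K F G x y = ereal (K x \<bullet> y) + F x - G y"

definition saddle_point ::
  "('a::real_inner \<Rightarrow> 'b::real_inner) \<Rightarrow> ('a \<Rightarrow> ereal) \<Rightarrow> ('b \<Rightarrow> ereal) \<Rightarrow> 'a \<Rightarrow> 'b \<Rightarrow> bool" where
  "saddle_point K F G xs ys \<longleftrightarrow> xs \<in> edom F \<and> ys \<in> edom G \<and>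
     (\<forall>x\<in>edom F. \<forall>y\<in>edom G.
        lagrangian K F G xs y \<le> lagrangian K F G xs ys \<and>
        lagrangian K F G xs ys \<le> lagrangian K F G x ys)"

definition restricted_gap ::
  "('a::real_inner \<Rightarrow> 'b::real_inner) \<Rightarrow> ('a \<Rightarrow> ereal) \<Rightarrow> ('b \<Rightarrow> ereal) \<Rightarrow>
   'a set \<Rightarrow> 'b set \<Rightarrow> 'a \<Rightarrow> 'b \<Rightarrow> ereal" where
  "restricted_gap K F G X0 Y0 x y =
     (SUP (x', y') \<in> X0 \<times> Y0. lagrangian K F G x y' - lagrangian K F G x' y)"


section \<open>Accelerated Douglas--Rachford iteration\<close>

text \<open>The values \<open>x 0\<close> and \<open>y 0\<close> are not part of the iteration and stay unconstrained. For
  continuous linear \<open>K\<close> between Hilbert spaces the library's \<open>adjoint K\<close> is the Hilbert space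
  adjoint, and \<open>id + \<sigma>\<^sub>0\<tau>\<^sub>0K*K\<close> is bijective.\<close>

definition adr_iteration ::
  "('a::real_inner \<Rightarrow> 'b::real_inner) \<Rightarrow> ('a \<Rightarrow> ereal) \<Rightarrow> ('b \<Rightarrow> ereal) \<Rightarrow> real \<Rightarrow>
   (nat \<Rightarrow> real) \<Rightarrow> (nat \<Rightarrow> real) \<Rightarrow> (nat \<Rightarrow> real) \<Rightarrow>
   (nat \<Rightarrow> 'a) \<Rightarrow> (nat \<Rightarrow> 'b) \<Rightarrow> (nat \<Rightarrow> 'a) \<Rightarrow> (nat \<Rightarrow> 'b) \<Rightarrow> bool" where
  "adr_iteration K F G \<gamma> \<sigma> \<tau> \<theta> x y xh yh \<longleftrightarrow>
     (\<forall>k. \<theta> k = 1 / sqrt (1 + \<sigma> k * \<gamma>)) \<and>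
     (\<forall>k. \<sigma> (Suc k) = \<theta> k * \<sigma> k) \<and>
     (\<forall>k. \<tau> (Suc k) = inverse (\<theta> k) * \<tau> k) \<and>
     (\<forall>k. x (Suc k) = resolvent (\<sigma> k) (subdifferential F) (xh k)) \<and>
     (\<forall>k. y (Suc k) = resolvent (\<tau> k) (subdifferential G) (yh k)) \<and>
     (\<forall>k. let b = ((1 + \<theta> k) *\<^sub>R x (Suc k) - \<theta> k *\<^sub>R xh k)
                    - \<sigma> k *\<^sub>R adjoint K ((1 + \<theta> k) *\<^sub>R y (Suc k) - yh k);
              d = inv (\<lambda>u. u + (\<sigma> 0 * \<tau> 0) *\<^sub>R adjoint K (K u)) b
          in xh (Suc k) = \<theta> k *\<^sub>R (xh k - x (Suc k)) + d \<and>
             yh (Suc k) = y (Suc k) + (inverse (\<theta> k) * \<tau> k) *\<^sub>R K d)"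

definition erg_weight :: "(nat \<Rightarrow> real) \<Rightarrow> nat \<Rightarrow> real" where
  "erg_weight \<theta> k = (\<Prod>j<k. 1 / \<theta> j)"

definition erg_norm :: "(nat \<Rightarrow> real) \<Rightarrow> nat \<Rightarrow> real" where
  "erg_norm \<theta> k = inverse (\<Sum>j<k. erg_weight \<theta> j)"

definition ergodic :: "(nat \<Rightarrow> real) \<Rightarrow> (nat \<Rightarrow> 'a::real_vector) \<Rightarrow> nat \<Rightarrow> 'a" where
  "ergodic \<theta> u k = erg_norm \<theta> k *\<^sub>R (\<Sum>j<k. erg_weight \<theta> j *\<^sub>R u (Suc j))"

text \<open>The supremum in the gap estimate, before multiplication by \<open>\<nu>\<^sub>k\<close>; \<open>(x', y')\<close> is the given
  saddle-point in \<open>X0 \<times> Y0\<close> towards which \<open>(u, v)\<close> is shifted.\<close>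

definition gap_bound ::
  "('a::real_inner \<Rightarrow> 'b::real_inner) \<Rightarrow> ('a \<Rightarrow> ereal) \<Rightarrow> ('b \<Rightarrow> ereal) \<Rightarrow>
   (nat \<Rightarrow> real) \<Rightarrow> (nat \<Rightarrow> real) \<Rightarrow> (nat \<Rightarrow> real) \<Rightarrow>
   (nat \<Rightarrow> 'a) \<Rightarrow> (nat \<Rightarrow> 'b) \<Rightarrow> (nat \<Rightarrow> 'a) \<Rightarrow> (nat \<Rightarrow> 'b) \<Rightarrow>
   'a set \<Rightarrow> 'b set \<Rightarrow> 'a \<Rightarrow> 'b \<Rightarrow> nat \<Rightarrow> real \<Rightarrow> ereal" where
  "gap_bound K F G \<sigma> \<tau> \<theta> x y xh yh X0 Y0 x' y' k0 \<rho> =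
     (SUP (u, v) \<in> X0 \<times> Y0.
        (let u\<rho> = \<rho> *\<^sub>R u + (1 - \<rho>) *\<^sub>R x';
             v\<rho> = \<rho> *\<^sub>R v + (1 - \<rho>) *\<^sub>R y'
         in ereal (\<sigma> 0 / (2 * \<rho> * (\<sigma> k0)\<^sup>2) * (norm (xh k0 - u\<rho> + \<sigma> k0 *\<^sub>R adjoint K v\<rho>))\<^sup>2)
            + ereal (1 / (2 * \<rho> * \<tau> 0) * (norm (yh k0 - v\<rho> - \<tau> k0 *\<^sub>R K u\<rho>))\<^sup>2)
            + (\<Sum>j<k0. ereal (erg_weight \<theta> j) *
                 (lagrangian K F G (x (Suc j)) v - lagrangian K F G u (y (Suc j))))))"

end

theory Submission
  imports Defs
begin

text \<open>
  Write \<open>s = \<sigma>\<^sub>0 \<tau>\<^sub>0\<close>, a constant of the iteration since \<open>\<sigma>\<^sub>k \<tau>\<^sub>k = s\<close>. For a reference pair \<open>(u, v)\<close> put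
  \<open>U\<^sub>k = (xh\<^sub>k - u) / \<sigma>\<^sub>k + K\<^sup>* v\<close>, \<open>V\<^sub>k = yh\<^sub>k - v - \<tau>\<^sub>k K u\<close> and call
  \<open>(s \<parallel>U\<^sub>k\<parallel>\<^sup>2 + \<parallel>V\<^sub>k\<parallel>\<^sup>2) / 2\<close> the energy. One step of the iteration obeys an exact energy balance
  (\<open>douglas_rachford_step_identity\<close>): the energy drops by the monotonicity products of the two
  resolvents plus half of the squared increments of \<open>U\<close> and \<open>V\<close>, up to a price of acceleration whose
  main part is at most
  \<open>\<gamma> (1 + s \<parallel>K\<parallel>\<^sup>2) / 2 * s \<parallel>x\<^bsub>k+1\<^esub> - u\<parallel>\<^sup>2 / \<sigma>\<^sub>k\<close>. Strong convexity contributes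
  \<open>\<alpha> s \<parallel>x\<^bsub>k+1\<^esub> - u\<parallel>\<^sup>2 / \<sigma>\<^sub>k\<close> for some \<open>\<alpha>\<close>. As \<open>\<sigma>\<^sub>k\<close> tends to \<open>0\<close>, this pays the price from some index on,
  provided that \<open>\<alpha>\<close> exceeds \<open>\<gamma> (1 + s \<parallel>K\<parallel>\<^sup>2) / 2\<close> (\<open>energy_descent\<close>).

  If \<open>(u, v)\<close> is a saddle-point, one can take \<open>\<alpha> = \<gamma>1\<close>, which the choice of \<open>\<gamma>\<close> makes
  sufficient. The energy then converges, the increments tend to \<open>0\<close>, and the squares
  \<open>\<parallel>x\<^bsub>k+1\<^esub> - u\<parallel>\<^sup>2\<close> are summable with the weights \<open>\<lambda>\<^sub>k\<close> (\<open>saddle_energy\<close>). As the sums of the weights grow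
  quadratically, the summability is the rate for the ergodic primal sequence. Boundedness of the
  energy gives strong convergence of \<open>x\<close>. The dual sequence is bounded; its weak cluster points are
  saddle-points by maximal monotonicity (\<open>weak_cluster_point_is_saddle\<close>), and there is only one of
  them because the energies relative to two of them both converge (\<open>opial_functional_convergent\<close>).

  For an arbitrary pair the gap supplies only \<open>\<alpha> = \<gamma>1 / 2\<close>. Moving the pair almost all the way to the
  saddle-point recovers nearly all of \<open>\<gamma>1\<close>, since the gap at the saddle-point is itself bounded below
  by \<open>\<gamma>1 / 2\<close> times the squared distance (\<open>shifted_gap\<close>).
  Hence the weighted sums of gaps over the bounded set \<open>X0 \<times> Y0\<close> stay below one
  constant, uniformly in the number of summands (\<open>weighted_gap_sums_bounded\<close>), and Jensen's inequality
  carries the bound to the ergodic sequences. The estimate has to hold from the first step on, whereas the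
  descent starts late; it is obtained with \<open>k\<^sub>0 = 0\<close> and a small \<open>\<rho>\<close>. The bound contains
  the energy of the starting point relative to \<open>(x', y')\<close>, divided by \<open>\<rho> \<tau>\<^sub>0\<close>; unless that energy
  vanishes, it exceeds every constant as \<open>\<rho>\<close> tends to \<open>0\<close>, and if it vanishes, the iteration is
  stationary and no gap is positive (\<open>gap_bound_dominates\<close>).

  The proximal maps, the adjoint and the linear solver all rest on one existence result, the
  solvability of \<open>z \<in> x + s \<partial>F x\<close> (\<open>resolvent_equation_solvable\<close>): applied to linear functions it yields
  the Riesz representation, applied to \<open>s / 2 * \<parallel>K x\<parallel>\<^sup>2\<close> the surjectivity of \<open>id + s K\<^sup>* K\<close>, and it is
  the core of maximal monotonicity.
\<close>

section \<open>Norms and limits\<close>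

lemma norm_half_add_square:
  fixes a b :: "'a::real_inner"
  shows "(norm ((1/2) *\<^sub>R (a + b)))\<^sup>2 = (norm a)\<^sup>2 / 2 + (norm b)\<^sup>2 / 2 - (norm (a - b))\<^sup>2 / 4"
proof -
  have "(norm ((1/2) *\<^sub>R (a + b)))\<^sup>2 = (norm (a + b))\<^sup>2 / 4"
    unfolding norm_scaleR power_mult_distrib by (simp add: power2_eq_square)
  moreover have "(norm (a + b))\<^sup>2 + (norm (a - b))\<^sup>2 = 2 * (norm a)\<^sup>2 + 2 * (norm b)\<^sup>2"
    by (simp add: power2_norm_eq_inner inner_diff_left inner_diff_right inner_add_left inner_add_right)
  ultimately show ?thesis by linarith
qed

lemma convex_on_norm_square: "convex_on UNIV (\<lambda>x::'a::real_inner. (norm x)\<^sup>2)"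
proof (rule convex_onI)
  fix t :: real and x y :: 'a assume t: "0 < t" "t < 1"
  have "(1 - t) * (norm x)\<^sup>2 + t * (norm y)\<^sup>2 - (norm ((1 - t) *\<^sub>R x + t *\<^sub>R y))\<^sup>2
      = t * (1 - t) * (norm (x - y))\<^sup>2"
    unfolding power2_norm_eq_inner
    by (simp add: inner_diff_left inner_diff_right inner_add_left inner_add_right inner_commute)
      (simp add: algebra_simps)
  also have "\<dots> \<ge> 0" using t by simp
  finally show "(norm ((1 - t) *\<^sub>R x + t *\<^sub>R y))\<^sup>2 \<le> (1 - t) * (norm x)\<^sup>2 + t * (norm y)\<^sup>2" by simp
qed simp

lemma norm_le_norm_add:
  fixes a b :: "'a::real_inner"
  assumes "0 \<le> a \<bullet> b"
  shows "norm a \<le> norm (a + b)" "norm b \<le> norm (a + b)"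
proof -
  have "(norm (a + b))\<^sup>2 = (norm a)\<^sup>2 + (norm b)\<^sup>2 + 2 * (a \<bullet> b)"
    by (simp add: power2_norm_eq_inner inner_add_left inner_add_right inner_commute[of b a])
  then have "(norm a)\<^sup>2 \<le> (norm (a + b))\<^sup>2" "(norm b)\<^sup>2 \<le> (norm (a + b))\<^sup>2" using assms by auto
  then show "norm a \<le> norm (a + b)" "norm b \<le> norm (a + b)" by (auto intro: power2_le_imp_le)
qed

lemma norm_convex_combination_le:
  fixes a b :: "'a::real_normed_vector"
  assumes "norm a \<le> R" "norm b \<le> R" "0 \<le> t" "t \<le> 1"
  shows "norm (t *\<^sub>R a + (1 - t) *\<^sub>R b) \<le> R"
  using convexD_alt[OF convex_cball[of 0 R], of b a t] assms by (simp add: add.commute)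

lemma le_of_le_add_scaled:
  fixes a b c :: real
  assumes "\<And>t. 0 < t \<Longrightarrow> t < 1 \<Longrightarrow> a \<le> b + t * c"
  shows "a \<le> b"
proof (rule tendsto_le[OF trivial_limit_at_right_real[of 0]])
  show "((\<lambda>t. b + t * c) \<longlongrightarrow> b) (at_right 0)"
    by (auto intro!: tendsto_eq_intros)
  show "eventually (\<lambda>t. a \<le> b + t * c) (at_right 0)"
    using eventually_at_right_real[OF zero_less_one] by (rule eventually_mono) (auto intro: assms)
qed auto

text \<open>The finitely many terms far from the limit carry a vanishing share of the divergent total
  weight; this is a case of the Silverman--Toeplitz theorem.\<close>

lemma weighted_mean_tendsto:
  fixes a w :: "nat \<Rightarrow> real"
  assumes a: "a \<longlonglongrightarrow> l" and w: "\<And>n. w n > 0"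
    and W: "filterlim (\<lambda>k. \<Sum>j<k. w j) at_top sequentially"
  shows "(\<lambda>k. inverse (\<Sum>j<k. w j) * (\<Sum>j<k. w j * a j)) \<longlonglongrightarrow> l"
proof (rule LIMSEQ_I)
  fix e :: real assume e: "e > 0"
  define S where "S k = (\<Sum>j<k. w j)" for k
  obtain N where N: "\<And>n. n \<ge> N \<Longrightarrow> \<bar>a n - l\<bar> < e / 2"
    using LIMSEQ_D[OF a, of "e / 2"] e by auto
  define B where "B = (\<Sum>j<N. w j * \<bar>a j - l\<bar>)"
  have "eventually (\<lambda>k. S k > 2 * B / e) sequentially"
    using W unfolding S_def filterlim_at_top_dense by blast
  then obtain M where M: "\<And>k. k \<ge> M \<Longrightarrow> S k > 2 * B / e" by (auto simp: eventually_sequentially)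
  have "norm (inverse (S k) * (\<Sum>j<k. w j * a j) - l) < e" if k: "k \<ge> max M (max N 1)" for k
  proof -
    have S: "S k > 0" unfolding S_def using k w by (intro sum_pos) (auto simp: lessThan_empty_iff)
    have eq: "(\<Sum>j<k. w j * a j) - S k * l = (\<Sum>j<k. w j * (a j - l))"
      by (simp add: S_def sum_distrib_right sum_subtractf right_diff_distrib)
    have "\<bar>(\<Sum>j<k. w j * a j) - S k * l\<bar> \<le> (\<Sum>j<k. w j * \<bar>a j - l\<bar>)"
      unfolding eq by (rule order_trans[OF sum_abs]) (simp add: abs_mult less_imp_le[OF w])
    also have "\<dots> = B + (\<Sum>j\<in>{N..<k}. w j * \<bar>a j - l\<bar>)"
      unfolding B_def lessThan_atLeast0 using k by (subst sum.atLeastLessThan_concat) auto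
    also have "\<dots> \<le> B + (\<Sum>j\<in>{N..<k}. w j * (e / 2))"
      using N by (intro add_left_mono sum_mono mult_left_mono) (auto simp: less_imp_le w)
    also have "\<dots> \<le> B + S k * (e / 2)"
      unfolding S_def sum_distrib_right[symmetric] using e w
      by (intro add_left_mono mult_right_mono sum_mono2) (auto simp: less_imp_le)
    also have "\<dots> < S k * e" using M[of k] k e by (simp add: field_simps)
    finally have "\<bar>(\<Sum>j<k. w j * a j) - S k * l\<bar> < S k * e" .
    moreover have "inverse (S k) * (\<Sum>j<k. w j * a j) - l = ((\<Sum>j<k. w j * a j) - S k * l) / S k"
      using S by (simp add: field_simps)
    ultimately show ?thesis using S by (simp add: abs_divide pos_divide_less_eq mult.commute)
  qed
  then show "\<exists>no. \<forall>k\<ge>no. norm (inverse (\<Sum>j<k. w j) * (\<Sum>j<k. w j * a j) - l) < e"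
    unfolding S_def by blast
qed

lemma summable_of_eventual_descent:
  fixes a P :: "nat \<Rightarrow> real"
  assumes "\<And>j. 0 \<le> a j" "\<And>j. 0 \<le> P j" "\<And>j. j \<ge> N \<Longrightarrow> a j \<le> P j - P (Suc j)"
  shows "summable a"
proof -
  have "(\<Sum>j<n. a (j + N)) \<le> P N" for n
  proof -
    have "(\<Sum>j<n. a (j + N)) \<le> (\<Sum>j<n. P (j + N) - P (Suc j + N))"
      using assms(3) by (intro sum_mono) simp
    also have "\<dots> = P N - P (n + N)" using sum_lessThan_telescope'[of "\<lambda>j. P (j + N)" n] by simp
    also have "\<dots> \<le> P N" using assms(2) by simp
    finally show ?thesis .
  qed
  then have "summable (\<lambda>j. a (j + N))"
    using assms(1) by (intro summableI_nonneg_bounded) auto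
  then show ?thesis by (simp add: summable_iff_shift)
qed


section \<open>Subgradients and resolvents\<close>

lemma proper_eq_ereal: "proper F \<Longrightarrow> x \<in> edom F \<Longrightarrow> F x = ereal (real_of_ereal (F x))"
  by (cases "F x") (auto simp: proper_def edom_def)

lemma convex_on_edom:
  assumes "proper F" "convex_fun F"
  shows "convex_on (edom F) (\<lambda>x. real_of_ereal (F x))"
proof -
  have le: "F (t *\<^sub>R x + (1 - t) *\<^sub>R y)
      \<le> ereal (t * real_of_ereal (F x) + (1 - t) * real_of_ereal (F y))"
    if "x \<in> edom F" "y \<in> edom F" "0 \<le> t" "t \<le> 1" for x y and t :: real
  proof -
    have "F (t *\<^sub>R x + (1 - t) *\<^sub>R y) \<le> ereal t * F x + ereal (1 - t) * F y"
      using assms(2) that by (auto simp: convex_fun_def)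
    then show ?thesis
      using proper_eq_ereal[OF assms(1) that(1)] proper_eq_ereal[OF assms(1) that(2)]
      by (metis plus_ereal.simps(1) times_ereal.simps(1))
  qed
  have dom: "t *\<^sub>R x + (1 - t) *\<^sub>R y \<in> edom F"
    if "x \<in> edom F" "y \<in> edom F" "0 \<le> t" "t \<le> 1" for x y and t :: real
    using le[OF that] by (auto simp: edom_def intro: le_less_trans)
  show ?thesis
    unfolding convex_on_def
  proof (intro conjI ballI allI impI)
    show "convex (edom F)"
      unfolding convex_alt using dom by (metis add.commute)
  next
    fix x y and u v :: real
    assume *: "x \<in> edom F" "y \<in> edom F" "0 \<le> u" "0 \<le> v" "u + v = 1"
    then have v: "v = 1 - u" "u \<le> 1" by auto
    show "real_of_ereal (F (u *\<^sub>R x + v *\<^sub>R y))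
        \<le> u * real_of_ereal (F x) + v * real_of_ereal (F y)"
      using le[OF *(1-3) v(2)] proper_eq_ereal[OF assms(1) dom[OF *(1-3) v(2)]] v(1)
      by (metis ereal_less_eq(3))
  qed
qed

lemma strongly_convex_real:
  assumes F: "proper F" "convex_fun F" "strongly_convex \<mu> F"
    and uw: "u \<in> edom F" "w \<in> edom F" and t: "0 \<le> t" "t \<le> 1"
  shows "real_of_ereal (F (t *\<^sub>R u + (1 - t) *\<^sub>R w))
    \<le> t * real_of_ereal (F u) + (1 - t) * real_of_ereal (F w) - \<mu> / 2 * (t * (1 - t) * (norm (u - w))\<^sup>2)"
proof -
  define r where "r = t *\<^sub>R u + (1 - t) *\<^sub>R w"
  have "convex (edom F)" using convex_on_edom[OF F(1,2)] by (simp add: convex_on_def)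
  then have "r \<in> edom F" unfolding r_def using uw t by (intro convexD) auto
  then have r: "F r = ereal (real_of_ereal (F r))" by (rule proper_eq_ereal[OF F(1)])
  obtain a b where ab: "F u = ereal a" "F w = ereal b"
    using proper_eq_ereal[OF F(1) uw(1)] proper_eq_ereal[OF F(1) uw(2)] by blast
  have "F r \<le> ereal t * F u + ereal (1 - t) * F w - ereal (\<mu> * t * (1 - t) * (norm (u - w))\<^sup>2 / 2)"
    using F(3) uw t unfolding strongly_convex_def r_def by auto
  then have "ereal (real_of_ereal (F r)) \<le> ereal (t * a + (1 - t) * b - \<mu> * t * (1 - t) * (norm (u - w))\<^sup>2 / 2)"
    unfolding r[symmetric] ab by simp
  then show ?thesis unfolding r_def[symmetric] ab by (simp add: ac_simps)
qed

lemma lower_semicontinuous_eventually: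
  assumes "lower_semicontinuous F" "c < F x"
  shows "eventually (\<lambda>z. c < F z) (nhds x)"
  using assms less_LiminfD[of c "at x" F]
  by (auto simp: lower_semicontinuous_def eventually_nhds_conv_at intro: less_le_trans)

text \<open>Lower semicontinuity bounds \<open>F\<close> from below on a small ball around a point of its domain,
  and convexity along rays from that point propagates the bound to the whole space at the price
  of linear growth. Quadratic regularizations of \<open>F\<close> are therefore bounded below.\<close>

lemma convex_lsc_linear_lower_bound:
  fixes F :: "'a::real_normed_vector \<Rightarrow> ereal"
  assumes "proper F" "convex_fun F" "lower_semicontinuous F"
  obtains x0 a C where "C \<ge> 0" "\<And>x. x \<in> edom F \<Longrightarrow> a - C * norm (x - x0) \<le> real_of_ereal (F x)"
proof -
  define f where "f = (\<lambda>x. real_of_ereal (F x))"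
  have Ff: "F x = ereal (f x)" if "x \<in> edom F" for x
    unfolding f_def using proper_eq_ereal[OF assms(1) that] .
  have cf: "convex_on (edom F) f" unfolding f_def by (rule convex_on_edom[OF assms(1,2)])
  obtain x0 where x0: "x0 \<in> edom F" using assms(1) by (auto simp: proper_def)
  have "eventually (\<lambda>z. ereal (f x0 - 1) < F z) (nhds x0)"
    by (rule lower_semicontinuous_eventually[OF assms(3)]) (simp add: Ff[OF x0])
  then obtain r where r: "r > 0" "\<And>z. dist z x0 < r \<Longrightarrow> ereal (f x0 - 1) < F z"
    by (auto simp: eventually_nhds_metric)
  show ?thesis
  proof (rule that[of "2 / r" "f x0 - 1" x0])
    show "0 \<le> 2 / r" using r by simp
  next
    fix x assume x: "x \<in> edom F"
    have Rx: "real_of_ereal (F x) = f x" by (simp add: f_def)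
    show "f x0 - 1 - 2 / r * norm (x - x0) \<le> real_of_ereal (F x)"
    proof (cases "norm (x - x0) < r")
      case True
      then have "f x0 - 1 < f x" using r(2)[of x] Ff[OF x] by (simp add: dist_norm)
      moreover have "0 \<le> 2 / r * norm (x - x0)" using r by simp
      ultimately show ?thesis unfolding Rx by linarith
    next
      case False
      define n where "n = norm (x - x0)"
      \<comment> \<open>puts \<open>xt\<close> at distance \<open>r / 2\<close> from \<open>x0\<close>, where the local bound applies\<close>
      define t where "t = r / (2 * n)"
      have n: "n \<ge> r" "n > 0" using False r(1) by (auto simp: n_def)
      have t: "0 < t" "t < 1" using n r(1) by (auto simp: t_def field_simps)
      define xt where "xt = (1 - t) *\<^sub>R x0 + t *\<^sub>R x"
      have xt: "xt \<in> edom F"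
        unfolding xt_def using cf t x x0 by (auto simp: convex_on_def intro!: convexD)
      have "xt - x0 = t *\<^sub>R (x - x0)" by (simp add: xt_def algebra_simps)
      then have "norm (xt - x0) = r / 2" using t n r(1) by (simp add: n_def[symmetric] t_def)
      then have "f x0 - 1 < f xt" using r(2)[of xt] Ff[OF xt] r(1) by (simp add: dist_norm)
      also have "f xt \<le> (1 - t) * f x0 + t * f x"
        unfolding xt_def by (rule convex_onD[OF cf]) (use t x x0 in auto)
      finally have "f x0 - 1 / t \<le> f x" using t by (simp add: field_simps)
      moreover have "1 / t = 2 / r * n" using n r(1) by (simp add: t_def)
      ultimately show ?thesis unfolding Rx n_def[symmetric] by linarith
    qed
  qed
qed

lemma subdifferential_in_edom:
  assumes "proper F" "p \<in> subdifferential F x"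
  shows "x \<in> edom F"
proof -
  obtain z where "F z < \<infinity>" using assms(1) by (auto simp: proper_def edom_def)
  moreover have "F x + ereal (p \<bullet> (z - x)) \<le> F z" using assms(2) by (auto simp: subdifferential_def)
  ultimately show ?thesis by (cases "F x") (auto simp: edom_def)
qed

lemma subdifferential_iff:
  assumes "proper F"
  shows "p \<in> subdifferential F x \<longleftrightarrow> x \<in> edom F \<and>
    (\<forall>z\<in>edom F. real_of_ereal (F x) + p \<bullet> (z - x) \<le> real_of_ereal (F z))"
proof (cases "x \<in> edom F")
  case True
  have "(F x + ereal (p \<bullet> (z - x)) \<le> F z) \<longleftrightarrow>
      (z \<in> edom F \<longrightarrow> real_of_ereal (F x) + p \<bullet> (z - x) \<le> real_of_ereal (F z))" for z
  proof (cases "z \<in> edom F")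
    case z: True
    then show ?thesis
      by (subst proper_eq_ereal[OF assms True], subst proper_eq_ereal[OF assms z]) simp
  next
    case False
    then show ?thesis by (simp add: edom_def)
  qed
  then show ?thesis using True by (auto simp: subdifferential_def)
qed (use subdifferential_in_edom[OF assms] in blast)

lemma subgradient_inequality:
  assumes "proper F" "p \<in> subdifferential F x" "z \<in> edom F"
  shows "real_of_ereal (F x) + p \<bullet> (z - x) \<le> real_of_ereal (F z)"
  using assms subdifferential_iff by blast

lemma subdifferential_monotone:
  assumes "proper F" "p \<in> subdifferential F x" "q \<in> subdifferential F y"
  shows "0 \<le> (p - q) \<bullet> (x - y)"
proof -
  have "real_of_ereal (F x) + p \<bullet> (y - x) \<le> real_of_ereal (F y)"
    "real_of_ereal (F y) + q \<bullet> (x - y) \<le> real_of_ereal (F x)"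
    using assms subdifferential_iff[OF assms(1)] by auto
  then show ?thesis by (simp add: algebra_simps)
qed

text \<open>Strong convexity improves a subgradient inequality by a quadratic term: apply the inequality
  at \<open>x + t (u - x)\<close>, divide by \<open>t\<close> and let \<open>t\<close> tend to \<open>0\<close>.\<close>

lemma strongly_convex_subgradient:
  assumes "proper F" "strongly_convex \<mu> F" "p \<in> subdifferential F x" "u \<in> edom F"
  shows "real_of_ereal (F x) + p \<bullet> (u - x) + \<mu> / 2 * (norm (u - x))\<^sup>2 \<le> real_of_ereal (F u)"
proof -
  define f where "f = (\<lambda>x. real_of_ereal (F x))"
  have Ff: "F x = ereal (f x)" if "x \<in> edom F" for x
    unfolding f_def using proper_eq_ereal[OF assms(1) that] .
  have x: "x \<in> edom F" using subdifferential_in_edom assms by blast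
  have "f x + p \<bullet> (u - x) + \<mu> / 2 * (norm (u - x))\<^sup>2 \<le> f u + t * (\<mu> / 2 * (norm (u - x))\<^sup>2)"
    if t: "0 < t" "t < 1" for t
  proof -
    define w where "w = t *\<^sub>R u + (1 - t) *\<^sub>R x"
    have "F w \<le> ereal t * F u + ereal (1 - t) * F x - ereal (\<mu> * t * (1 - t) * (norm (u - x))\<^sup>2 / 2)"
      using assms(2,4) x t by (auto simp: strongly_convex_def w_def)
    then have Fw: "F w \<le> ereal (t * f u + (1 - t) * f x - \<mu> * t * (1 - t) * (norm (u - x))\<^sup>2 / 2)"
      by (simp add: Ff x assms(4))
    then have w: "w \<in> edom F" by (auto simp: edom_def intro: le_less_trans)
    have "f x + p \<bullet> (w - x) \<le> f w"
      using assms(3) w subdifferential_iff[OF assms(1)] unfolding f_def by blast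
    also have "f w \<le> t * f u + (1 - t) * f x - \<mu> * t * (1 - t) * (norm (u - x))\<^sup>2 / 2"
      using Fw by (simp add: Ff w)
    finally have le: "f x + p \<bullet> (w - x) \<le> \<dots>" .
    have "w - x = t *\<^sub>R (u - x)" by (simp add: w_def algebra_simps)
    then have pw: "p \<bullet> (w - x) = t * (p \<bullet> (u - x))" by simp
    from le[unfolded pw] have "t * (f x + p \<bullet> (u - x) + \<mu> / 2 * (norm (u - x))\<^sup>2)
        \<le> t * (f u + t * (\<mu> / 2 * (norm (u - x))\<^sup>2))"
      by (simp add: field_simps)
    then show ?thesis using t by simp
  qed
  then show ?thesis unfolding f_def by (rule le_of_le_add_scaled)
qed

text \<open>The point is the minimizer of \<open>F + \<parallel>\<cdot> - z\<parallel>\<^sup>2 / (2 s)\<close>. The quadratic term makes minimizing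
  sequences Cauchy (midpoint inequality), lower semicontinuity makes the limit a minimizer, and
  first order optimality along segments produces the subgradient.\<close>

lemma resolvent_equation_solvable:
  fixes F :: "'a::{real_inner, complete_space} \<Rightarrow> ereal"
  assumes F: "proper F" "convex_fun F" "lower_semicontinuous F" and s: "s > 0"
  obtains x p where "p \<in> subdifferential F x" "z = x + s *\<^sub>R p"
proof -
  define f where "f = (\<lambda>x. real_of_ereal (F x))"
  have Ff: "F x = ereal (f x)" if "x \<in> edom F" for x
    unfolding f_def using proper_eq_ereal[OF F(1) that] .
  have cf: "convex_on (edom F) f" unfolding f_def by (rule convex_on_edom[OF F(1,2)])
  have cdom: "convex (edom F)" using cf by (simp add: convex_on_def)
  define \<phi> where "\<phi> = (\<lambda>x. f x + (norm (x - z))\<^sup>2 / (2 * s))"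
  obtain x0 a C where C: "C \<ge> 0" "\<And>x. x \<in> edom F \<Longrightarrow> a - C * norm (x - x0) \<le> f x"
    using convex_lsc_linear_lower_bound[OF F] unfolding f_def by metis
  have lb: "a - C * norm (x0 - z) - C\<^sup>2 * s / 2 \<le> \<phi> x" if "x \<in> edom F" for x
  proof -
    define n where "n = norm (x - z)"
    have "norm (x - x0) \<le> n + norm (x0 - z)"
      unfolding n_def by (metis dist_commute dist_norm dist_triangle)
    then have "C * norm (x - x0) \<le> C * n + C * norm (x0 - z)"
      using C(1) by (metis distrib_left mult_left_mono)
    moreover have "C * n \<le> C\<^sup>2 * s / 2 + n\<^sup>2 / (2 * s)"
    proof -
      have "C\<^sup>2 * s / 2 + n\<^sup>2 / (2 * s) - C * n = (C * s - n)\<^sup>2 / (2 * s)"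
        using s by (simp add: field_simps power2_eq_square)
      also have "\<dots> \<ge> 0" using s by simp
      finally show ?thesis by simp
    qed
    ultimately show ?thesis using C(2)[OF that] by (simp add: \<phi>_def n_def[symmetric])
  qed
  define m where "m = Inf (\<phi> ` edom F)"
  have bdd: "bdd_below (\<phi> ` edom F)" using lb by (auto simp: bdd_below_def)
  have ne: "\<phi> ` edom F \<noteq> {}" using F(1) by (auto simp: proper_def)
  have m_le: "m \<le> \<phi> x" if "x \<in> edom F" for x
    unfolding m_def using bdd that by (auto intro: cInf_lower)
  have "\<exists>x. x \<in> edom F \<and> \<phi> x < m + 1 / real (Suc n)" for n
    using cInf_lessD[OF ne, of "m + 1 / real (Suc n)"] by (auto simp: m_def)
  then obtain u where u: "\<And>n. u n \<in> edom F" "\<And>n. \<phi> (u n) < m + 1 / real (Suc n)" by metis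
  have sq: "(norm (v - w))\<^sup>2 \<le> 4 * s * ((\<phi> v - m) + (\<phi> w - m))"
    if "v \<in> edom F" "w \<in> edom F" for v w
  proof -
    define h where "h = (1 - 1/2) *\<^sub>R v + (1/2::real) *\<^sub>R w"
    have h: "h \<in> edom F" unfolding h_def using cdom that by (intro convexD) auto
    have "f h \<le> (1 - 1/2) * f v + 1/2 * f w"
      unfolding h_def by (rule convex_onD[OF cf]) (use that in auto)
    moreover have hz: "(norm (h - z))\<^sup>2
        = (norm (v - z))\<^sup>2 / 2 + (norm (w - z))\<^sup>2 / 2 - (norm (v - w))\<^sup>2 / 4"
    proof -
      have "(1/2) *\<^sub>R ((v - z) + (w - z)) = (1/2) *\<^sub>R (v + w) - (1/2) *\<^sub>R (z + z)"
        by (simp only: scaleR_diff_right[symmetric]) (simp add: algebra_simps)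
      then have h: "h - z = (1/2) *\<^sub>R ((v - z) + (w - z))"
        unfolding h_def scaleR_half_double by (simp add: scaleR_add_right)
      show ?thesis unfolding h norm_half_add_square by simp
    qed
    moreover have "(norm (h - z))\<^sup>2 / (2 * s) = ((norm (v - z))\<^sup>2 / (2 * s) + (norm (w - z))\<^sup>2 / (2 * s)) / 2
        - (norm (v - w))\<^sup>2 / (8 * s)"
      unfolding hz by (simp add: add_divide_distrib diff_divide_distrib)
    ultimately have "\<phi> h \<le> (\<phi> v + \<phi> w) / 2 - (norm (v - w))\<^sup>2 / (8 * s)"
      unfolding \<phi>_def by (simp add: add_divide_distrib)
    then have "(norm (v - w))\<^sup>2 / (8 * s) \<le> (\<phi> v + \<phi> w) / 2 - m" using m_le[OF h] by linarith
    then show ?thesis using s by (simp add: field_simps)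
  qed
  have "Cauchy u"
  proof (rule metric_CauchyI)
    fix e :: real assume e: "e > 0"
    obtain N where N: "8 * s / e\<^sup>2 < real N" using reals_Archimedean2 by blast
    show "\<exists>M. \<forall>m\<ge>M. \<forall>n\<ge>M. dist (u m) (u n) < e"
    proof (intro exI[of _ N] allI impI)
      fix i j assume ij: "i \<ge> N" "j \<ge> N"
      have b: "\<phi> (u k) - m \<le> 1 / real (Suc N)" if "k \<ge> N" for k
        using u(2)[of k] that frac_le[of 1 1 "real (Suc N)" "real (Suc k)"] by auto
      have "(norm (u i - u j))\<^sup>2 \<le> 4 * s * ((\<phi> (u i) - m) + (\<phi> (u j) - m))"
        by (rule sq) (rule u)+
      also have "\<dots> \<le> 4 * s * (1 / real (Suc N) + 1 / real (Suc N))"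
        using b[OF ij(1)] b[OF ij(2)] s by (intro mult_left_mono add_mono) auto
      also have "\<dots> = 8 * s / real (Suc N)" by simp
      also have "\<dots> < e\<^sup>2" using N e s by (simp add: field_simps add_strict_increasing)
      finally show "dist (u i) (u j) < e" using e by (simp add: dist_norm power_less_imp_less_base)
    qed
  qed
  then obtain x where x: "u \<longlonglongrightarrow> x" using Cauchy_convergent_iff convergent_def by blast
  have "F x \<le> ereal (m - (norm (x - z))\<^sup>2 / (2 * s))"
  proof (rule ccontr)
    assume "\<not> ?thesis"
    then obtain c where c: "m - (norm (x - z))\<^sup>2 / (2 * s) < c" "ereal c < F x"
      by (metis ereal_dense2 ereal_less(2) less_ereal.simps(1) not_le)
    have "eventually (\<lambda>n. ereal c < F (u n)) sequentially"
      by (rule eventually_compose_filterlim[OF lower_semicontinuous_eventually[OF F(3) c(2)] x])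
    then have ev: "eventually (\<lambda>n. c \<le> m + 1 / real (Suc n) - (norm (u n - z))\<^sup>2 / (2 * s)) sequentially"
    proof eventually_elim
      case (elim n)
      then show ?case using u(2)[of n] by (simp add: Ff[OF u(1)] \<phi>_def)
    qed
    have "(\<lambda>n. m + 1 / real (Suc n) - (norm (u n - z))\<^sup>2 / (2 * s))
        \<longlonglongrightarrow> m + 0 - (norm (x - z))\<^sup>2 / (2 * s)"
      by (intro tendsto_intros x LIMSEQ_Suc[OF lim_1_over_n]) (use s in auto)
    from tendsto_lowerbound[OF this ev] c(1) show False by simp
  qed
  then have xd: "x \<in> edom F" by (auto simp: edom_def intro: le_less_trans)
  have fx: "f x \<le> m - (norm (x - z))\<^sup>2 / (2 * s)"
    using \<open>F x \<le> ereal _\<close> Ff[OF xd] by simp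
  define p where "p = (z - x) /\<^sub>R s"
  have "f x + p \<bullet> (y - x) \<le> f y" if y: "y \<in> edom F" for y
  proof (rule le_of_le_add_scaled)
    fix t :: real assume t: "0 < t" "t < 1"
    define w where "w = (1 - t) *\<^sub>R x + t *\<^sub>R y"
    have w: "w \<in> edom F" unfolding w_def using cdom t y xd by (intro convexD) auto
    have "f w \<le> (1 - t) * f x + t * f y"
      unfolding w_def by (rule convex_onD[OF cf]) (use t y xd in auto)
    moreover have wz: "(norm (w - z))\<^sup>2
        = (norm (x - z))\<^sup>2 - 2 * t * ((z - x) \<bullet> (y - x)) + t\<^sup>2 * (norm (y - x))\<^sup>2"
    proof -
      have w: "w - z = t *\<^sub>R (y - x) - (z - x)" and x: "x - z = - (z - x)"
        by (simp_all add: w_def algebra_simps)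
      show ?thesis
        unfolding w x norm_minus_cancel
        by (simp add: power2_norm_eq_inner inner_diff_left inner_diff_right inner_commute)
          (simp add: algebra_simps power2_eq_square)
    qed
    moreover have "f x + (norm (x - z))\<^sup>2 / (2 * s) \<le> f w + (norm (w - z))\<^sup>2 / (2 * s)"
      using m_le[OF w] fx by (simp add: \<phi>_def)
    moreover have "(norm (w - z))\<^sup>2 / (2 * s)
        = (norm (x - z))\<^sup>2 / (2 * s) - t * (p \<bullet> (y - x)) + t * (t * ((norm (y - x))\<^sup>2 / (2 * s)))"
    proof -
      have e: "(n - 2 * t * q + t\<^sup>2 * m) / (2 * s) = n / (2 * s) - t * (q / s) + t * (t * (m / (2 * s)))"
        for n q m :: real
        using s by (simp add: field_simps power2_eq_square)
      have "p \<bullet> (y - x) = ((z - x) \<bullet> (y - x)) / s" unfolding p_def inner_scaleR_left by (simp only: divide_inverse mult.commute)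
      then show ?thesis unfolding wz e by simp
    qed
    ultimately have "t * (f x + p \<bullet> (y - x)) \<le> t * (f y + t * ((norm (y - x))\<^sup>2 / (2 * s)))"
      by (simp add: algebra_simps)
    then show "f x + p \<bullet> (y - x) \<le> f y + t * ((norm (y - x))\<^sup>2 / (2 * s))" using t by simp
  qed
  then have "p \<in> subdifferential F x" using xd subdifferential_iff[OF F(1)] by (auto simp: f_def)
  moreover have "z = x + s *\<^sub>R p" using s by (simp add: p_def)
  ultimately show ?thesis by (rule that)
qed

lemma resolvent_subdifferential:
  fixes F :: "'a::{real_inner, complete_space} \<Rightarrow> ereal"
  assumes F: "proper F" "convex_fun F" "lower_semicontinuous F" and s: "s > 0"
  shows "(z - resolvent s (subdifferential F) z) /\<^sub>R s
    \<in> subdifferential F (resolvent s (subdifferential F) z)"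
proof -
  obtain x p where xp: "p \<in> subdifferential F x" "z = x + s *\<^sub>R p"
    using resolvent_equation_solvable[OF F s] .
  have "\<exists>!x. \<exists>p\<in>subdifferential F x. z = x + s *\<^sub>R p"
  proof (intro ex1I[of _ x])
    show "\<exists>p\<in>subdifferential F x. z = x + s *\<^sub>R p" using xp by blast
  next
    fix y assume "\<exists>p\<in>subdifferential F y. z = y + s *\<^sub>R p"
    then obtain q where q: "q \<in> subdifferential F y" "z = y + s *\<^sub>R q" by blast
    have "y - x = s *\<^sub>R (p - q)" using xp(2) q(2) by (simp add: algebra_simps)
    moreover have "0 \<le> (p - q) \<bullet> (x - y)" by (rule subdifferential_monotone[OF F(1) xp(1) q(1)])
    ultimately have "s * ((p - q) \<bullet> (p - q)) \<le> 0"
      by (metis inner_minus_right inner_scaleR_right minus_diff_eq neg_0_le_iff_le)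
    then have "p = q" using s by (simp add: mult_le_0_iff) (metis eq_iff_diff_eq_0 inner_ge_zero inner_eq_zero_iff order_antisym)
    then show "y = x" using \<open>y - x = s *\<^sub>R (p - q)\<close> by simp
  qed
  then have "\<exists>p\<in>subdifferential F (resolvent s (subdifferential F) z).
      z = resolvent s (subdifferential F) z + s *\<^sub>R p"
    unfolding resolvent_def by (rule theI')
  then obtain p where "p \<in> subdifferential F (resolvent s (subdifferential F) z)"
    "z = resolvent s (subdifferential F) z + s *\<^sub>R p" by blast
  moreover from this(2) have "z - resolvent s (subdifferential F) z = s *\<^sub>R p"
    by (metis add_diff_cancel_left')
  ultimately show ?thesis using s by simp
qed

text \<open>Minty's argument: by surjectivity of \<open>id + \<partial>F\<close> some pair \<open>(r, g)\<close> in the graph of \<open>\<partial>F\<close> has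
  \<open>r + g = x + p\<close>, and monotonicity between \<open>(x, p)\<close> and \<open>(r, g)\<close> makes the two pairs equal.\<close>

lemma subdifferential_maximal_monotone:
  fixes F :: "'a::{real_inner, complete_space} \<Rightarrow> ereal"
  assumes F: "proper F" "convex_fun F" "lower_semicontinuous F"
    and mono: "\<And>r g. g \<in> subdifferential F r \<Longrightarrow> 0 \<le> (p - g) \<bullet> (x - r)"
  shows "p \<in> subdifferential F x"
proof -
  obtain r g where rg: "g \<in> subdifferential F r" "x + p = r + 1 *\<^sub>R g"
    using resolvent_equation_solvable[OF F zero_less_one] .
  then have "x - r = - (p - g)" by (simp add: algebra_simps)
  then have "(p - g) \<bullet> (p - g) \<le> 0" using mono[OF rg(1)] by (metis inner_minus_right neg_0_le_iff_le)
  then have "p = g" by (metis eq_iff_diff_eq_0 inner_ge_zero inner_eq_zero_iff order_antisym)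
  then show ?thesis using rg by simp
qed

section \<open>Hilbert space duality and weak compactness\<close>

lemma lower_semicontinuous_continuous:
  fixes f :: "'a::t2_space \<Rightarrow> real"
  assumes "continuous_on UNIV f"
  shows "lower_semicontinuous (\<lambda>x. ereal (f x))"
  unfolding lower_semicontinuous_def
proof
  fix x
  show "ereal (f x) \<le> Liminf (at x) (\<lambda>x. ereal (f x))"
  proof (cases "at x = bot")
    case False
    have "(f \<longlongrightarrow> f x) (at x)"
      using assms by (simp add: continuous_on_eq_continuous_at isCont_def)
    then have "((\<lambda>x. ereal (f x)) \<longlongrightarrow> ereal (f x)) (at x)" by (rule tendsto_ereal)
    from lim_imp_Liminf[OF _ this] False show ?thesis by simp
  qed simp
qed

text \<open>The resolvent equation for the linear function \<open>- f\<close> at \<open>0\<close> already is the representation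
  of \<open>f\<close>: its subgradient \<open>- x\<close> must be the constant slope of \<open>- f\<close>.\<close>

lemma Riesz_representation:
  fixes f :: "'a::{real_inner, complete_space} \<Rightarrow> real"
  assumes "bounded_linear f"
  shows "\<exists>r. \<forall>h. f h = r \<bullet> h"
proof -
  interpret bounded_linear f by fact
  define F where "F = (\<lambda>x. ereal (- f x))"
  have dom: "edom F = UNIV" by (auto simp: edom_def F_def)
  have pr: "proper F" unfolding proper_def dom by (auto simp: F_def)
  moreover have "convex_fun F"
    by (auto simp: convex_fun_def F_def add scaleR)
  moreover have "lower_semicontinuous F"
    unfolding F_def
    by (intro lower_semicontinuous_continuous continuous_intros linear_continuous_on bounded_linear_axioms)
  ultimately obtain r p where rp: "p \<in> subdifferential F r" "0 = r + 1 *\<^sub>R p"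
    using resolvent_equation_solvable[OF _ _ _ zero_less_one] by metis
  then have p: "p = - r" by (metis add.inverse_unique scaleR_one)
  have "f h \<le> r \<bullet> h" for h
  proof -
    have "- f r + p \<bullet> (r + h - r) \<le> - f (r + h)"
      using subgradient_inequality[OF pr rp(1), of "r + h"] by (simp add: dom) (simp add: F_def)
    then show ?thesis by (simp add: p add)
  qed
  note le = this
  have "f h = r \<bullet> h" for h
    using le[of h] le[of "- h"] by (simp add: neg)
  then show ?thesis by blast
qed

lemma weakly_tendsto_iff_inner:
  fixes u :: "nat \<Rightarrow> 'a::{real_inner, complete_space}"
  shows "weakly_tendsto u l \<longleftrightarrow> (\<forall>h. (\<lambda>n. u n \<bullet> h) \<longlonglongrightarrow> l \<bullet> h)"
proof
  assume "weakly_tendsto u l"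
  then show "\<forall>h. (\<lambda>n. u n \<bullet> h) \<longlonglongrightarrow> l \<bullet> h"
    unfolding weakly_tendsto_def by (intro allI) (drule spec, erule mp, rule bounded_linear_inner_left)
next
  assume *: "\<forall>h. (\<lambda>n. u n \<bullet> h) \<longlonglongrightarrow> l \<bullet> h"
  show "weakly_tendsto u l"
    unfolding weakly_tendsto_def
  proof (intro allI impI)
    fix f :: "'a \<Rightarrow> real" assume "bounded_linear f"
    then obtain r where "\<forall>h. f h = r \<bullet> h" using Riesz_representation by blast
    then show "(\<lambda>n. f (u n)) \<longlonglongrightarrow> f l" using * by (simp add: inner_commute[of r])
  qed
qed

lemma adjoint_inner:
  fixes K :: "'a::{real_inner, complete_space} \<Rightarrow> 'b::real_inner"
  assumes "bounded_linear K"
  shows "K x \<bullet> y = x \<bullet> adjoint K y"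
proof -
  have "\<exists>r. \<forall>x. K x \<bullet> y = x \<bullet> r" for y
  proof -
    have "bounded_linear (\<lambda>x. K x \<bullet> y)"
      using bounded_linear_compose[OF bounded_linear_inner_left assms] .
    from Riesz_representation[OF this] obtain r where "\<forall>h. K h \<bullet> y = r \<bullet> h" ..
    then show ?thesis by (auto simp: inner_commute)
  qed
  then obtain K' where "\<forall>x y. K x \<bullet> y = x \<bullet> K' y" by metis
  then have "\<forall>x y. K x \<bullet> y = x \<bullet> adjoint K y"
    unfolding adjoint_def by (rule someI[of "\<lambda>K'. \<forall>x y. K x \<bullet> y = x \<bullet> K' y"])
  then show ?thesis by blast
qed

lemma norm_adjoint_le:
  fixes K :: "'a::{real_inner, complete_space} \<Rightarrow> 'b::real_inner"
  assumes "bounded_linear K"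
  shows "norm (adjoint K y) \<le> onorm K * norm y"
proof (cases "adjoint K y = 0")
  case True
  then show ?thesis using onorm_pos_le[OF assms] by simp
next
  case False
  have "norm (adjoint K y) * norm (adjoint K y) = K (adjoint K y) \<bullet> y"
    by (simp add: adjoint_inner[OF assms] flip: power2_norm_eq_inner power2_eq_square)
  also have "\<dots> \<le> norm (K (adjoint K y)) * norm y" by (rule norm_cauchy_schwarz)
  also have "\<dots> \<le> (onorm K * norm (adjoint K y)) * norm y"
    by (intro mult_right_mono onorm[OF assms]) simp
  finally have "norm (adjoint K y) * norm (adjoint K y) \<le> norm (adjoint K y) * (onorm K * norm y)"
    by (simp add: ac_simps)
  then show ?thesis using False by simp
qed

lemma bounded_linear_adjoint:
  fixes K :: "'a::{real_inner, complete_space} \<Rightarrow> 'b::real_inner"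
  assumes "bounded_linear K"
  shows "bounded_linear (adjoint K)"
proof (rule bounded_linear_intro)
  fix x y :: 'b and r :: real
  note ai = adjoint_inner[OF assms, symmetric]
  have "z \<bullet> adjoint K (x + y) = z \<bullet> (adjoint K x + adjoint K y)" for z
    by (simp add: ai inner_add_right)
  then show "adjoint K (x + y) = adjoint K x + adjoint K y" by (metis vector_eq_ldot)
  have "z \<bullet> adjoint K (r *\<^sub>R x) = z \<bullet> (r *\<^sub>R adjoint K x)" for z
    by (simp add: ai)
  then show "adjoint K (r *\<^sub>R x) = r *\<^sub>R adjoint K x" by (metis vector_eq_ldot)
  show "norm (adjoint K x) \<le> norm x * onorm K"
    using norm_adjoint_le[OF assms] by (simp add: mult.commute)
qed

text \<open>The function \<open>s / 2 * \<parallel>K x\<parallel>\<^sup>2\<close> has the gradient \<open>s K\<^sup>* K x\<close>, so that inverting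
  \<open>id + s K\<^sup>* K\<close> is a resolvent equation.\<close>

lemma surj_id_plus_normal_operator:
  fixes K :: "'a::{real_inner, complete_space} \<Rightarrow> 'b::real_inner"
  assumes K: "bounded_linear K" and s: "s > 0"
  shows "surj (\<lambda>u. u + s *\<^sub>R adjoint K (K u))"
proof -
  interpret bounded_linear K by fact
  define F where "F = (\<lambda>x. ereal (s / 2 * (norm (K x))\<^sup>2))"
  have dom: "edom F = UNIV" by (auto simp: edom_def F_def)
  have pr: "proper F" unfolding proper_def dom by (auto simp: F_def)
  moreover have "convex_fun F"
    unfolding convex_fun_def
  proof (intro allI ballI)
    fix x y and t :: real assume t: "t \<in> {0..1}"
    have "(norm (K (t *\<^sub>R x + (1 - t) *\<^sub>R y)))\<^sup>2 \<le> t * (norm (K x))\<^sup>2 + (1 - t) * (norm (K y))\<^sup>2"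
      using convex_onD[OF convex_on_norm_square, of "1 - t" "K x" "K y"] t by (simp add: add scaleR)
    moreover have e: "s / 2 * (t * a + (1 - t) * b) = t * (s / 2 * a) + (1 - t) * (s / 2 * b)" for a b
      by (simp add: field_simps)
    ultimately have "s / 2 * (norm (K (t *\<^sub>R x + (1 - t) *\<^sub>R y)))\<^sup>2
        \<le> t * (s / 2 * (norm (K x))\<^sup>2) + (1 - t) * (s / 2 * (norm (K y))\<^sup>2)"
      using s unfolding e[symmetric] by (intro mult_left_mono) auto
    then show "F (t *\<^sub>R x + (1 - t) *\<^sub>R y) \<le> ereal t * F x + ereal (1 - t) * F y"
      by (simp add: F_def)
  qed
  moreover have "lower_semicontinuous F"
    unfolding F_def
    by (intro lower_semicontinuous_continuous continuous_intros linear_continuous_on bounded_linear_axioms)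
  ultimately have F: "proper F" "convex_fun F" "lower_semicontinuous F" by blast+
  have "\<exists>x. b = x + s *\<^sub>R adjoint K (K x)" for b
  proof -
    obtain x p where xp: "p \<in> subdifferential F x" "b = x + 1 *\<^sub>R p"
      using resolvent_equation_solvable[OF F zero_less_one] .
    have le: "p \<bullet> h \<le> s * (K x \<bullet> K h)" for h
    proof (rule le_of_le_add_scaled)
      fix t :: real assume t: "0 < t" "t < 1"
      have "s / 2 * (norm (K x))\<^sup>2 + p \<bullet> (x + t *\<^sub>R h - x) \<le> s / 2 * (norm (K (x + t *\<^sub>R h)))\<^sup>2"
        using subgradient_inequality[OF pr xp(1), unfolded dom, OF UNIV_I, of "x + t *\<^sub>R h"]
        unfolding F_def real_of_ereal.simps .
      also have "s / 2 * (norm (K (x + t *\<^sub>R h)))\<^sup>2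
          = s / 2 * (norm (K x))\<^sup>2 + t * (s * (K x \<bullet> K h)) + t * (t * (s / 2 * (norm (K h))\<^sup>2))"
      proof -
        have "(norm (v + t *\<^sub>R w))\<^sup>2 = (norm v)\<^sup>2 + 2 * t * (v \<bullet> w) + t\<^sup>2 * (norm w)\<^sup>2" for v w :: 'b
          unfolding power2_norm_eq_inner
          by (simp add: inner_add_left inner_add_right inner_commute[of w v] power2_eq_square distrib_left)
        then show ?thesis unfolding add scaleR by (simp add: distrib_left power2_eq_square)
      qed
      finally have "t * (p \<bullet> h) \<le> t * (s * (K x \<bullet> K h) + t * (s / 2 * (norm (K h))\<^sup>2))"
        by (simp add: algebra_simps)
      then show "p \<bullet> h \<le> s * (K x \<bullet> K h) + t * (s / 2 * (norm (K h))\<^sup>2)" using t by simp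
    qed
    have "p \<bullet> h = (s *\<^sub>R adjoint K (K x)) \<bullet> h" for h
    proof -
      have "p \<bullet> h = s * (K x \<bullet> K h)" using le[of h] le[of "- h"] by (simp add: neg)
      also have "\<dots> = s * (K h \<bullet> K x)" by (simp add: inner_commute)
      finally show ?thesis by (simp add: adjoint_inner[OF K] inner_commute)
    qed
    then have "p = s *\<^sub>R adjoint K (K x)" by (metis vector_eq_rdot)
    then show ?thesis using xp(2) by auto
  qed
  then show ?thesis unfolding surj_def by blast
qed

text \<open>Weak compactness of balls, for filters instead of sequences: the functionals \<open>\<langle>u n, \<cdot>\<rangle>\<close> lie in
  a product of compact intervals, and a cluster point of them is linear and bounded, hence
  represented by a vector. Filters avoid the extraction of subsequences, which in a
  non-separable space would need a detour through the closed span of the sequence.\<close>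

lemma weak_cluster_point:
  fixes u :: "'i \<Rightarrow> 'a::{real_inner, complete_space}"
  assumes bound: "\<And>n. norm (u n) \<le> C" and F: "F \<noteq> bot"
  obtains G l where "G \<le> F" "G \<noteq> bot" "\<And>h. ((\<lambda>n. u n \<bullet> h) \<longlongrightarrow> l \<bullet> h) G"
proof -
  define P where "P = (\<Pi>\<^sub>E h\<in>(UNIV::'a set). {- C * norm h..C * norm h})"
  define U where "U n h = u n \<bullet> h" for n and h :: 'a
  have "compactin (product_topology (\<lambda>h::'a. euclideanreal) UNIV) P"
    unfolding P_def compactin_PiE by simp
  then have "compact P" by (simp add: euclidean_product_topology)
  moreover have UP: "U n \<in> P" for n
  proof -
    have "\<bar>u n \<bullet> h\<bar> \<le> C * norm h" for h
      by (rule order_trans[OF Cauchy_Schwarz_ineq2]) (simp add: bound mult_right_mono)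
    then show ?thesis by (auto simp: P_def U_def abs_le_iff minus_le_iff)
  qed
  ultimately obtain g where g: "g \<in> P" "inf (nhds g) (filtermap U F) \<noteq> bot"
    using F compact_filter[of P] by (metis (mono_tags, lifting) eventually_filtermap eventually_True
        always_eventually filtermap_bot_iff)
  \<comment> \<open>pull the neighbourhoods of the cluster point back to the index set\<close>
  define G where "G = inf (filtercomap U (nhds g)) F"
  have GF: "G \<le> F" by (simp add: G_def)
  have Gb: "G \<noteq> bot"
  proof
    assume "G = bot"
    then have "eventually (\<lambda>_. False) G" by simp
    then obtain Q R where "eventually Q (filtercomap U (nhds g))" "eventually R F"
      and QR: "\<forall>n. Q n \<and> R n \<longrightarrow> False"
      unfolding G_def eventually_inf by blast
    then obtain Q' where Q': "eventually Q' (nhds g)" "\<forall>n. Q' (U n) \<longrightarrow> Q n"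
      unfolding eventually_filtercomap by blast
    have "eventually (\<lambda>v. \<exists>n. R n \<and> v = U n) (filtermap U F)"
      unfolding eventually_filtermap using \<open>eventually R F\<close> by (rule eventually_mono) blast
    then have "eventually (\<lambda>v. False) (inf (nhds g) (filtermap U F))"
      unfolding eventually_inf using Q' QR by blast
    then show False using g(2) by (simp add: eventually_False)
  qed
  have lim: "((\<lambda>n. u n \<bullet> h) \<longlongrightarrow> g h) G" for h
  proof -
    have "filterlim U (nhds g) G"
      unfolding G_def by (rule filterlim_mono[OF filterlim_filtercomap order_refl]) simp
    then have "((\<lambda>n. U n h) \<longlongrightarrow> g h) G"
      by (rule continuous_on_tendsto_compose[OF continuous_on_product_coordinates]) auto
    then show ?thesis by (simp add: U_def)
  qed
  have "bounded_linear g"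
  proof (rule bounded_linear_intro)
    fix h k and r :: real
    show "g (h + k) = g h + g k"
      using tendsto_unique[OF Gb lim[of "h + k"]] tendsto_add[OF lim[of h] lim[of k]]
      by (simp add: inner_add_right)
    show "g (r *\<^sub>R h) = r *\<^sub>R g h"
      using tendsto_unique[OF Gb lim[of "r *\<^sub>R h"]] tendsto_mult_left[OF lim[of h], of r] by simp
    show "norm (g h) \<le> norm h * C"
      using g(1) by (auto simp: P_def abs_le_iff mult.commute minus_le_iff)
  qed
  from Riesz_representation[OF this] obtain l where "\<forall>h. g h = l \<bullet> h" ..
  then show ?thesis using that[OF GF Gb, of l] lim by simp
qed

text \<open>Otherwise some inner product stays away from its limit for infinitely many indices, and a weak
  cluster point along these indices differs from \<open>l\<close>.\<close>

lemma weakly_tendsto_of_unique_cluster_point: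
  fixes u :: "nat \<Rightarrow> 'a::{real_inner, complete_space}"
  assumes bound: "\<And>n. norm (u n) \<le> C"
    and uniq: "\<And>G m. G \<le> sequentially \<Longrightarrow> G \<noteq> bot \<Longrightarrow> (\<And>h. ((\<lambda>n. u n \<bullet> h) \<longlongrightarrow> m \<bullet> h) G) \<Longrightarrow> m = l"
  shows "weakly_tendsto u l"
  unfolding weakly_tendsto_iff_inner
proof (intro allI, rule ccontr)
  fix h assume "\<not> (\<lambda>n. u n \<bullet> h) \<longlonglongrightarrow> l \<bullet> h"
  then obtain e where e: "e > 0" "\<not> eventually (\<lambda>n. dist (u n \<bullet> h) (l \<bullet> h) < e) sequentially"
    by (auto simp: tendsto_iff)
  define F where "F = inf sequentially (principal {n. \<not> dist (u n \<bullet> h) (l \<bullet> h) < e})"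
  have "F \<noteq> bot"
    using e(2) unfolding F_def trivial_limit_def eventually_inf_principal by simp
  then obtain G m where G: "G \<le> F" "G \<noteq> bot" "\<And>h. ((\<lambda>n. u n \<bullet> h) \<longlongrightarrow> m \<bullet> h) G"
    using weak_cluster_point[of u C F] bound by blast
  have "m = l" by (rule uniq[OF _ G(2,3)]) (use G(1) in \<open>simp add: F_def\<close>)
  then have "eventually (\<lambda>n. dist (u n \<bullet> h) (l \<bullet> h) < e) G"
    using G(3)[of h] e(1) by (auto simp: tendsto_iff)
  moreover have "eventually (\<lambda>n. \<not> dist (u n \<bullet> h) (l \<bullet> h) < e) G"
    by (rule filter_leD[OF G(1)]) (simp add: F_def eventually_inf_principal)
  ultimately have "eventually (\<lambda>n. False) G" by eventually_elim simp
  then show False using G(2) by (simp add: eventually_False)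
qed

text \<open>Boundedness of \<open>b\<close> controls the error of replacing \<open>a\<close> by its limit. It is a separate hypothesis
  because along a filter weak convergence does not entail boundedness.\<close>

lemma tendsto_inner_strong_weak:
  fixes a b :: "'i \<Rightarrow> 'a::real_inner"
  assumes "(a \<longlongrightarrow> a0) F" and "eventually (\<lambda>n. norm (b n) \<le> C) F"
    and weak: "\<And>h. ((\<lambda>n. b n \<bullet> h) \<longlongrightarrow> b0 \<bullet> h) F"
  shows "((\<lambda>n. a n \<bullet> b n) \<longlongrightarrow> a0 \<bullet> b0) F"
proof -
  have "((\<lambda>n. (a n - a0) \<bullet> b n) \<longlongrightarrow> 0) F"
  proof (rule tendsto_0_le[where K = C])
    show "((\<lambda>n. a n - a0) \<longlongrightarrow> 0) F" by (rule LIM_zero[OF assms(1)])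
    show "eventually (\<lambda>n. norm ((a n - a0) \<bullet> b n) \<le> norm (a n - a0) * C) F"
      using assms(2)
    proof eventually_elim
      case (elim n)
      have "norm ((a n - a0) \<bullet> b n) \<le> norm (a n - a0) * norm (b n)"
        unfolding real_norm_def by (rule Cauchy_Schwarz_ineq2)
      also have "\<dots> \<le> norm (a n - a0) * C" using elim by (simp add: mult_left_mono)
      finally show ?case .
    qed
  qed
  from tendsto_add[OF this weak[of a0]] show ?thesis
    by (simp add: inner_diff_left inner_commute[of _ a0])
qed


section \<open>Algebra of one iteration\<close>

text \<open>Testing the two update relations with \<open>U1\<close> and \<open>V1\<close> makes the coupling terms in \<open>K\<close> cancel,
  because the operator matrix with rows \<open>(1, K\<^sup>*)\<close> and \<open>(- s K, 1)\<close> is skew up to the identity in the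
  inner product weighted by \<open>(s, 1)\<close>. For \<open>r = 1\<close> this is the firm nonexpansiveness of the
  Douglas--Rachford operator; the last line is the price of acceleration.\<close>

lemma douglas_rachford_step_identity:
  fixes K :: "'a::real_inner \<Rightarrow> 'b::real_inner" and K' :: "'b \<Rightarrow> 'a" and r s :: real
  assumes K: "bounded_linear K" and K': "bounded_linear K'"
    and adj: "\<And>x y. K x \<bullet> y = x \<bullet> K' y"
    and up1: "U1 + K' V1 = r *\<^sub>R (W + K' C)"
    and up2: "V1 - s *\<^sub>R K U1 = Z - s *\<^sub>R K A"
    and U: "U = W + A" and V: "V = Z + C"
  shows "s * (A \<bullet> W) + Z \<bullet> C
    = (s * (norm U)\<^sup>2 + (norm V)\<^sup>2) / 2 - (s * (norm U1)\<^sup>2 + (norm V1)\<^sup>2) / 2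
      - (s * (norm (U - U1))\<^sup>2 + (norm (V - V1))\<^sup>2) / 2
      + (r - 1) * (s * (W \<bullet> (W - (U - U1)) + (V - V1) \<bullet> K (W - (U - U1))
                         + s * (norm (K (W - (U - U1))))\<^sup>2))"
proof -
  interpret K: bounded_linear K by fact
  have "V1 \<bullet> K U1 = U1 \<bullet> K' V1" by (metis adj inner_commute)
  then have t1: "s * (U1 \<bullet> U1) + V1 \<bullet> V1 = s * (U1 \<bullet> (U1 + K' V1)) + V1 \<bullet> (V1 - s *\<^sub>R K U1)"
    by (simp add: inner_add_right inner_diff_right distrib_left)
  have t2: "U1 \<bullet> (U1 + K' V1) = r * (U1 \<bullet> W + K U1 \<bullet> C)"
    unfolding up1 by (simp add: inner_add_right adj)
  have t3: "V1 \<bullet> (V1 - s *\<^sub>R K U1) = V1 \<bullet> Z - s * (V1 \<bullet> K A)"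
    unfolding up2 by (simp add: inner_diff_right)
  have t4: "V1 \<bullet> K A = r * (A \<bullet> W + K A \<bullet> C) - A \<bullet> U1"
  proof -
    have "K' V1 = r *\<^sub>R (W + K' C) - U1" using up1 by (metis add_diff_cancel_left')
    then have "A \<bullet> K' V1 = r * (A \<bullet> W + A \<bullet> K' C) - A \<bullet> U1"
      by (simp add: inner_diff_right inner_add_right)
    then show ?thesis by (simp add: adj[symmetric] inner_commute)
  qed
  have KUC: "s * (K U1 \<bullet> C) = V1 \<bullet> C - Z \<bullet> C + s * (K A \<bullet> C)"
  proof -
    have "s *\<^sub>R K U1 = V1 - Z + s *\<^sub>R K A" using up2 by (simp add: algebra_simps)
    then have "(s *\<^sub>R K U1) \<bullet> C = (V1 - Z + s *\<^sub>R K A) \<bullet> C" by simp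
    then show ?thesis by (simp add: inner_add_left inner_diff_left)
  qed
  have sq: "s * (U1 \<bullet> U1) + V1 \<bullet> V1
      = r * (s * (U1 \<bullet> W) + s * (K U1 \<bullet> C) - s * (A \<bullet> W) - s * (K A \<bullet> C)) + V1 \<bullet> Z + s * (A \<bullet> U1)"
    unfolding t1 t2 t3 t4 by (simp add: distrib_left right_diff_distrib)
  have KUA: "W - (U - U1) = U1 - A" by (simp add: U)
  have VZ: "V1 - Z = s *\<^sub>R K (U1 - A)" using up2 by (simp add: K.diff algebra_simps)
  have "C = (V - V1) + s *\<^sub>R K (U1 - A)" unfolding VZ[symmetric] by (simp add: V)
  then have t5: "C \<bullet> K (U1 - A) = (V - V1) \<bullet> K (U1 - A) + s * (norm (K (U1 - A)))\<^sup>2"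
    by (metis inner_add_left inner_scaleR_left power2_norm_eq_inner)
  have t6: "s * (C \<bullet> K (U1 - A)) = s * (K U1 \<bullet> C) - s * (K A \<bullet> C)"
    by (simp add: K.diff inner_diff_right inner_commute algebra_simps)
  have t7: "W \<bullet> (U1 - A) = U1 \<bullet> W - A \<bullet> W" by (simp add: inner_diff_right inner_commute)
  have price: "s * (W \<bullet> (U1 - A) + (V - V1) \<bullet> K (U1 - A) + s * (norm (K (U1 - A)))\<^sup>2)
      = s * (U1 \<bullet> W) - s * (A \<bullet> W) + (s * (K U1 \<bullet> C) - s * (K A \<bullet> C))"
    unfolding t6[symmetric] t5 t7 by (simp add: distrib_left right_diff_distrib)
  have half: "(norm a)\<^sup>2 / 2 - (norm b)\<^sup>2 / 2 - (norm (a - b))\<^sup>2 / 2 = b \<bullet> a - b \<bullet> b" for a b :: "'c::real_inner"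
    by (simp add: power2_norm_eq_inner inner_diff_left inner_diff_right inner_commute[of a b]
      diff_divide_distrib add_divide_distrib)
  have "(s * (norm U)\<^sup>2 + (norm V)\<^sup>2) / 2 - (s * (norm U1)\<^sup>2 + (norm V1)\<^sup>2) / 2
      - (s * (norm (U - U1))\<^sup>2 + (norm (V - V1))\<^sup>2) / 2
      = s * ((norm U)\<^sup>2 / 2 - (norm U1)\<^sup>2 / 2 - (norm (U - U1))\<^sup>2 / 2)
        + ((norm V)\<^sup>2 / 2 - (norm V1)\<^sup>2 / 2 - (norm (V - V1))\<^sup>2 / 2)"
    by (simp add: field_simps)
  also have "\<dots> = s * (U1 \<bullet> U) + V1 \<bullet> V - (s * (U1 \<bullet> U1) + V1 \<bullet> V1)"
    unfolding half by (simp add: algebra_simps)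
  also have "s * (U1 \<bullet> U) + V1 \<bullet> V = s * (U1 \<bullet> W) + s * (A \<bullet> U1) + V1 \<bullet> Z + V1 \<bullet> C"
    unfolding U V by (simp add: inner_add_right inner_commute[of U1 A] algebra_simps)
  finally show ?thesis
    unfolding KUA price sq KUC by (simp add: algebra_simps)
qed

text \<open>The price of acceleration is a quadratic form in \<open>W\<close> and the increments \<open>D\<close>, \<open>E\<close>. Only its
  part in \<open>W\<close> alone needs a sharp constant; mixed terms go into the increments by Young's
  inequality.\<close>

lemma acceleration_price_bound:
  fixes K :: "'a::real_inner \<Rightarrow> 'b::real_inner" and s \<mu> :: real
  assumes K: "bounded_linear K" and s: "s \<ge> 0" and \<mu>: "\<mu> > 0"
  obtains M where "M \<ge> 0"
    "\<And>W D E. W \<bullet> (W - D) + E \<bullet> K (W - D) + s * (norm (K (W - D)))\<^sup>2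
       \<le> (1 + s * (onorm K)\<^sup>2 + \<mu>) * (norm W)\<^sup>2 + M * ((norm D)\<^sup>2 + (norm E)\<^sup>2)"
proof -
  define k where "k = onorm K"
  have k: "k \<ge> 0" unfolding k_def by (rule onorm_pos_le[OF K])
  define c where "c = 1 + 2 * s * k\<^sup>2"
  define M where "M = c\<^sup>2 / (2 * \<mu>) + s * k\<^sup>2 + k\<^sup>2 / (2 * \<mu>) + k"
  have M: "M \<ge> 0" unfolding M_def using k s \<mu> by simp
  have young: "c * (a * b) \<le> \<mu> / 2 * a\<^sup>2 + c\<^sup>2 / (2 * \<mu>) * b\<^sup>2" for a b c :: real
  proof -
    have "\<mu> / 2 * a\<^sup>2 + c\<^sup>2 / (2 * \<mu>) * b\<^sup>2 - c * (a * b) = (\<mu> * a - c * b)\<^sup>2 / (2 * \<mu>)"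
      using \<mu> by (simp add: field_simps power2_eq_square)
    also have "\<dots> \<ge> 0" using \<mu> by simp
    finally show ?thesis by simp
  qed
  show ?thesis
  proof (rule that[OF M])
    fix W D :: 'a and E :: 'b
    define a b e where "a = norm W" and "b = norm D" and "e = norm E"
    have nn: "a \<ge> 0" "b \<ge> 0" "e \<ge> 0" by (auto simp: a_def b_def e_def)
    have nK: "norm (K (W - D)) \<le> k * (a + b)"
      unfolding k_def a_def b_def
      by (rule order_trans[OF onorm[OF K]])
        (intro mult_left_mono norm_triangle_ineq4 onorm_pos_le[OF K])
    have "W \<bullet> (W - D) \<le> a\<^sup>2 + a * b"
      unfolding a_def b_def inner_diff_right power2_norm_eq_inner
      using Cauchy_Schwarz_ineq2[of W D] by linarith
    moreover have "E \<bullet> K (W - D) \<le> e * (k * (a + b))"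
      unfolding e_def by (rule order_trans[OF norm_cauchy_schwarz]) (intro mult_left_mono nK; simp)
    moreover have "s * (norm (K (W - D)))\<^sup>2 \<le> s * (k * (a + b))\<^sup>2"
      using nK s by (intro mult_left_mono power_mono) auto
    ultimately have "W \<bullet> (W - D) + E \<bullet> K (W - D) + s * (norm (K (W - D)))\<^sup>2
        \<le> (1 + s * k\<^sup>2) * a\<^sup>2 + c * (a * b) + s * k\<^sup>2 * b\<^sup>2 + k * (a * e) + k * (e * b)"
      unfolding c_def by (simp add: algebra_simps power2_eq_square)
    moreover have "k * (e * b) \<le> k * (b\<^sup>2 + e\<^sup>2)"
    proof (intro mult_left_mono k)
      have "2 * (e * b) \<le> b\<^sup>2 + e\<^sup>2" using sum_squares_bound[of e b] by (simp add: algebra_simps)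
      moreover have "0 \<le> e * b" using nn by simp
      ultimately show "e * b \<le> b\<^sup>2 + e\<^sup>2" by linarith
    qed
    moreover have "(c\<^sup>2 / (2 * \<mu>) + s * k\<^sup>2 + k) * b\<^sup>2 \<le> M * b\<^sup>2"
      "(k\<^sup>2 / (2 * \<mu>) + k) * e\<^sup>2 \<le> M * e\<^sup>2"
      unfolding M_def using k s \<mu> by (intro mult_right_mono; simp)+
    ultimately show "W \<bullet> (W - D) + E \<bullet> K (W - D) + s * (norm (K (W - D)))\<^sup>2
       \<le> (1 + s * (onorm K)\<^sup>2 + \<mu>) * (norm W)\<^sup>2 + M * ((norm D)\<^sup>2 + (norm E)\<^sup>2)"
      unfolding k_def[symmetric] a_def[symmetric] b_def[symmetric] e_def[symmetric]
      using young[of c a b] young[of k a e] by (simp add: algebra_simps)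
  qed
qed

section \<open>The accelerated Douglas--Rachford iteration\<close>

locale accelerated_douglas_rachford =
  fixes K :: "'a::{real_inner, complete_space} \<Rightarrow> 'b::{real_inner, complete_space}"
    and F :: "'a \<Rightarrow> ereal" and G :: "'b \<Rightarrow> ereal"
    and \<gamma>1 \<gamma> :: real and \<sigma> \<tau> \<theta> :: "nat \<Rightarrow> real"
    and x xh :: "nat \<Rightarrow> 'a" and y yh :: "nat \<Rightarrow> 'b"
  assumes K: "bounded_linear K"
    and F: "proper F" "convex_fun F" "lower_semicontinuous F"
    and G: "proper G" "convex_fun G" "lower_semicontinuous G"
    and F_strong: "\<gamma>1 > 0" "strongly_convex \<gamma>1 F"
    and params: "\<sigma> 0 > 0" "\<tau> 0 > 0" "0 < \<gamma>" "\<gamma> < 2 * \<gamma>1 / (1 + \<sigma> 0 * \<tau> 0 * (onorm K)\<^sup>2)"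
    and iter: "adr_iteration K F G \<gamma> \<sigma> \<tau> \<theta> x y xh yh"
begin

abbreviation K' :: "'b \<Rightarrow> 'a" where "K' \<equiv> adjoint K"
abbreviation f :: "'a \<Rightarrow> real" where "f u \<equiv> real_of_ereal (F u)"
abbreviation g :: "'b \<Rightarrow> real" where "g v \<equiv> real_of_ereal (G v)"

definition s :: real where "s = \<sigma> 0 * \<tau> 0"

lemma bounded_linear_K': "bounded_linear K'" by (rule bounded_linear_adjoint[OF K])

sublocale K: bounded_linear K by (rule K)
sublocale K': bounded_linear K' by (rule bounded_linear_K')

lemmas K_inner = adjoint_inner[OF K]

subsection \<open>Step sizes\<close>

lemma \<theta>_eq: "\<theta> k = 1 / sqrt (1 + \<sigma> k * \<gamma>)"
  and \<sigma>_Suc: "\<sigma> (Suc k) = \<theta> k * \<sigma> k"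
  and \<tau>_Suc: "\<tau> (Suc k) = inverse (\<theta> k) * \<tau> k"
  using iter by (auto simp: adr_iteration_def)

lemma \<sigma>_pos: "\<sigma> k > 0"
proof (induction k)
  case (Suc k)
  then have "\<sigma> k * \<gamma> > 0" using params by simp
  then show ?case using Suc by (simp add: \<sigma>_Suc \<theta>_eq)
qed (rule params)

lemma \<theta>_pos: "\<theta> k > 0"
  using mult_pos_pos[OF \<sigma>_pos[of k] params(3)] by (simp add: \<theta>_eq)

lemma \<tau>_pos: "\<tau> k > 0"
  by (induction k) (simp_all add: params \<tau>_Suc \<theta>_pos)

lemma \<sigma>_\<tau>: "\<sigma> k * \<tau> k = s"
proof (induction k)
  case (Suc k)
  have "\<sigma> (Suc k) * \<tau> (Suc k) = \<sigma> k * \<tau> k"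
    using \<theta>_pos[of k] by (simp add: \<sigma>_Suc \<tau>_Suc field_simps)
  then show ?case using Suc by simp
qed (simp add: s_def)

lemma s_pos: "s > 0" by (simp add: s_def params)

lemma erg_weight_eq: "erg_weight \<theta> k = \<sigma> 0 / \<sigma> k"
proof (induction k)
  case (Suc k)
  then have "erg_weight \<theta> (Suc k) = \<sigma> 0 / \<sigma> k * (1 / \<theta> k)" by (simp add: erg_weight_def)
  then show ?case by (simp add: \<sigma>_Suc mult.commute)
qed (use params in \<open>simp add: erg_weight_def\<close>)

lemma erg_weight_pos: "erg_weight \<theta> k > 0"
  using \<sigma>_pos params by (simp add: erg_weight_eq)

lemma \<tau>_eq_erg_weight: "\<tau> k = \<tau> 0 * erg_weight \<theta> k"
  using \<sigma>_\<tau>[of k] \<sigma>_pos[of k] by (simp add: erg_weight_eq s_def field_simps)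

lemma inverse_\<theta>: "inverse (\<theta> k) = sqrt (1 + \<sigma> k * \<gamma>)"
  by (simp add: \<theta>_eq)

lemma inverse_\<theta>_bounds: "0 \<le> inverse (\<theta> k) - 1" "inverse (\<theta> k) - 1 \<le> \<sigma> k * \<gamma> / 2"
proof -
  have p: "\<sigma> k * \<gamma> > 0" using \<sigma>_pos[of k] params by simp
  then show "0 \<le> inverse (\<theta> k) - 1" by (simp add: inverse_\<theta>)
  have "sqrt (1 + \<sigma> k * \<gamma>) \<le> 1 + \<sigma> k * \<gamma> / 2"
  proof (rule real_le_lsqrt)
    show "1 + \<sigma> k * \<gamma> \<le> (1 + \<sigma> k * \<gamma> / 2)\<^sup>2"
      using zero_le_power2[of "\<sigma> k * \<gamma> / 2"] by (simp add: power2_sum)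
  qed (use p in auto)
  then show "inverse (\<theta> k) - 1 \<le> \<sigma> k * \<gamma> / 2" by (simp add: inverse_\<theta>)
qed

lemma \<sigma>_antimono: "\<sigma> (Suc k) \<le> \<sigma> k"
proof -
  have "\<theta> k \<le> 1" using inverse_\<theta>_bounds(1)[of k] \<theta>_pos[of k]
    by (metis diff_ge_0_iff_ge inverse_1 inverse_le_imp_le zero_less_one)
  then show ?thesis using \<sigma>_pos[of k] by (simp add: \<sigma>_Suc)
qed

lemma \<sigma>_le_\<sigma>0: "\<sigma> k \<le> \<sigma> 0"
  by (rule lift_Suc_antimono_le[of \<sigma>, OF \<sigma>_antimono]) simp

text \<open>The numbers \<open>t = 1 / \<sigma> k\<close> obey \<open>t\<^sub>+\<^sup>2 = t\<^sup>2 + \<gamma> t\<close>, so that their increments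
  \<open>\<gamma> t / (t\<^sub>+ + t)\<close> stay bounded away from \<open>0\<close>: the weights grow linearly.\<close>

lemma erg_weight_growth:
  obtains c where "c > 0" "\<And>k. 1 + c * real k \<le> erg_weight \<theta> k"
proof -
  define R where "R = sqrt (1 + \<sigma> 0 * \<gamma>)"
  define c where "c = \<sigma> 0 * \<gamma> / (1 + R)"
  have R: "R > 0" unfolding R_def using add_pos_pos[OF zero_less_one mult_pos_pos[OF params(1,3)]] by simp
  have c: "c > 0" unfolding c_def using R params by simp
  have inc: "erg_weight \<theta> k + c \<le> erg_weight \<theta> (Suc k)" for k
  proof -
    define r where "r = sqrt (1 + \<sigma> k * \<gamma>)"
    have p: "\<sigma> k * \<gamma> > 0" using \<sigma>_pos[of k] params by simp
    have r: "1 < r" "r \<le> R"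
      unfolding r_def R_def using p \<sigma>_le_\<sigma>0[of k] params by (auto intro!: real_sqrt_le_mono mult_right_mono)
    have "r\<^sup>2 = 1 + \<sigma> k * \<gamma>" unfolding r_def using p by simp
    then have "(r - 1) * (1 + r) = \<sigma> k * \<gamma>" by (simp add: power2_eq_square algebra_simps)
    then have "r - 1 = \<sigma> k * \<gamma> / (1 + r)" using r by (simp add: field_simps)
    also have "\<dots> \<ge> \<sigma> k * \<gamma> / (1 + R)" using r p by (intro divide_left_mono) auto
    finally have "\<sigma> 0 / \<sigma> k * (\<sigma> k * \<gamma> / (1 + R)) \<le> \<sigma> 0 / \<sigma> k * (r - 1)"
      using \<sigma>_pos[of k] params by (intro mult_left_mono) auto
    moreover have "\<sigma> 0 / \<sigma> k * (\<sigma> k * \<gamma> / (1 + R)) = c"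
      unfolding c_def using \<sigma>_pos[of k] by simp
    moreover have "erg_weight \<theta> (Suc k) = erg_weight \<theta> k * r"
      by (simp add: erg_weight_def \<theta>_eq r_def)
    ultimately show ?thesis
      unfolding erg_weight_eq[of k, symmetric] right_diff_distrib by linarith
  qed
  have "1 + c * real k \<le> erg_weight \<theta> k" for k
  proof (induction k)
    case (Suc k)
    then show ?case using inc[of k] by (simp add: algebra_simps)
  qed (simp add: erg_weight_def)
  with c show ?thesis by (rule that)
qed

lemma \<sigma>_tendsto_0: "\<sigma> \<longlonglongrightarrow> 0"
proof -
  obtain c where c: "c > 0" "\<And>k. 1 + c * real k \<le> erg_weight \<theta> k" by (rule erg_weight_growth) blast
  have le: "\<sigma> k \<le> \<sigma> 0 / c * inverse (real k)" if "k > 0" for k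
  proof -
    have "c * real k \<le> \<sigma> 0 / \<sigma> k" using c(2)[of k] by (simp add: erg_weight_eq)
    then show ?thesis using \<sigma>_pos[of k] c(1) that by (simp add: field_simps)
  qed
  have "(\<lambda>k. \<sigma> 0 / c * inverse (real k)) \<longlonglongrightarrow> \<sigma> 0 / c * 0"
    by (intro tendsto_intros lim_inverse_n)
  then have lim: "(\<lambda>k. \<sigma> 0 / c * inverse (real k)) \<longlonglongrightarrow> 0" by simp
  have up: "eventually (\<lambda>k. \<sigma> k \<le> \<sigma> 0 / c * inverse (real k)) sequentially"
    using eventually_gt_at_top[of 0] by (rule eventually_mono) (rule le)
  have "eventually (\<lambda>k. 0 \<le> \<sigma> k) sequentially" by (simp add: less_imp_le \<sigma>_pos)
  from tendsto_sandwich[OF this up tendsto_const lim] show ?thesis .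
qed

subsection \<open>Residuals\<close>

definition p :: "nat \<Rightarrow> 'a" where "p k = (xh k - x (Suc k)) /\<^sub>R \<sigma> k"
definition q :: "nat \<Rightarrow> 'b" where "q k = (yh k - y (Suc k)) /\<^sub>R \<tau> k"

lemma p_subgradient: "p k \<in> subdifferential F (x (Suc k))"
  and q_subgradient: "q k \<in> subdifferential G (y (Suc k))"
proof -
  have "x (Suc k) = resolvent (\<sigma> k) (subdifferential F) (xh k)"
    "y (Suc k) = resolvent (\<tau> k) (subdifferential G) (yh k)"
    using iter by (auto simp: adr_iteration_def)
  then show "p k \<in> subdifferential F (x (Suc k))" "q k \<in> subdifferential G (y (Suc k))"
    using resolvent_subdifferential[OF F \<sigma>_pos, of k "xh k"]
      resolvent_subdifferential[OF G \<tau>_pos, of k "yh k"] by (simp_all add: p_def q_def)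
qed

lemma x_edom: "x (Suc k) \<in> edom F" and y_edom: "y (Suc k) \<in> edom G"
  using subdifferential_in_edom[OF F(1) p_subgradient] subdifferential_in_edom[OF G(1) q_subgradient] .

text \<open>All quantities are measured relative to a reference pair \<open>(u, v)\<close>. The primal ones are divided
  by \<open>\<sigma> k\<close>, which turns the growing weights of the energy into the constant \<open>s\<close>. Up to this factor
  \<open>resU\<close> and \<open>resV\<close> are the offsets of \<open>(xh k, yh k)\<close> from \<open>(u - \<sigma> k K\<^sup>* v, v + \<tau> k K u)\<close>, the point that
  the resolvents send to \<open>(u, v)\<close> if \<open>(u, v)\<close> is a saddle-point. The resolvents split
  them as \<open>W + A\<close> and \<open>Z + C\<close>.\<close>

definition resU where "resU k u v = (xh k - u) /\<^sub>R \<sigma> k + K' v"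
definition resV where "resV k u v = yh k - v - \<tau> k *\<^sub>R K u"
definition resW where "resW k u = (x (Suc k) - u) /\<^sub>R \<sigma> k"
definition resA where "resA k v = p k + K' v"
definition resZ where "resZ k v = y (Suc k) - v"
definition resC where "resC k u = yh k - y (Suc k) - \<tau> k *\<^sub>R K u"

definition energy where
  "energy k u v = (s * (norm (resU k u v))\<^sup>2 + (norm (resV k u v))\<^sup>2) / 2"

lemma energy_nonneg: "energy k u v \<ge> 0" using s_pos by (simp add: energy_def)

lemma resU_split: "resU k u v = resW k u + resA k v"
  by (simp add: resU_def resW_def resA_def p_def algebra_simps)

lemma resV_split: "resV k u v = resZ k v + resC k u"
  by (simp add: resV_def resZ_def resC_def algebra_simps)

lemma resW_eq: "x (Suc k) - u = \<sigma> k *\<^sub>R resW k u"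
  using \<sigma>_pos[of k] by (simp add: resW_def)

lemma resC_eq: "resC k u = \<tau> k *\<^sub>R (q k - K u)"
  using \<tau>_pos[of k] by (simp add: resC_def q_def scaleR_diff_right)

text \<open>Eliminating the solution \<open>d\<close> of the linear system from the update of \<open>xh\<close> and \<open>yh\<close>.\<close>

lemma xh_update: "xh (Suc k) + \<sigma> (Suc k) *\<^sub>R K' (yh (Suc k)) = x (Suc k) + \<sigma> k *\<^sub>R K' (yh k - y (Suc k))"
  and yh_update: "yh (Suc k) = y (Suc k) + \<tau> (Suc k) *\<^sub>R K (xh (Suc k)) - \<tau> k *\<^sub>R K (xh k - x (Suc k))"
proof -
  define b where "b = ((1 + \<theta> k) *\<^sub>R x (Suc k) - \<theta> k *\<^sub>R xh k)
                    - \<sigma> k *\<^sub>R K' ((1 + \<theta> k) *\<^sub>R y (Suc k) - yh k)"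
  define d where "d = inv (\<lambda>u. u + (\<sigma> 0 * \<tau> 0) *\<^sub>R K' (K u)) b"
  have upd: "xh (Suc k) = \<theta> k *\<^sub>R (xh k - x (Suc k)) + d"
      "yh (Suc k) = y (Suc k) + \<tau> (Suc k) *\<^sub>R K d"
    using iter by (auto simp: adr_iteration_def Let_def b_def d_def)
  have "d + s *\<^sub>R K' (K d) = b"
    using surj_f_inv_f[OF surj_id_plus_normal_operator[OF K s_pos], of b] by (simp add: d_def s_def)
  moreover have "\<sigma> (Suc k) *\<^sub>R K' (yh (Suc k)) = (\<sigma> k * \<theta> k) *\<^sub>R K' (y (Suc k)) + s *\<^sub>R K' (K d)"
    unfolding upd(2) K'.add K'.scaleR scaleR_add_right scaleR_scaleR \<sigma>_\<tau>
    by (simp add: \<sigma>_Suc mult.commute)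
  ultimately have "xh (Suc k) + \<sigma> (Suc k) *\<^sub>R K' (yh (Suc k))
      = \<theta> k *\<^sub>R (xh k - x (Suc k)) + (b + (\<sigma> k * \<theta> k) *\<^sub>R K' (y (Suc k)))"
    unfolding upd(1) by (simp add: algebra_simps)
  then show "xh (Suc k) + \<sigma> (Suc k) *\<^sub>R K' (yh (Suc k)) = x (Suc k) + \<sigma> k *\<^sub>R K' (yh k - y (Suc k))"
    unfolding b_def by (simp add: K'.add K'.diff K'.scaleR algebra_simps)
  have "d = xh (Suc k) - \<theta> k *\<^sub>R (xh k - x (Suc k))" using upd(1) by simp
  then have "\<tau> (Suc k) *\<^sub>R K d = \<tau> (Suc k) *\<^sub>R K (xh (Suc k)) - (\<tau> (Suc k) * \<theta> k) *\<^sub>R K (xh k - x (Suc k))"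
    by (simp only: K.diff K.scaleR scaleR_diff_right scaleR_scaleR)
  moreover have "\<tau> (Suc k) * \<theta> k = \<tau> k" using \<theta>_pos[of k] by (simp add: \<tau>_Suc)
  ultimately show "yh (Suc k) = y (Suc k) + \<tau> (Suc k) *\<^sub>R K (xh (Suc k)) - \<tau> k *\<^sub>R K (xh k - x (Suc k))"
    using upd(2) by simp
qed

lemma s_div_\<sigma>: "s / \<sigma> k = \<tau> k" "s * inverse (\<sigma> k) = \<tau> k"
  using \<sigma>_\<tau>[of k] \<sigma>_pos[of k] by (auto simp: field_simps)

lemma residual_update:
  shows "resU (Suc k) u v + K' (resV (Suc k) u v) = inverse (\<theta> k) *\<^sub>R (resW k u + K' (resC k u))"
    and "resV (Suc k) u v - s *\<^sub>R K (resU (Suc k) u v) = resZ k v - s *\<^sub>R K (resA k v)"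
proof -
  have sc: "\<sigma> j *\<^sub>R (resU j u v + K' (resV j u v)) = xh j + \<sigma> j *\<^sub>R K' (yh j) - u - s *\<^sub>R K' (K u)" for j
    using \<sigma>_pos[of j] unfolding resU_def resV_def
    by (simp add: K'.diff K'.scaleR scaleR_add_right scaleR_diff_right \<sigma>_\<tau>)
  have sw: "\<sigma> k *\<^sub>R (resW k u + K' (resC k u)) = x (Suc k) + \<sigma> k *\<^sub>R K' (yh k - y (Suc k)) - u - s *\<^sub>R K' (K u)"
    using \<sigma>_pos[of k] unfolding resW_def resC_def
    by (simp add: K'.diff K'.scaleR scaleR_add_right scaleR_diff_right \<sigma>_\<tau>)
  have "\<sigma> (Suc k) *\<^sub>R (resU (Suc k) u v + K' (resV (Suc k) u v)) = \<sigma> k *\<^sub>R (resW k u + K' (resC k u))"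
    unfolding sc sw xh_update ..
  also have "\<dots> = \<sigma> (Suc k) *\<^sub>R (inverse (\<theta> k) *\<^sub>R (resW k u + K' (resC k u)))"
    using \<theta>_pos[of k] by (simp add: \<sigma>_Suc)
  finally show "resU (Suc k) u v + K' (resV (Suc k) u v) = inverse (\<theta> k) *\<^sub>R (resW k u + K' (resC k u))"
    by (rule scaleR_left_imp_eq[rotated]) (use \<sigma>_pos[of "Suc k"] in simp)
  have "resV (Suc k) u v - s *\<^sub>R K (resU (Suc k) u v)
      = yh (Suc k) - v - \<tau> (Suc k) *\<^sub>R K (xh (Suc k)) - s *\<^sub>R K (K' v)"
    unfolding resU_def resV_def
    by (simp add: K.add K.diff K.scaleR scaleR_add_right scaleR_diff_right s_div_\<sigma>)
  also have "\<dots> = resZ k v - s *\<^sub>R K (resA k v)"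
    unfolding yh_update resZ_def resA_def p_def
    by (simp add: K.add K.diff K.scaleR scaleR_add_right scaleR_diff_right s_div_\<sigma>)
  finally show "resV (Suc k) u v - s *\<^sub>R K (resU (Suc k) u v) = resZ k v - s *\<^sub>R K (resA k v)" .
qed

lemma energy_identity:
  defines "D k u v \<equiv> resU k u v - resU (Suc k) u v"
    and "E k u v \<equiv> resV k u v - resV (Suc k) u v"
  shows "s * (resA k v \<bullet> resW k u) + resZ k v \<bullet> resC k u
    = energy k u v - energy (Suc k) u v - (s * (norm (D k u v))\<^sup>2 + (norm (E k u v))\<^sup>2) / 2
      + (inverse (\<theta> k) - 1) * (s * (resW k u \<bullet> (resW k u - D k u v)
          + E k u v \<bullet> K (resW k u - D k u v) + s * (norm (K (resW k u - D k u v)))\<^sup>2))"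
  unfolding energy_def D_def E_def
  by (rule douglas_rachford_step_identity[OF K bounded_linear_K' K_inner residual_update
        resU_split resV_split])

text \<open>Since \<open>inverse (\<theta> k) - 1\<close> is at most \<open>\<gamma> \<sigma> k / 2\<close>, a quadratic gain with any coefficient
  above \<open>\<gamma> (1 + s \<parallel>K\<parallel>\<^sup>2) / 2\<close> pays for the acceleration, once \<open>\<sigma> k\<close> is so small that the mixed
  terms are covered by the squared increments.\<close>

lemma energy_descent:
  assumes \<alpha>: "\<gamma> * (1 + s * (onorm K)\<^sup>2) / 2 < \<alpha>"
  obtains \<epsilon> N where "\<epsilon> > 0"
    "\<And>k u v. k \<ge> N \<Longrightarrow> s * (resA k v \<bullet> resW k u) + resZ k v \<bullet> resC k u - \<alpha> * (s * \<sigma> k * (norm (resW k u))\<^sup>2)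
      + \<epsilon> * (s * \<sigma> k * (norm (resW k u))\<^sup>2 + s * (norm (resU k u v - resU (Suc k) u v))\<^sup>2
              + (norm (resV k u v - resV (Suc k) u v))\<^sup>2)
      \<le> energy k u v - energy (Suc k) u v"
proof -
  define c0 where "c0 = 1 + s * (onorm K)\<^sup>2"
  define slack where "slack = \<alpha> - \<gamma> * c0 / 2"
  have slack: "slack > 0" using \<alpha> by (simp add: slack_def c0_def)
  \<comment> \<open>One half of the slack pays for \<open>\<mu>\<close>, the other half is returned as \<open>\<epsilon>\<close>; of the factor \<open>1/2\<close> in front
    of the squared increments, \<open>1/4\<close> covers the mixed terms and \<open>1/4\<close> is left for \<open>\<epsilon>\<close>.\<close>
  define \<epsilon> where "\<epsilon> = min (1/4) (slack / 2)"
  define \<mu> where "\<mu> = slack / \<gamma>"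
  have \<epsilon>: "\<epsilon> > 0" "\<epsilon> \<le> 1/4" "\<epsilon> \<le> slack / 2" using slack by (auto simp: \<epsilon>_def)
  have \<mu>: "\<mu> > 0" using slack params by (simp add: \<mu>_def)
  obtain M where M: "M \<ge> 0"
    "\<And>W D E. W \<bullet> (W - D) + E \<bullet> K (W - D) + s * (norm (K (W - D)))\<^sup>2
       \<le> (c0 + \<mu>) * (norm W)\<^sup>2 + M * ((norm D)\<^sup>2 + (norm E)\<^sup>2)"
    using acceleration_price_bound[OF K less_imp_le[OF s_pos] \<mu>] unfolding c0_def by metis
  have "(\<lambda>k. \<sigma> k * (\<gamma> / 2 * (1 + s) * M)) \<longlonglongrightarrow> 0 * (\<gamma> / 2 * (1 + s) * M)"
    by (intro tendsto_intros \<sigma>_tendsto_0)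
  then have "eventually (\<lambda>k. \<sigma> k * (\<gamma> / 2 * (1 + s) * M) < 1/4) sequentially"
    by (rule order_tendstoD) simp
  then obtain N where N: "\<And>k. k \<ge> N \<Longrightarrow> \<sigma> k * (\<gamma> / 2 * (1 + s) * M) < 1/4"
    by (auto simp: eventually_sequentially)
  show ?thesis
  proof (rule that[OF \<epsilon>(1)])
    fix k u v assume k: "k \<ge> N"
    define a2 b2 e2 where "a2 = (norm (resW k u))\<^sup>2" and "b2 = (norm (resU k u v - resU (Suc k) u v))\<^sup>2"
      and "e2 = (norm (resV k u v - resV (Suc k) u v))\<^sup>2"
    have nn: "a2 \<ge> 0" "b2 \<ge> 0" "e2 \<ge> 0" by (auto simp: a2_def b2_def e2_def)
    define B where "B = resW k u \<bullet> (resW k u - (resU k u v - resU (Suc k) u v))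
          + (resV k u v - resV (Suc k) u v) \<bullet> K (resW k u - (resU k u v - resU (Suc k) u v))
          + s * (norm (K (resW k u - (resU k u v - resU (Suc k) u v))))\<^sup>2"
    have id: "s * (resA k v \<bullet> resW k u) + resZ k v \<bullet> resC k u
      = energy k u v - energy (Suc k) u v - (s * b2 + e2) / 2 + (inverse (\<theta> k) - 1) * (s * B)"
      unfolding a2_def b2_def e2_def B_def by (rule energy_identity)
    define \<eta> where "\<eta> = \<sigma> k * \<gamma> / 2"
    have \<eta>: "\<eta> \<ge> 0" unfolding \<eta>_def using \<sigma>_pos[of k] params by simp
    have B: "B \<le> (c0 + \<mu>) * a2 + M * (b2 + e2)" unfolding B_def a2_def b2_def e2_def by (rule M(2))
    have "c0 + \<mu> \<ge> 0" unfolding c0_def using s_pos \<mu> by simp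
    then have nnB: "0 \<le> (c0 + \<mu>) * a2 + M * (b2 + e2)" using nn M(1) by simp
    have "(inverse (\<theta> k) - 1) * (s * B) \<le> (inverse (\<theta> k) - 1) * (s * ((c0 + \<mu>) * a2 + M * (b2 + e2)))"
      using inverse_\<theta>_bounds(1) s_pos B by (intro mult_left_mono) auto
    also have "\<dots> \<le> \<eta> * (s * ((c0 + \<mu>) * a2 + M * (b2 + e2)))"
      unfolding \<eta>_def
      by (intro mult_right_mono inverse_\<theta>_bounds(2) mult_nonneg_nonneg nnB less_imp_le[OF s_pos])
    also have "\<dots> = (\<gamma> * (c0 + \<mu>) / 2) * (s * \<sigma> k * a2) + (\<eta> * M) * (s * b2) + (\<eta> * s * M) * e2"
      unfolding \<eta>_def by (simp add: field_simps)
    also have "\<dots> \<le> (\<alpha> - \<epsilon>) * (s * \<sigma> k * a2) + 1/4 * (s * b2) + 1/4 * e2"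
    proof (intro add_mono mult_right_mono)
      have "\<gamma> * \<mu> = slack" using params by (simp add: \<mu>_def)
      then have "\<gamma> * (c0 + \<mu>) / 2 = \<gamma> * c0 / 2 + slack / 2" by (simp add: distrib_left add_divide_distrib)
      moreover have "\<alpha> = \<gamma> * c0 / 2 + slack" by (simp add: slack_def)
      ultimately show "\<gamma> * (c0 + \<mu>) / 2 \<le> \<alpha> - \<epsilon>" using \<epsilon>(3) by linarith
      have "\<eta> * M + \<eta> * s * M < 1/4" using N[OF k] by (simp add: \<eta>_def algebra_simps)
      moreover have "\<eta> * M \<ge> 0" "\<eta> * s * M \<ge> 0" using \<eta> s_pos M(1) by auto
      ultimately show "\<eta> * M \<le> 1/4" "\<eta> * s * M \<le> 1/4" by linarith+
    qed (use s_pos \<sigma>_pos[of k] nn in auto)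
    finally have le: "(inverse (\<theta> k) - 1) * (s * B) \<le> \<dots>" .
    have "\<epsilon> * (s * b2 + e2) \<le> 1/4 * (s * b2 + e2)" using \<epsilon> nn s_pos by (intro mult_right_mono) auto
    then have small: "\<epsilon> * (s * b2 + e2) \<le> 1/4 * (s * b2) + 1/4 * e2" by (simp add: distrib_left)
    have split: "\<epsilon> * (s * \<sigma> k * a2 + s * b2 + e2) = \<epsilon> * (s * \<sigma> k * a2) + \<epsilon> * (s * b2 + e2)"
      "(\<alpha> - \<epsilon>) * (s * \<sigma> k * a2) = \<alpha> * (s * \<sigma> k * a2) - \<epsilon> * (s * \<sigma> k * a2)"
      by (simp_all add: algebra_simps)
    have arith: "X - aP + (eP + eQ) \<le> E0 - E1"
      if "X = E0 - E1 - (Q + e) / 2 + T" "T \<le> aP - eP + 1/4 * Q + 1/4 * e" "eQ \<le> 1/4 * Q + 1/4 * e"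
      for X aP eP eQ E0 E1 Q e T :: real
      using that by argo
    show "s * (resA k v \<bullet> resW k u) + resZ k v \<bullet> resC k u - \<alpha> * (s * \<sigma> k * (norm (resW k u))\<^sup>2)
      + \<epsilon> * (s * \<sigma> k * (norm (resW k u))\<^sup>2 + s * (norm (resU k u v - resU (Suc k) u v))\<^sup>2
              + (norm (resV k u v - resV (Suc k) u v))\<^sup>2)
      \<le> energy k u v - energy (Suc k) u v"
      unfolding a2_def[symmetric] b2_def[symmetric] e2_def[symmetric] split(1)
      by (rule arith[OF id le[unfolded split(2)] small])
  qed
qed

subsection \<open>Saddle-points as reference pairs\<close>

lemma lagrangian_eq:
  "u \<in> edom F \<Longrightarrow> v \<in> edom G \<Longrightarrow> lagrangian K F G u v = ereal (K u \<bullet> v + f u - g v)"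
  unfolding lagrangian_def
  using proper_eq_ereal[OF F(1), of u] proper_eq_ereal[OF G(1), of v]
  by (metis ereal_minus(1) plus_ereal.simps(1))

lemma saddle_point_iff_subgradients:
  "saddle_point K F G u v \<longleftrightarrow> - K' v \<in> subdifferential F u \<and> K u \<in> subdifferential G v"
proof
  assume sp: "saddle_point K F G u v"
  then have dom: "u \<in> edom F" "v \<in> edom G" by (auto simp: saddle_point_def)
  have "f u + (- K' v) \<bullet> (z - u) \<le> f z" if "z \<in> edom F" for z
  proof -
    have "lagrangian K F G u v \<le> lagrangian K F G z v"
      using sp dom that by (auto simp: saddle_point_def)
    then have "K u \<bullet> v + f u \<le> K z \<bullet> v + f z" by (simp add: lagrangian_eq dom that)
    then show ?thesis unfolding K_inner by (simp add: inner_diff_right inner_commute[of "K' v"])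
  qed
  moreover have "g v + K u \<bullet> (z - v) \<le> g z" if "z \<in> edom G" for z
  proof -
    have "lagrangian K F G u z \<le> lagrangian K F G u v"
      using sp dom that by (auto simp: saddle_point_def)
    then have "K u \<bullet> z - g z \<le> K u \<bullet> v - g v" by (simp add: lagrangian_eq dom that)
    then show ?thesis by (simp add: inner_diff_right)
  qed
  ultimately show "- K' v \<in> subdifferential F u \<and> K u \<in> subdifferential G v"
    using dom subdifferential_iff[OF F(1)] subdifferential_iff[OF G(1)] by blast
next
  assume sub: "- K' v \<in> subdifferential F u \<and> K u \<in> subdifferential G v"
  then have dom: "u \<in> edom F" "v \<in> edom G"
    using subdifferential_in_edom[OF F(1)] subdifferential_in_edom[OF G(1)] by blast+
  show "saddle_point K F G u v"
    unfolding saddle_point_def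
  proof (intro conjI ballI dom)
    fix a b assume ab: "a \<in> edom F" "b \<in> edom G"
    have "f u + (- K' v) \<bullet> (a - u) \<le> f a" "g v + K u \<bullet> (b - v) \<le> g b"
      using sub ab subgradient_inequality[OF F(1)] subgradient_inequality[OF G(1)] by blast+
    then have "K u \<bullet> v + f u \<le> K a \<bullet> v + f a" "K u \<bullet> b - g b \<le> K u \<bullet> v - g v"
      by (simp_all add: K_inner[of _ v] inner_diff_right inner_commute[of "K' v"])
    then show "lagrangian K F G u b \<le> lagrangian K F G u v"
      "lagrangian K F G u v \<le> lagrangian K F G a v"
      by (simp_all add: lagrangian_eq dom ab)
  qed
qed

text \<open>Both subgradient inequalities for \<open>F\<close>, the one at \<open>x (Suc k)\<close> and the one at the saddle-point,
  contribute half of the modulus, hence the full \<open>\<gamma>1\<close>.\<close>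

lemma saddle_gain:
  assumes "saddle_point K F G u v"
  shows "\<gamma>1 * (s * \<sigma> k * (norm (resW k u))\<^sup>2) \<le> s * (resA k v \<bullet> resW k u) + resZ k v \<bullet> resC k u"
    and "0 \<le> resA k v \<bullet> resW k u" and "0 \<le> resZ k v \<bullet> resC k u"
proof -
  have sub: "- K' v \<in> subdifferential F u" "K u \<in> subdifferential G v"
    using assms saddle_point_iff_subgradients by blast+
  have u: "u \<in> edom F" using assms by (simp add: saddle_point_def)
  have "f (x (Suc k)) + p k \<bullet> (u - x (Suc k)) + \<gamma>1 / 2 * (norm (u - x (Suc k)))\<^sup>2 \<le> f u"
    by (rule strongly_convex_subgradient[OF F(1) F_strong(2) p_subgradient u])
  moreover have "f u + (- K' v) \<bullet> (x (Suc k) - u) + \<gamma>1 / 2 * (norm (x (Suc k) - u))\<^sup>2 \<le> f (x (Suc k))"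
    by (rule strongly_convex_subgradient[OF F(1) F_strong(2) sub(1) x_edom])
  moreover have "p k \<bullet> (u - x (Suc k)) = - (p k \<bullet> (x (Suc k) - u))" by (simp add: inner_diff_right)
  moreover have "resA k v \<bullet> (x (Suc k) - u) = p k \<bullet> (x (Suc k) - u) - (- K' v) \<bullet> (x (Suc k) - u)"
    by (simp add: resA_def inner_add_left)
  ultimately have "\<gamma>1 * (norm (x (Suc k) - u))\<^sup>2 \<le> resA k v \<bullet> (x (Suc k) - u)"
    by (simp add: norm_minus_commute)
  then have "\<sigma> k * (\<gamma>1 * (\<sigma> k * (norm (resW k u))\<^sup>2)) \<le> \<sigma> k * (resA k v \<bullet> resW k u)"
    unfolding resW_eq by (simp add: power2_eq_square ac_simps)
  then have AW: "\<gamma>1 * (\<sigma> k * (norm (resW k u))\<^sup>2) \<le> resA k v \<bullet> resW k u"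
    using \<sigma>_pos[of k] by simp
  moreover have "0 \<le> \<gamma>1 * (\<sigma> k * (norm (resW k u))\<^sup>2)" using F_strong \<sigma>_pos[of k] by simp
  ultimately show "0 \<le> resA k v \<bullet> resW k u" by linarith
  have "0 \<le> (q k - K u) \<bullet> (y (Suc k) - v)"
    by (rule subdifferential_monotone[OF G(1) q_subgradient sub(2)])
  then show ZC: "0 \<le> resZ k v \<bullet> resC k u"
    using \<tau>_pos[of k] by (simp add: resC_eq resZ_def inner_commute)
  have "s * (\<gamma>1 * (\<sigma> k * (norm (resW k u))\<^sup>2)) \<le> s * (resA k v \<bullet> resW k u)"
    using AW s_pos by (intro mult_left_mono) auto
  then show "\<gamma>1 * (s * \<sigma> k * (norm (resW k u))\<^sup>2) \<le> s * (resA k v \<bullet> resW k u) + resZ k v \<bullet> resC k u"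
    using ZC by (simp add: ac_simps)
qed

lemma \<gamma>_less: "\<gamma> * (1 + s * (onorm K)\<^sup>2) / 2 < \<gamma>1"
proof -
  have "1 + s * (onorm K)\<^sup>2 > 0" using s_pos by (simp add: add_pos_nonneg)
  then show ?thesis using params(4) by (simp add: s_def field_simps)
qed

lemma scaled_square: "s * \<sigma> k * (norm (resW k u))\<^sup>2 = \<tau> 0 * (erg_weight \<theta> k * (norm (x (Suc k) - u))\<^sup>2)"
proof -
  have "(norm (x (Suc k) - u))\<^sup>2 = (\<sigma> k)\<^sup>2 * (norm (resW k u))\<^sup>2"
    unfolding resW_eq by (simp add: power_mult_distrib)
  then have "\<tau> 0 * (erg_weight \<theta> k * (norm (x (Suc k) - u))\<^sup>2) = (\<tau> k * \<sigma> k) * \<sigma> k * (norm (resW k u))\<^sup>2"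
    by (simp add: \<tau>_eq_erg_weight[of k] power2_eq_square)
  then show ?thesis using \<sigma>_\<tau>[of k] by (simp add: mult.commute)
qed

lemma saddle_energy:
  assumes sp: "saddle_point K F G u v"
  shows "summable (\<lambda>k. erg_weight \<theta> k * (norm (x (Suc k) - u))\<^sup>2)"
    and "(\<lambda>k. resU k u v - resU (Suc k) u v) \<longlonglongrightarrow> 0"
    and "(\<lambda>k. resV k u v - resV (Suc k) u v) \<longlonglongrightarrow> 0"
    and "convergent (\<lambda>k. energy k u v)"
proof -
  obtain \<epsilon> N where \<epsilon>: "\<epsilon> > 0" and desc: "\<And>k u v. k \<ge> N \<Longrightarrow>
      s * (resA k v \<bullet> resW k u) + resZ k v \<bullet> resC k u - \<gamma>1 * (s * \<sigma> k * (norm (resW k u))\<^sup>2)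
      + \<epsilon> * (s * \<sigma> k * (norm (resW k u))\<^sup>2 + s * (norm (resU k u v - resU (Suc k) u v))\<^sup>2
              + (norm (resV k u v - resV (Suc k) u v))\<^sup>2)
      \<le> energy k u v - energy (Suc k) u v"
    using energy_descent[OF \<gamma>_less] by metis
  define w where "w k = s * \<sigma> k * (norm (resW k u))\<^sup>2" for k
  define D where "D k = s * (norm (resU k u v - resU (Suc k) u v))\<^sup>2" for k
  define E where "E k = (norm (resV k u v - resV (Suc k) u v))\<^sup>2" for k
  have nn: "w k \<ge> 0" "D k \<ge> 0" "E k \<ge> 0" for k
    using s_pos \<sigma>_pos[of k] by (auto simp: w_def D_def E_def)
  have step: "\<epsilon> * (w k + D k + E k) \<le> energy k u v - energy (Suc k) u v" if "k \<ge> N" for k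
    using desc[OF that, of v u] saddle_gain(1)[OF sp, of k] unfolding w_def D_def E_def by linarith
  have "summable (\<lambda>k. \<epsilon> * (w k + D k + E k))"
    by (rule summable_of_eventual_descent[of _ "\<lambda>k. energy k u v" N])
      (use nn \<epsilon> step energy_nonneg in auto)
  then have sm: "summable (\<lambda>k. w k + D k + E k)" using \<epsilon> by (simp add: summable_cmult_iff)
  have "summable w" "summable D" "summable E"
    by (rule summable_comparison_test'[OF sm, of 0]; use nn in \<open>simp add: add_increasing add_increasing2\<close>)+
  from \<open>summable w\<close> show "summable (\<lambda>k. erg_weight \<theta> k * (norm (x (Suc k) - u))\<^sup>2)"
    unfolding w_def scaled_square using params(2) by (simp add: summable_cmult_iff)
  have null: "a \<longlonglongrightarrow> 0" if "(\<lambda>k. (norm (a k))\<^sup>2) \<longlonglongrightarrow> 0" for a :: "nat \<Rightarrow> 'c::real_normed_vector"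
    using tendsto_real_sqrt[OF that] by (simp add: tendsto_norm_zero_iff)
  have "(\<lambda>k. D k * inverse s) \<longlonglongrightarrow> 0 * inverse s"
    by (intro tendsto_mult summable_LIMSEQ_zero[OF \<open>summable D\<close>] tendsto_const)
  then have "(\<lambda>k. (norm (resU k u v - resU (Suc k) u v))\<^sup>2) \<longlonglongrightarrow> 0"
    using s_pos by (simp add: D_def)
  then show "(\<lambda>k. resU k u v - resU (Suc k) u v) \<longlonglongrightarrow> 0" by (rule null)
  show "(\<lambda>k. resV k u v - resV (Suc k) u v) \<longlonglongrightarrow> 0"
    by (rule null, rule summable_LIMSEQ_zero[OF \<open>summable E\<close>, unfolded E_def])
  have "energy (Suc k + N) u v \<le> energy (k + N) u v" for k
  proof -
    have "0 \<le> \<epsilon> * (w (k + N) + D (k + N) + E (k + N))" using nn \<epsilon> by simp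
    also have "\<dots> \<le> energy (k + N) u v - energy (Suc (k + N)) u v" by (rule step) simp
    finally show ?thesis by simp
  qed
  then have "decseq (\<lambda>k. energy (k + N) u v)" by (intro decseq_SucI)
  then obtain L where "(\<lambda>k. energy (k + N) u v) \<longlonglongrightarrow> L"
    using decseq_convergent[of "\<lambda>k. energy (k + N) u v" 0] energy_nonneg by metis
  then have "(\<lambda>k. energy k u v) \<longlonglongrightarrow> L" by (rule LIMSEQ_offset)
  then show "convergent (\<lambda>k. energy k u v)" by (rule convergentI)
qed

text \<open>By monotonicity the two summands of \<open>U\<close>, and those of \<open>V\<close>, enclose no obtuse angle. Each of them
  is therefore at most as long as the sum, which the energy bounds.\<close>

lemma saddle_residuals_bounded:
  assumes sp: "saddle_point K F G u v"
  shows "\<exists>B. \<forall>k. norm (resW k u) \<le> B \<and> norm (resA k v) \<le> B \<and> norm (resZ k v) \<le> B \<and> norm (resC k u) \<le> B"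
proof -
  have "Bseq (\<lambda>k. energy k u v)" by (rule convergent_imp_Bseq[OF saddle_energy(4)[OF sp]])
  then obtain E where E: "\<And>k. energy k u v \<le> E" by (metis BseqE abs_le_D1 real_norm_def)
  define B where "B = sqrt (2 * E / s) + sqrt (2 * E)"
  have E0: "E \<ge> 0" using E[of 0] energy_nonneg[of 0 u v] by linarith
  have U: "norm (resU k u v) \<le> B" and V: "norm (resV k u v) \<le> B" for k
  proof -
    have "0 \<le> s * (norm (resU k u v))\<^sup>2" "0 \<le> (norm (resV k u v))\<^sup>2" using s_pos by simp_all
    moreover have "s * (norm (resU k u v))\<^sup>2 + (norm (resV k u v))\<^sup>2 \<le> 2 * E"
      using E[of k] by (simp add: energy_def)
    ultimately have le: "s * (norm (resU k u v))\<^sup>2 \<le> 2 * E" "(norm (resV k u v))\<^sup>2 \<le> 2 * E"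
      by linarith+
    from le(1) have "norm (resU k u v) \<le> sqrt (2 * E / s)"
      using s_pos by (intro real_le_rsqrt) (simp add: field_simps)
    moreover have "norm (resV k u v) \<le> sqrt (2 * E)" by (intro real_le_rsqrt le(2))
    ultimately show "norm (resU k u v) \<le> B" "norm (resV k u v) \<le> B"
      using E0 s_pos by (auto simp: B_def intro: add_increasing add_increasing2)
  qed
  have "norm (resW k u) \<le> B \<and> norm (resA k v) \<le> B \<and> norm (resZ k v) \<le> B \<and> norm (resC k u) \<le> B" for k
  proof -
    note sg = saddle_gain(2,3)[OF sp, of k]
    have "0 \<le> resW k u \<bullet> resA k v" using sg(1) by (simp add: inner_commute)
    from norm_le_norm_add[OF this] norm_le_norm_add[OF sg(2)] show ?thesis
      using U[of k] V[of k] by (simp add: resU_split resV_split)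
  qed
  then show ?thesis by blast
qed

subsection \<open>Convergence\<close>

lemma x_tendsto_saddle:
  assumes sp: "saddle_point K F G u v"
  shows "x \<longlonglongrightarrow> u"
proof -
  obtain B where B: "\<And>k. norm (resW k u) \<le> B" using saddle_residuals_bounded[OF sp] by blast
  have "(\<lambda>k. x (Suc k) - u) \<longlonglongrightarrow> 0"
  proof (rule tendsto_0_le[OF \<sigma>_tendsto_0])
    show "eventually (\<lambda>k. norm (x (Suc k) - u) \<le> norm (\<sigma> k) * B) sequentially"
      unfolding resW_eq using B \<sigma>_pos by (intro always_eventually allI) (auto intro: mult_left_mono)
  qed
  then have "(\<lambda>k. x (Suc k)) \<longlonglongrightarrow> u" by (simp add: LIM_zero_iff)
  then show ?thesis by (simp add: filterlim_sequentially_Suc)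
qed

lemma q_tendsto_saddle:
  assumes sp: "saddle_point K F G u v"
  shows "q \<longlonglongrightarrow> K u"
proof -
  obtain B where B: "\<And>k. norm (resC k u) \<le> B" using saddle_residuals_bounded[OF sp] by blast
  have "(\<lambda>k. q k - K u) \<longlonglongrightarrow> 0"
  proof (rule tendsto_0_le[OF \<sigma>_tendsto_0])
    show "eventually (\<lambda>k. norm (q k - K u) \<le> norm (\<sigma> k) * (B / s)) sequentially"
    proof (intro always_eventually allI)
      fix k
      have "\<tau> k * norm (q k - K u) \<le> B" using B[of k] \<tau>_pos[of k] by (simp add: resC_eq)
      then have "\<sigma> k * (\<tau> k * norm (q k - K u)) \<le> \<sigma> k * B"
        using \<sigma>_pos[of k] by (intro mult_left_mono) auto
      then have "s * norm (q k - K u) \<le> \<sigma> k * B" by (simp add: \<sigma>_\<tau> flip: mult.assoc)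
      then show "norm (q k - K u) \<le> norm (\<sigma> k) * (B / s)"
        using s_pos \<sigma>_pos[of k] by (simp add: field_simps)
    qed
  qed
  then show ?thesis by (simp add: LIM_zero_iff)
qed

text \<open>The combination of residuals that expresses primal optimality consists of increments of \<open>U\<close>
  and \<open>V\<close>, which vanish, and of bounded terms multiplied by \<open>inverse (\<theta> k) - 1\<close>.\<close>

lemma primal_residual_tendsto_0:
  assumes sp: "saddle_point K F G u v"
  shows "(\<lambda>k. p k + K' (y (Suc k))) \<longlonglongrightarrow> 0"
proof -
  obtain B where B: "\<And>k. norm (resW k u) \<le> B" "\<And>k. norm (resC k u) \<le> B"
    using saddle_residuals_bounded[OF sp] by blast
  have B0: "0 \<le> B" using B(1)[of 0] norm_ge_zero order_trans by blast
  have eq: "p k + K' (y (Suc k)) = (resU k u v - resU (Suc k) u v) + K' (resV k u v - resV (Suc k) u v)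
      + (inverse (\<theta> k) - 1) *\<^sub>R (resW k u + K' (resC k u))" for k
  proof -
    have "p k + K' (y (Suc k)) = resU k u v + K' (resV k u v) - (resW k u + K' (resC k u))"
      unfolding resU_split resV_split by (simp add: K'.add resA_def resZ_def K'.diff)
    also have "\<dots> = (resU k u v - resU (Suc k) u v) + K' (resV k u v - resV (Suc k) u v)
      + (resU (Suc k) u v + K' (resV (Suc k) u v)) - (resW k u + K' (resC k u))"
      by (simp add: K'.diff)
    finally show ?thesis unfolding residual_update(1) by (simp add: algebra_simps)
  qed
  have "(\<lambda>k. K' (resV k u v - resV (Suc k) u v)) \<longlonglongrightarrow> 0"
    using K'.tendsto[OF saddle_energy(3)[OF sp]] by (simp add: K'.zero)
  moreover have "(\<lambda>k. (inverse (\<theta> k) - 1) *\<^sub>R (resW k u + K' (resC k u))) \<longlonglongrightarrow> 0"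
  proof (rule tendsto_0_le[OF \<sigma>_tendsto_0])
    show "eventually (\<lambda>k. norm ((inverse (\<theta> k) - 1) *\<^sub>R (resW k u + K' (resC k u)))
        \<le> norm (\<sigma> k) * (\<gamma> / 2 * (B + onorm K * B))) sequentially"
    proof (intro always_eventually allI)
      fix k
      have "norm (resW k u + K' (resC k u)) \<le> B + onorm K * B"
        using B(1)[of k] order_trans[OF norm_adjoint_le[OF K] mult_left_mono[OF B(2)[of k] onorm_pos_le[OF K]]]
        by (intro norm_triangle_le add_mono) auto
      then have "(inverse (\<theta> k) - 1) * norm (resW k u + K' (resC k u)) \<le> (\<sigma> k * \<gamma> / 2) * (B + onorm K * B)"
        using inverse_\<theta>_bounds[of k] B0 onorm_pos_le[OF K] by (intro mult_mono) auto
      then show "norm ((inverse (\<theta> k) - 1) *\<^sub>R (resW k u + K' (resC k u)))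
        \<le> norm (\<sigma> k) * (\<gamma> / 2 * (B + onorm K * B))"
        unfolding norm_scaleR using inverse_\<theta>_bounds(1)[of k] \<sigma>_pos[of k] by (simp add: mult.assoc)
    qed
  qed
  ultimately have "(\<lambda>k. (resU k u v - resU (Suc k) u v) + K' (resV k u v - resV (Suc k) u v)
      + (inverse (\<theta> k) - 1) *\<^sub>R (resW k u + K' (resC k u))) \<longlonglongrightarrow> 0 + 0 + 0"
    by (intro tendsto_add saddle_energy(2)[OF sp])
  then show ?thesis unfolding eq by simp
qed

text \<open>In the limit only \<open>q\<close> and \<open>x\<close> converge strongly, which in each of the two inclusions
  is exactly one factor of the inner product tested by maximal monotonicity.\<close>

lemma weak_cluster_point_is_saddle:
  assumes sp: "saddle_point K F G u v"
    and H: "H \<le> sequentially" "H \<noteq> bot"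
    and weak: "\<And>h. ((\<lambda>k. y (Suc k) \<bullet> h) \<longlongrightarrow> m \<bullet> h) H"
  shows "saddle_point K F G u m"
proof -
  obtain B where B: "\<And>k. norm (resA k v) \<le> B" "\<And>k. norm (resZ k v) \<le> B"
    using saddle_residuals_bounded[OF sp] by blast
  have seq: "(a \<longlongrightarrow> l) H" if "a \<longlonglongrightarrow> l" for a :: "nat \<Rightarrow> 'c::topological_space" and l
    by (rule tendsto_mono[OF H(1) that])
  have "K u \<in> subdifferential G m"
  proof (rule subdifferential_maximal_monotone[OF G])
    fix r h assume h: "h \<in> subdifferential G r"
    have "((\<lambda>k. (q k - h) \<bullet> (y (Suc k) - r)) \<longlongrightarrow> (K u - h) \<bullet> (m - r)) H"
    proof (rule tendsto_inner_strong_weak)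
      show "((\<lambda>k. q k - h) \<longlongrightarrow> K u - h) H" by (intro tendsto_intros seq q_tendsto_saddle[OF sp])
      have "norm (y (Suc k) - r) \<le> B + norm (v - r)" for k
        using norm_triangle_le[of "resZ k v" "v - r" "B + norm (v - r)"] B(2)[of k]
        by (simp add: resZ_def)
      then show "eventually (\<lambda>k. norm (y (Suc k) - r) \<le> B + norm (v - r)) H" by simp
      show "((\<lambda>k. (y (Suc k) - r) \<bullet> w) \<longlongrightarrow> (m - r) \<bullet> w) H" for w
        unfolding inner_diff_left by (intro tendsto_intros weak)
    qed
    then show "0 \<le> (K u - h) \<bullet> (m - r)"
      by (rule tendsto_lowerbound[OF _ _ H(2)])
        (intro always_eventually allI subdifferential_monotone[OF G(1) q_subgradient h])
  qed
  moreover have "- K' m \<in> subdifferential F u"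
  proof (rule subdifferential_maximal_monotone[OF F])
    fix r h assume h: "h \<in> subdifferential F r"
    have "((\<lambda>k. (x (Suc k) - r) \<bullet> (p k - h)) \<longlongrightarrow> (u - r) \<bullet> (- K' m - h)) H"
    proof (rule tendsto_inner_strong_weak)
      show "((\<lambda>k. x (Suc k) - r) \<longlongrightarrow> u - r) H"
        by (intro tendsto_intros seq LIMSEQ_Suc x_tendsto_saddle[OF sp])
      have "norm (p k - h) \<le> B + norm (- K' v - h)" for k
        using norm_triangle_le[of "resA k v" "- K' v - h" "B + norm (- K' v - h)"] B(1)[of k]
        by (simp add: resA_def)
      then show "eventually (\<lambda>k. norm (p k - h) \<le> B + norm (- K' v - h)) H" by simp
      fix w
      have "((\<lambda>k. (p k + K' (y (Suc k))) \<bullet> w - y (Suc k) \<bullet> K w - h \<bullet> w) \<longlongrightarrow> 0 \<bullet> w - m \<bullet> K w - h \<bullet> w) H"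
        by (intro tendsto_intros seq primal_residual_tendsto_0[OF sp] weak)
      moreover have "c \<bullet> K w = K' c \<bullet> w" for c
        using K_inner[of w c] by (simp add: inner_commute)
      ultimately show "((\<lambda>k. (p k - h) \<bullet> w) \<longlongrightarrow> (- K' m - h) \<bullet> w) H"
        by (simp add: inner_add_left inner_diff_left)
    qed
    then show "0 \<le> (- K' m - h) \<bullet> (u - r)"
      unfolding inner_commute[of "- K' m - h"]
      by (rule tendsto_lowerbound[OF _ _ H(2)])
        (use subdifferential_monotone[OF F(1) p_subgradient h] in \<open>simp add: inner_commute\<close>)
  qed
  ultimately show ?thesis using saddle_point_iff_subgradients by blast
qed

text \<open>Opial's argument: the energies relative to two saddle-points with the same primal part both
  converge, hence so does their difference. The quadratic terms cancel in it, and up to vanishing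
  terms and constants there remains the inner product of \<open>y (Suc k)\<close> with \<open>(id + s K K\<^sup>*) h\<close>.\<close>

lemma opial_functional_convergent:
  assumes sp1: "saddle_point K F G u m1" and sp2: "saddle_point K F G u m2"
  defines "h \<equiv> m1 - m2"
  shows "convergent (\<lambda>k. y (Suc k) \<bullet> (h + s *\<^sub>R K (K' h)))"
proof -
  have U: "resU k u m1 = resU k u m2 + K' h" and V: "resV k u m1 = resV k u m2 - h" for k
    by (simp_all add: resU_def resV_def h_def K'.diff)
  have diff: "(resV k u m2 - s *\<^sub>R K (resU k u m2)) \<bullet> h
      = energy k u m2 - energy k u m1 + (s * (norm (K' h))\<^sup>2 + (norm h)\<^sup>2) / 2" for k
  proof -
    have sq: "(norm (a + b))\<^sup>2 = (norm a)\<^sup>2 + 2 * (a \<bullet> b) + (norm b)\<^sup>2"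
      "(norm (a - b))\<^sup>2 = (norm a)\<^sup>2 - 2 * (a \<bullet> b) + (norm b)\<^sup>2" for a b :: "'c::real_inner"
      by (simp_all add: power2_norm_eq_inner inner_add_left inner_add_right inner_diff_left
          inner_diff_right inner_commute[of b a])
    show ?thesis
      unfolding energy_def U V sq inner_diff_left inner_scaleR_left K_inner by (simp add: field_simps)
  qed
  have R: "resV k u m2 - s *\<^sub>R K (resU k u m2)
      = y (Suc k) + s *\<^sub>R K (K' (y (Suc k))) - (m2 + s *\<^sub>R K (K' m2))
        + ((resV k u m2 - resV (Suc k) u m2) - s *\<^sub>R K (resU k u m2 - resU (Suc k) u m2)
           - s *\<^sub>R K (p k + K' (y (Suc k))))" for k
  proof -
    have "resV k u m2 - s *\<^sub>R K (resU k u m2) = (resV (Suc k) u m2 - s *\<^sub>R K (resU (Suc k) u m2))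
       + ((resV k u m2 - resV (Suc k) u m2) - s *\<^sub>R K (resU k u m2 - resU (Suc k) u m2))"
      by (simp add: K.diff algebra_simps)
    also have "resV (Suc k) u m2 - s *\<^sub>R K (resU (Suc k) u m2)
       = y (Suc k) + s *\<^sub>R K (K' (y (Suc k))) - (m2 + s *\<^sub>R K (K' m2)) - s *\<^sub>R K (p k + K' (y (Suc k)))"
      unfolding residual_update(2) resZ_def resA_def by (simp add: K.add K'.add algebra_simps)
    finally show ?thesis by (simp add: algebra_simps)
  qed
  obtain L1 L2 where L: "(\<lambda>k. energy k u m1) \<longlonglongrightarrow> L1" "(\<lambda>k. energy k u m2) \<longlonglongrightarrow> L2"
    using saddle_energy(4)[OF sp1] saddle_energy(4)[OF sp2] unfolding convergent_def by blast
  define \<delta> where "\<delta> k = (resV k u m2 - resV (Suc k) u m2) - s *\<^sub>R K (resU k u m2 - resU (Suc k) u m2)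
           - s *\<^sub>R K (p k + K' (y (Suc k)))" for k
  have "\<delta> \<longlonglongrightarrow> 0 - s *\<^sub>R K 0 - s *\<^sub>R K 0"
    unfolding \<delta>_def
    by (intro tendsto_intros K.tendsto saddle_energy[OF sp2] primal_residual_tendsto_0[OF sp2])
  then have \<delta>: "\<delta> \<longlonglongrightarrow> 0" by (simp add: K.zero)
  have adj: "K (K' c) \<bullet> h = c \<bullet> K (K' h)" for c
    using K_inner[of "K' c" h] K_inner[of "K' h" c] by (simp add: inner_commute)
  have "y (Suc k) \<bullet> (h + s *\<^sub>R K (K' h))
      = energy k u m2 - energy k u m1 + (s * (norm (K' h))\<^sup>2 + (norm h)\<^sup>2) / 2
        + (m2 + s *\<^sub>R K (K' m2)) \<bullet> h - \<delta> k \<bullet> h" for k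
  proof -
    have "(resV k u m2 - s *\<^sub>R K (resU k u m2)) \<bullet> h
      = y (Suc k) \<bullet> (h + s *\<^sub>R K (K' h)) - (m2 + s *\<^sub>R K (K' m2)) \<bullet> h + \<delta> k \<bullet> h"
      unfolding R \<delta>_def[symmetric]
      by (simp add: inner_add_left inner_diff_left inner_add_right adj)
    then show ?thesis using diff[of k] by linarith
  qed
  moreover have "(\<lambda>k. energy k u m2 - energy k u m1 + (s * (norm (K' h))\<^sup>2 + (norm h)\<^sup>2) / 2
        + (m2 + s *\<^sub>R K (K' m2)) \<bullet> h - \<delta> k \<bullet> h)
      \<longlonglongrightarrow> L2 - L1 + (s * (norm (K' h))\<^sup>2 + (norm h)\<^sup>2) / 2 + (m2 + s *\<^sub>R K (K' m2)) \<bullet> h - 0 \<bullet> h"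
    by (intro tendsto_intros L \<delta>)
  ultimately show ?thesis unfolding convergent_def by auto
qed

text \<open>The operator \<open>id + s K K\<^sup>*\<close> is positive definite, so its value at \<open>m1 - m2\<close> separates \<open>m1\<close> from
  \<open>m2\<close>.\<close>

lemma weak_cluster_point_unique:
  assumes sp: "saddle_point K F G u v"
    and H1: "H1 \<le> sequentially" "H1 \<noteq> bot" "\<And>h. ((\<lambda>k. y (Suc k) \<bullet> h) \<longlongrightarrow> m1 \<bullet> h) H1"
    and H2: "H2 \<le> sequentially" "H2 \<noteq> bot" "\<And>h. ((\<lambda>k. y (Suc k) \<bullet> h) \<longlongrightarrow> m2 \<bullet> h) H2"
  shows "m1 = m2"
proof -
  define h where "h = m1 - m2"
  define w where "w = h + s *\<^sub>R K (K' h)"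
  have "saddle_point K F G u m1" "saddle_point K F G u m2"
    by (rule weak_cluster_point_is_saddle[OF sp H1], rule weak_cluster_point_is_saddle[OF sp H2])
  then obtain l where l: "(\<lambda>k. y (Suc k) \<bullet> w) \<longlonglongrightarrow> l"
    using opial_functional_convergent unfolding w_def h_def convergent_def by blast
  have "m1 \<bullet> w = l" "m2 \<bullet> w = l"
    using tendsto_unique[OF H1(2) H1(3)[of w] tendsto_mono[OF H1(1) l]]
      tendsto_unique[OF H2(2) H2(3)[of w] tendsto_mono[OF H2(1) l]] by simp_all
  then have "h \<bullet> w = 0" by (simp add: h_def inner_diff_left)
  moreover have "h \<bullet> w = (norm h)\<^sup>2 + s * (norm (K' h))\<^sup>2"
    unfolding w_def inner_add_right inner_scaleR_right power2_norm_eq_inner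
    using K_inner[of "K' h" h] by (simp add: inner_commute)
  ultimately have "(norm h)\<^sup>2 = 0"
    using s_pos by (smt (verit) mult_nonneg_nonneg zero_le_power2)
  then show ?thesis by (simp add: h_def)
qed

lemma y_weakly_tendsto:
  assumes sp: "saddle_point K F G u v"
  obtains ys where "saddle_point K F G u ys" "weakly_tendsto (\<lambda>k. y (Suc k)) ys"
proof -
  obtain B where B: "\<And>k. norm (resZ k v) \<le> B" using saddle_residuals_bounded[OF sp] by blast
  have bound: "norm (y (Suc k)) \<le> B + norm v" for k
    using norm_triangle_le[of "resZ k v" v "B + norm v"] B[of k] by (simp add: resZ_def)
  obtain H ys where H: "H \<le> sequentially" "H \<noteq> bot" "\<And>h. ((\<lambda>k. y (Suc k) \<bullet> h) \<longlongrightarrow> ys \<bullet> h) H"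
    using weak_cluster_point[of "\<lambda>k. y (Suc k)" "B + norm v" sequentially] bound by auto
  show ?thesis
  proof (rule that)
    show "saddle_point K F G u ys" by (rule weak_cluster_point_is_saddle[OF sp H])
    show "weakly_tendsto (\<lambda>k. y (Suc k)) ys"
    proof (rule weakly_tendsto_of_unique_cluster_point[OF bound])
      fix H' m assume H': "H' \<le> sequentially" "H' \<noteq> bot" "\<And>h. ((\<lambda>k. y (Suc k) \<bullet> h) \<longlongrightarrow> m \<bullet> h) H'"
      show "m = ys" by (rule weak_cluster_point_unique[OF sp H' H])
    qed
  qed
qed

subsection \<open>The primal-dual gap along the iteration\<close>

text \<open>The difference of Lagrangians whose supremum is the restricted gap, at the \<open>k\<close>-th pair of
  proximal points. It is finite on the domains, so real arithmetic suffices.\<close>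

definition gap :: "nat \<Rightarrow> 'a \<Rightarrow> 'b \<Rightarrow> real" where
  "gap k u v = K (x (Suc k)) \<bullet> v - K u \<bullet> y (Suc k) + f (x (Suc k)) - f u + g (y (Suc k)) - g v"

lemma gap_le_residuals:
  assumes u: "u \<in> edom F" and v: "v \<in> edom G"
  shows "\<tau> k * gap k u v \<le> s * (resA k v \<bullet> resW k u) + resZ k v \<bullet> resC k u
    - \<gamma>1 / 2 * (s * \<sigma> k * (norm (resW k u))\<^sup>2)"
proof -
  have "f (x (Suc k)) + p k \<bullet> (u - x (Suc k)) + \<gamma>1 / 2 * (norm (u - x (Suc k)))\<^sup>2 \<le> f u"
    by (rule strongly_convex_subgradient[OF F(1) F_strong(2) p_subgradient u])
  moreover have "g (y (Suc k)) + q k \<bullet> (v - y (Suc k)) \<le> g v"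
    by (rule subgradient_inequality[OF G(1) q_subgradient v])
  moreover have "resA k v \<bullet> (x (Suc k) - u) = - (p k \<bullet> (u - x (Suc k))) + K (x (Suc k)) \<bullet> v - K u \<bullet> v"
    unfolding K_inner resA_def
    by (simp add: inner_add_left inner_diff_right inner_commute[of "K' v"])
  moreover have "(q k - K u) \<bullet> (y (Suc k) - v) = - (q k \<bullet> (v - y (Suc k))) - K u \<bullet> y (Suc k) + K u \<bullet> v"
    by (simp add: inner_diff_left inner_diff_right)
  ultimately have le: "gap k u v \<le> resA k v \<bullet> (x (Suc k) - u) + (q k - K u) \<bullet> (y (Suc k) - v)
      - \<gamma>1 / 2 * (norm (x (Suc k) - u))\<^sup>2"
    unfolding gap_def norm_minus_commute[of u] by linarith
  have "\<tau> k * gap k u v \<le> \<tau> k * (resA k v \<bullet> (x (Suc k) - u) + (q k - K u) \<bullet> (y (Suc k) - v)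
      - \<gamma>1 / 2 * (norm (x (Suc k) - u))\<^sup>2)"
    using le \<tau>_pos[of k] by (intro mult_left_mono) auto
  also have "\<dots> = \<tau> k * (resA k v \<bullet> (x (Suc k) - u)) + \<tau> k * ((q k - K u) \<bullet> (y (Suc k) - v))
      - \<gamma>1 / 2 * (\<tau> k * (norm (x (Suc k) - u))\<^sup>2)"
    by (simp add: distrib_left right_diff_distrib)
  also have "\<tau> k * (norm (x (Suc k) - u))\<^sup>2 = s * \<sigma> k * (norm (resW k u))\<^sup>2"
    by (simp add: scaled_square \<tau>_eq_erg_weight[of k])
  also have "\<tau> k * (resA k v \<bullet> (x (Suc k) - u)) = s * (resA k v \<bullet> resW k u)"
    unfolding resW_eq using \<sigma>_\<tau>[of k] by (simp add: mult.commute[of "\<tau> k"] flip: mult.assoc)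
  also have "\<tau> k * ((q k - K u) \<bullet> (y (Suc k) - v)) = resZ k v \<bullet> resC k u"
    by (simp add: resC_eq resZ_def inner_commute)
  finally show ?thesis .
qed

text \<open>A crude bound that holds at every index, by \<open>a \<bullet> b \<le> (norm (a + b))\<^sup>2 / 4\<close>.\<close>

lemma gap_le_energy:
  assumes u: "u \<in> edom F" and v: "v \<in> edom G"
  shows "\<tau> k * gap k u v \<le> energy k u v"
proof -
  have 4: "2 * (a \<bullet> b) \<le> (norm (b + a))\<^sup>2 / 2" for a b :: "'c::real_inner"
  proof -
    have "0 \<le> (norm (a - b))\<^sup>2" by simp
    then show ?thesis
      by (simp add: power2_norm_eq_inner inner_add_left inner_add_right inner_diff_left
          inner_diff_right inner_commute[of b a] add_divide_distrib)
  qed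
  have "2 * (s * (resA k v \<bullet> resW k u)) \<le> s * ((norm (resU k u v))\<^sup>2 / 2)"
    using mult_left_mono[OF 4[of "resA k v" "resW k u"] less_imp_le[OF s_pos]]
    by (simp add: resU_split mult.left_commute)
  moreover have "2 * (resZ k v \<bullet> resC k u) \<le> (norm (resV k u v))\<^sup>2 / 2"
    using 4[of "resZ k v" "resC k u"] by (simp add: resV_split add.commute)
  moreover have "0 \<le> \<gamma>1 / 2 * (s * \<sigma> k * (norm (resW k u))\<^sup>2)"
    using F_strong s_pos \<sigma>_pos[of k] by simp
  moreover have "energy k u v = s * ((norm (resU k u v))\<^sup>2 / 2) + (norm (resV k u v))\<^sup>2 / 2"
    by (simp add: energy_def add_divide_distrib)
  ultimately show ?thesis using gap_le_residuals[OF u v, of k] energy_nonneg[of k u v] by linarith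
qed

lemma energy_bounded_on_bounded:
  "\<exists>E\<ge>0. \<forall>u v. norm u \<le> R \<longrightarrow> norm v \<le> R \<longrightarrow> energy k u v \<le> E"
proof -
  define b1 where "b1 = inverse (\<sigma> k) * (norm (xh k) + R) + onorm K * R"
  define b2 where "b2 = norm (yh k) + R + \<tau> k * (onorm K * R)"
  have Kn: "0 \<le> onorm K" by (rule onorm_pos_le[OF K])
  have "energy k u v \<le> (s * b1\<^sup>2 + b2\<^sup>2) / 2" if R: "norm u \<le> R" "norm v \<le> R" for u v
  proof -
    have "norm (K' v) \<le> onorm K * R"
      by (rule order_trans[OF norm_adjoint_le[OF K] mult_left_mono[OF R(2) Kn]])
    moreover have "norm ((xh k - u) /\<^sub>R \<sigma> k) \<le> inverse (\<sigma> k) * (norm (xh k) + R)"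
      using norm_triangle_le_diff[of "xh k" u "norm (xh k) + R"] R(1) \<sigma>_pos[of k]
      by (simp add: mult_left_mono)
    ultimately have "norm (resU k u v) \<le> b1"
      unfolding resU_def b1_def by (intro norm_triangle_le add_mono)
    moreover have "norm (K u) \<le> onorm K * R"
      by (rule order_trans[OF onorm[OF K] mult_left_mono[OF R(1) Kn]])
    then have "norm (\<tau> k *\<^sub>R K u) \<le> \<tau> k * (onorm K * R)"
      using \<tau>_pos[of k] by (simp add: mult_left_mono)
    then have "norm (resV k u v) \<le> b2"
      unfolding resV_def b2_def using R(2) by (intro norm_triangle_le_diff add_mono) auto
    ultimately have "s * (norm (resU k u v))\<^sup>2 \<le> s * b1\<^sup>2" "(norm (resV k u v))\<^sup>2 \<le> b2\<^sup>2"
      using s_pos by (auto intro!: mult_left_mono power_mono)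
    then show ?thesis by (simp add: energy_def)
  qed
  moreover have "0 \<le> (s * b1\<^sup>2 + b2\<^sup>2) / 2" using s_pos by simp
  ultimately show ?thesis by blast
qed

text \<open>For an arbitrary pair \<open>(u, v)\<close> the gap only yields half of the modulus \<open>\<gamma>1\<close>, too little for
  the descent of the energy. The missing half comes from the saddle-point, whose gap is nonnegative
  and even quadratic in the distance: shift \<open>(u, v)\<close> almost all the way to it. The shifted gap
  still controls \<open>\<kappa>\<close> times the original one, and the modulus becomes \<open>\<gamma>1 / (1 + \<kappa>)\<close>.\<close>

lemma shifted_gap:
  assumes sp: "saddle_point K F G x' y'" and \<kappa>: "0 < \<kappa>" "\<kappa> \<le> 1"
    and u: "u \<in> edom F" and v: "v \<in> edom G"
  defines "u\<kappa> \<equiv> \<kappa> *\<^sub>R u + (1 - \<kappa>) *\<^sub>R x'" and "v\<kappa> \<equiv> \<kappa> *\<^sub>R v + (1 - \<kappa>) *\<^sub>R y'"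
  shows "\<kappa> * (\<tau> k * gap k u v) \<le> s * (resA k v\<kappa> \<bullet> resW k u\<kappa>) + resZ k v\<kappa> \<bullet> resC k u\<kappa>
    - \<gamma>1 / (1 + \<kappa>) * (s * \<sigma> k * (norm (resW k u\<kappa>))\<^sup>2)"
proof -
  have dom: "x' \<in> edom F" "y' \<in> edom G" using sp by (auto simp: saddle_point_def)
  have sub: "- K' y' \<in> subdifferential F x'" "K x' \<in> subdifferential G y'"
    using sp saddle_point_iff_subgradients by blast+
  have dom\<kappa>: "u\<kappa> \<in> edom F" "v\<kappa> \<in> edom G"
    unfolding u\<kappa>_def v\<kappa>_def
    using convex_on_edom[OF F(1,2)] convex_on_edom[OF G(1,2)] u v dom \<kappa>
    by (auto simp: convex_on_def intro!: convexD)
  define w where "w = x (Suc k) - u\<kappa>"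
  define e where "e = u - x'"
  have "f u\<kappa> \<le> \<kappa> * f u + (1 - \<kappa>) * f x' - \<gamma>1 / 2 * (\<kappa> * (1 - \<kappa>) * (norm e)\<^sup>2)"
    unfolding u\<kappa>_def e_def by (rule strongly_convex_real[OF F(1,2) F_strong(2)]) (use u dom \<kappa> in auto)
  moreover have "g v\<kappa> \<le> \<kappa> * g v + (1 - \<kappa>) * g y'"
    using convex_onD[OF convex_on_edom[OF G(1,2)], of "1 - \<kappa>" v y'] v dom \<kappa> by (simp add: v\<kappa>_def)
  moreover have "K (x (Suc k)) \<bullet> v\<kappa> = \<kappa> * (K (x (Suc k)) \<bullet> v) + (1 - \<kappa>) * (K (x (Suc k)) \<bullet> y')"
    "K u\<kappa> \<bullet> y (Suc k) = \<kappa> * (K u \<bullet> y (Suc k)) + (1 - \<kappa>) * (K x' \<bullet> y (Suc k))"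
    unfolding u\<kappa>_def v\<kappa>_def by (simp_all add: K.add K.scaleR inner_add_left inner_add_right)
  ultimately have shift: "\<kappa> * gap k u v + (1 - \<kappa>) * gap k x' y' + \<gamma>1 / 2 * (\<kappa> * (1 - \<kappa>) * (norm e)\<^sup>2)
      \<le> gap k u\<kappa> v\<kappa>"
    unfolding gap_def by (simp add: algebra_simps)
  have "f x' + (- K' y') \<bullet> (x (Suc k) - x') + \<gamma>1 / 2 * (norm (x (Suc k) - x'))\<^sup>2 \<le> f (x (Suc k))"
    by (rule strongly_convex_subgradient[OF F(1) F_strong(2) sub(1) x_edom])
  moreover have "g y' + K x' \<bullet> (y (Suc k) - y') \<le> g (y (Suc k))"
    by (rule subgradient_inequality[OF G(1) sub(2) y_edom])
  moreover have "(- K' y') \<bullet> (x (Suc k) - x') = K x' \<bullet> y' - K (x (Suc k)) \<bullet> y'"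
    unfolding K_inner by (simp add: inner_diff_right inner_commute[of "K' y'"])
  ultimately have "\<gamma>1 / 2 * (norm (x (Suc k) - x'))\<^sup>2 \<le> gap k x' y'"
    unfolding gap_def inner_diff_right by linarith
  moreover have "x (Suc k) - x' = w + \<kappa> *\<^sub>R e"
    by (simp add: w_def e_def u\<kappa>_def algebra_simps)
  ultimately have "(1 - \<kappa>) * (\<gamma>1 / 2 * (norm (w + \<kappa> *\<^sub>R e))\<^sup>2) \<le> (1 - \<kappa>) * gap k x' y'"
    using \<kappa> by (intro mult_left_mono) auto
  moreover have split: "(1 - \<kappa>) * (\<gamma>1 / 2) * ((norm (w + \<kappa> *\<^sub>R e))\<^sup>2 + \<kappa> * (norm e)\<^sup>2)
      = (1 - \<kappa>) * (\<gamma>1 / 2 * (norm (w + \<kappa> *\<^sub>R e))\<^sup>2) + \<gamma>1 / 2 * (\<kappa> * (1 - \<kappa>) * (norm e)\<^sup>2)"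
    by (simp add: field_simps)
  \<comment> \<open>the worst case over \<open>e\<close> is \<open>e = - w / (1 + \<kappa>)\<close>\<close>
  moreover have "(norm w)\<^sup>2 / (1 + \<kappa>) \<le> (norm (w + \<kappa> *\<^sub>R e))\<^sup>2 + \<kappa> * (norm e)\<^sup>2"
  proof -
    have "(1 + \<kappa>) * ((norm (w + \<kappa> *\<^sub>R e))\<^sup>2 + \<kappa> * (norm e)\<^sup>2) - (norm w)\<^sup>2
        = \<kappa> * (norm (w + (1 + \<kappa>) *\<^sub>R e))\<^sup>2"
      unfolding power2_norm_eq_inner
      by (simp add: inner_add_left inner_add_right inner_commute[of e w])
        (simp add: algebra_simps)
    also have "\<dots> \<ge> 0" using \<kappa> by simp
    finally show ?thesis using \<kappa> by (simp add: field_simps)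
  qed
  then have "(1 - \<kappa>) * (\<gamma>1 / 2) * ((norm w)\<^sup>2 / (1 + \<kappa>))
      \<le> (1 - \<kappa>) * (\<gamma>1 / 2) * ((norm (w + \<kappa> *\<^sub>R e))\<^sup>2 + \<kappa> * (norm e)\<^sup>2)"
    using \<kappa> F_strong by (intro mult_left_mono) auto
  ultimately have "\<kappa> * gap k u v \<le> gap k u\<kappa> v\<kappa> - (1 - \<kappa>) * (\<gamma>1 / 2) * ((norm w)\<^sup>2 / (1 + \<kappa>))"
    using shift split by linarith
  from mult_left_mono[OF this less_imp_le[OF \<tau>_pos[of k]]]
  have "\<kappa> * (\<tau> k * gap k u v) \<le> \<tau> k * gap k u\<kappa> v\<kappa>
      - (1 - \<kappa>) * (\<gamma>1 / 2) / (1 + \<kappa>) * (\<tau> k * (norm w)\<^sup>2)"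
    by (simp add: algebra_simps)
  also have "\<tau> k * (norm w)\<^sup>2 = s * \<sigma> k * (norm (resW k u\<kappa>))\<^sup>2"
    by (simp add: scaled_square \<tau>_eq_erg_weight[of k] w_def)
  finally have "\<kappa> * (\<tau> k * gap k u v) \<le> s * (resA k v\<kappa> \<bullet> resW k u\<kappa>) + resZ k v\<kappa> \<bullet> resC k u\<kappa>
      - (\<gamma>1 / 2 + (1 - \<kappa>) * (\<gamma>1 / 2) / (1 + \<kappa>)) * (s * \<sigma> k * (norm (resW k u\<kappa>))\<^sup>2)"
    using gap_le_residuals[OF dom\<kappa>, of k] unfolding distrib_right by linarith
  moreover have "\<gamma>1 / 2 + (1 - \<kappa>) * (\<gamma>1 / 2) / (1 + \<kappa>) = \<gamma>1 / (1 + \<kappa>)"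
    using \<kappa> by (simp add: field_simps)
  ultimately show ?thesis by simp
qed

lemma gap_descent:
  assumes sp: "saddle_point K F G x' y'"
  obtains \<kappa> N where "0 < \<kappa>" "\<kappa> \<le> 1"
    "\<And>k u v. k \<ge> N \<Longrightarrow> u \<in> edom F \<Longrightarrow> v \<in> edom G \<Longrightarrow>
      \<kappa> * (\<tau> k * gap k u v)
      \<le> energy k (\<kappa> *\<^sub>R u + (1 - \<kappa>) *\<^sub>R x') (\<kappa> *\<^sub>R v + (1 - \<kappa>) *\<^sub>R y')
        - energy (Suc k) (\<kappa> *\<^sub>R u + (1 - \<kappa>) *\<^sub>R x') (\<kappa> *\<^sub>R v + (1 - \<kappa>) *\<^sub>R y')"
proof -
  define \<eta> where "\<eta> = \<gamma> * (1 + s * (onorm K)\<^sup>2) / 2"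
  have \<eta>: "0 < \<eta>" "\<eta> < \<gamma>1"
    using \<gamma>_less params(3) s_pos by (auto simp: \<eta>_def add_pos_nonneg)
  \<comment> \<open>then \<open>\<kappa> \<eta>\<close> is at most half of the slack \<open>\<gamma>1 - \<eta>\<close>\<close>
  define \<kappa> where "\<kappa> = min 1 ((\<gamma>1 - \<eta>) / (2 * \<eta>))"
  have \<kappa>: "0 < \<kappa>" "\<kappa> \<le> 1" using \<eta> by (auto simp: \<kappa>_def)
  have "\<kappa> * \<eta> \<le> (\<gamma>1 - \<eta>) / (2 * \<eta>) * \<eta>" using \<eta> by (intro mult_right_mono) (auto simp: \<kappa>_def)
  also have "\<dots> = \<gamma>1 / 2 - \<eta> / 2" using \<eta> by (simp add: field_simps)
  finally have "(1 + \<kappa>) * \<eta> < \<gamma>1" using \<eta>(2) by (simp add: distrib_right)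
  then have "\<eta> < \<gamma>1 / (1 + \<kappa>)" using \<kappa> by (simp add: field_simps)
  then obtain \<epsilon> N where \<epsilon>: "\<epsilon> > 0" and desc: "\<And>k u v. k \<ge> N \<Longrightarrow>
      s * (resA k v \<bullet> resW k u) + resZ k v \<bullet> resC k u - \<gamma>1 / (1 + \<kappa>) * (s * \<sigma> k * (norm (resW k u))\<^sup>2)
      + \<epsilon> * (s * \<sigma> k * (norm (resW k u))\<^sup>2 + s * (norm (resU k u v - resU (Suc k) u v))\<^sup>2
              + (norm (resV k u v - resV (Suc k) u v))\<^sup>2)
      \<le> energy k u v - energy (Suc k) u v"
    using energy_descent[of "\<gamma>1 / (1 + \<kappa>)"] unfolding \<eta>_def by metis
  have pos: "0 \<le> \<epsilon> * (s * \<sigma> k * (norm (resW k u))\<^sup>2 + s * (norm (resU k u v - resU (Suc k) u v))\<^sup>2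
              + (norm (resV k u v - resV (Suc k) u v))\<^sup>2)" for k u v
    using \<epsilon> s_pos \<sigma>_pos[of k] by simp
  show ?thesis
  proof (rule that[OF \<kappa>])
    fix k u v assume k: "k \<ge> N" and uv: "u \<in> edom F" "v \<in> edom G"
    show "\<kappa> * (\<tau> k * gap k u v)
      \<le> energy k (\<kappa> *\<^sub>R u + (1 - \<kappa>) *\<^sub>R x') (\<kappa> *\<^sub>R v + (1 - \<kappa>) *\<^sub>R y')
        - energy (Suc k) (\<kappa> *\<^sub>R u + (1 - \<kappa>) *\<^sub>R x') (\<kappa> *\<^sub>R v + (1 - \<kappa>) *\<^sub>R y')"
      using shifted_gap[OF sp \<kappa> uv, of k] desc[OF k] pos by (meson add_increasing2 order_trans le_add_same_cancel1)
  qed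
qed

text \<open>The descent holds from some index on; the finitely many earlier gaps are bounded by
  their own energies.\<close>

lemma weighted_gap_sums_bounded:
  assumes sp: "saddle_point K F G x' y'" and mem: "x' \<in> X0" "y' \<in> Y0"
    and dom: "X0 \<subseteq> edom F" "Y0 \<subseteq> edom G" and bnd: "bounded X0" "bounded Y0"
  obtains B where "\<And>k u v. u \<in> X0 \<Longrightarrow> v \<in> Y0 \<Longrightarrow> (\<Sum>j<k. erg_weight \<theta> j * gap j u v) \<le> B"
proof -
  obtain R where R: "\<And>u. u \<in> X0 \<Longrightarrow> norm u \<le> R" "\<And>v. v \<in> Y0 \<Longrightarrow> norm v \<le> R"
  proof -
    obtain R1 R2 where "\<forall>u\<in>X0. norm u \<le> R1" "\<forall>v\<in>Y0. norm v \<le> R2" using bnd by (auto simp: bounded_iff)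
    then show ?thesis by (intro that[of "max R1 R2"]) (auto intro: max.coboundedI1 max.coboundedI2)
  qed
  obtain E where E: "\<And>k. 0 \<le> E k" "\<And>k u v. norm u \<le> R \<Longrightarrow> norm v \<le> R \<Longrightarrow> energy k u v \<le> E k"
    using energy_bounded_on_bounded[of R] by metis
  obtain \<kappa> N where \<kappa>: "0 < \<kappa>" "\<kappa> \<le> 1" and desc: "\<And>k u v. k \<ge> N \<Longrightarrow> u \<in> edom F \<Longrightarrow> v \<in> edom G \<Longrightarrow>
      \<kappa> * (\<tau> k * gap k u v)
      \<le> energy k (\<kappa> *\<^sub>R u + (1 - \<kappa>) *\<^sub>R x') (\<kappa> *\<^sub>R v + (1 - \<kappa>) *\<^sub>R y')
        - energy (Suc k) (\<kappa> *\<^sub>R u + (1 - \<kappa>) *\<^sub>R x') (\<kappa> *\<^sub>R v + (1 - \<kappa>) *\<^sub>R y')"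
    using gap_descent[OF sp] by metis
  define B where "B = (\<Sum>j<N. E j) + E N / \<kappa>"
  have "(\<Sum>j<k. \<tau> j * gap j u v) \<le> B" if u: "u \<in> X0" and v: "v \<in> Y0" for k u v
  proof -
    define u\<kappa> v\<kappa> where "u\<kappa> = \<kappa> *\<^sub>R u + (1 - \<kappa>) *\<^sub>R x'" and "v\<kappa> = \<kappa> *\<^sub>R v + (1 - \<kappa>) *\<^sub>R y'"
    have uv: "u \<in> edom F" "v \<in> edom G" using u v dom by auto
    have early: "\<tau> j * gap j u v \<le> E j" for j
      by (rule order_trans[OF gap_le_energy[OF uv] E(2)[OF R(1)[OF u] R(2)[OF v]]])
    show ?thesis
    proof (cases "k \<le> N")
      case True
      have "(\<Sum>j<k. \<tau> j * gap j u v) \<le> (\<Sum>j<k. E j)" by (intro sum_mono early)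
      also have "\<dots> \<le> (\<Sum>j<N. E j)" using True E(1) by (intro sum_mono2) auto
      also have "\<dots> \<le> B" unfolding B_def using E(1)[of N] \<kappa> by simp
      finally show ?thesis .
    next
      case False
      have "\<kappa> * (\<Sum>j=N..<k. \<tau> j * gap j u v) \<le> (\<Sum>j=N..<k. energy j u\<kappa> v\<kappa> - energy (Suc j) u\<kappa> v\<kappa>)"
        unfolding sum_distrib_left u\<kappa>_def v\<kappa>_def by (intro sum_mono desc uv) auto
      also have "\<dots> = energy N u\<kappa> v\<kappa> - energy k u\<kappa> v\<kappa>"
        using sum_Suc_diff'[of N k "\<lambda>j. - energy j u\<kappa> v\<kappa>"] False by simp
      also have "\<dots> \<le> E N"
      proof -
        have "norm u\<kappa> \<le> R" "norm v\<kappa> \<le> R"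
          unfolding u\<kappa>_def v\<kappa>_def using \<kappa> R u v mem by (auto intro!: norm_convex_combination_le)
        then show ?thesis using E(2)[of u\<kappa> v\<kappa> N] energy_nonneg[of k u\<kappa> v\<kappa>] by linarith
      qed
      finally have late: "(\<Sum>j=N..<k. \<tau> j * gap j u v) \<le> E N / \<kappa>"
        using \<kappa> by (simp add: field_simps)
      have "(\<Sum>j<k. \<tau> j * gap j u v) = (\<Sum>j<N. \<tau> j * gap j u v) + (\<Sum>j=N..<k. \<tau> j * gap j u v)"
        unfolding lessThan_atLeast0 using False by (subst sum.atLeastLessThan_concat) auto
      also have "\<dots> \<le> B" unfolding B_def by (intro add_mono late sum_mono early)
      finally show ?thesis .
    qed
  qed
  then have "\<tau> 0 * (\<Sum>j<k. erg_weight \<theta> j * gap j u v) \<le> B" if "u \<in> X0" "v \<in> Y0" for k u v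
    using that unfolding sum_distrib_left by (subst (asm) \<tau>_eq_erg_weight) (simp add: mult.assoc)
  then have "(\<Sum>j<k. erg_weight \<theta> j * gap j u v) \<le> B / \<tau> 0" if "u \<in> X0" "v \<in> Y0" for k u v
    using that params(2) by (simp add: field_simps)
  then show ?thesis by (rule that)
qed

subsection \<open>Ergodic averages\<close>

lemma erg_weight_sum_growth:
  obtains m where "m > 0" "\<And>k. m * (real k)\<^sup>2 \<le> (\<Sum>j<k. erg_weight \<theta> j)"
proof -
  obtain c where c: "c > 0" "\<And>k. 1 + c * real k \<le> erg_weight \<theta> k" using erg_weight_growth by metis
  define m where "m = min 1 (c / 2)"
  have m: "m > 0" "m \<le> 1" "2 * m \<le> c" using c(1) by (auto simp: m_def)
  have "m * (real k)\<^sup>2 \<le> (\<Sum>j<k. erg_weight \<theta> j)" for k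
  proof (induction k)
    case (Suc k)
    have "m * (real (Suc k))\<^sup>2 = m * (real k)\<^sup>2 + (2 * m * real k + m)"
      by (simp add: power2_eq_square algebra_simps)
    also have "\<dots> \<le> (\<Sum>j<k. erg_weight \<theta> j) + (c * real k + 1)"
      using m by (intro add_mono Suc mult_right_mono) auto
    also have "\<dots> \<le> (\<Sum>j<Suc k. erg_weight \<theta> j)" using c(2)[of k] by simp
    finally show ?case .
  qed simp
  with m(1) show ?thesis by (rule that)
qed

lemma erg_weight_sum_pos: "k \<ge> 1 \<Longrightarrow> (\<Sum>j<k. erg_weight \<theta> j) > 0"
  by (intro sum_pos) (auto simp: erg_weight_pos lessThan_empty_iff)

lemma erg_norm_pos: "k \<ge> 1 \<Longrightarrow> erg_norm \<theta> k > 0"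
  using erg_weight_sum_pos by (simp add: erg_norm_def)

lemma erg_norm_weights: "k \<ge> 1 \<Longrightarrow> (\<Sum>j<k. erg_norm \<theta> k * erg_weight \<theta> j) = 1"
  using erg_weight_sum_pos[of k] by (simp add: erg_norm_def flip: sum_distrib_left)

lemma ergodic_eq: "ergodic \<theta> u k = (\<Sum>j<k. (erg_norm \<theta> k * erg_weight \<theta> j) *\<^sub>R u (Suc j))"
  by (simp add: ergodic_def scaleR_right.sum)

lemma ergodic_jensen:
  assumes "convex_on C \<phi>" "k \<ge> 1" "\<And>j. u (Suc j) \<in> C"
  shows "\<phi> (ergodic \<theta> u k) \<le> erg_norm \<theta> k * (\<Sum>j<k. erg_weight \<theta> j * \<phi> (u (Suc j)))"
    and "ergodic \<theta> u k \<in> C"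
proof -
  have ne: "{..<k} \<noteq> {}" using assms(2) by (auto simp: lessThan_empty_iff)
  have nn: "0 \<le> erg_norm \<theta> k * erg_weight \<theta> j" for j
    using erg_norm_pos[OF assms(2)] erg_weight_pos[of j] by simp
  have "\<phi> (ergodic \<theta> u k) \<le> (\<Sum>j<k. (erg_norm \<theta> k * erg_weight \<theta> j) * \<phi> (u (Suc j)))"
    unfolding ergodic_eq
    by (rule convex_on_sum[OF _ ne assms(1) erg_norm_weights[OF assms(2)]]) (use nn assms(3) in auto)
  then show "\<phi> (ergodic \<theta> u k) \<le> erg_norm \<theta> k * (\<Sum>j<k. erg_weight \<theta> j * \<phi> (u (Suc j)))"
    by (simp add: sum_distrib_left mult.assoc)
  show "ergodic \<theta> u k \<in> C"
    unfolding ergodic_eq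
    by (rule convex_sum) (use assms nn erg_norm_weights in \<open>auto simp: convex_on_def\<close>)
qed

lemma erg_norm_bigo: "(\<lambda>k. erg_norm \<theta> k * M) \<in> O(\<lambda>k. 1 / (real k)\<^sup>2)"
proof -
  obtain m where m: "m > 0" "\<And>k. m * (real k)\<^sup>2 \<le> (\<Sum>j<k. erg_weight \<theta> j)"
    by (rule erg_weight_sum_growth) blast
  have "norm (erg_norm \<theta> k * M) \<le> \<bar>M\<bar> / m * norm (1 / (real k)\<^sup>2)" if k: "k \<ge> 1" for k
  proof -
    have "erg_norm \<theta> k \<le> inverse (m * (real k)\<^sup>2)"
      unfolding erg_norm_def using m k by (intro le_imp_inverse_le) auto
    then have "erg_norm \<theta> k * \<bar>M\<bar> \<le> inverse (m * (real k)\<^sup>2) * \<bar>M\<bar>" by (intro mult_right_mono) auto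
    then show ?thesis using erg_norm_pos[OF k] by (simp add: abs_mult divide_inverse ac_simps)
  qed
  then show ?thesis by (intro bigoI[of _ "\<bar>M\<bar> / m"] eventually_sequentiallyI[of 1])
qed

text \<open>Averaging the pointwise bound \<open>O(1 / k)\<close> on the distances would leave a logarithm. The rate
  follows from the summability of the weighted squares.\<close>

lemma ergodic_x_rate:
  assumes sp: "saddle_point K F G u v"
  shows "(\<lambda>k. (norm (ergodic \<theta> x k - u))\<^sup>2) \<in> O(\<lambda>k. 1 / (real k)\<^sup>2)"
proof -
  define B where "B = (\<Sum>j. erg_weight \<theta> j * (norm (x (Suc j) - u))\<^sup>2)"
  have le: "(norm (ergodic \<theta> x k - u))\<^sup>2 \<le> erg_norm \<theta> k * B" if k: "k \<ge> 1" for k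
  proof -
    have "ergodic \<theta> x k - u = ergodic \<theta> (\<lambda>j. x j - u) k"
      unfolding ergodic_eq scaleR_diff_right sum_subtractf
      by (simp add: erg_norm_weights[OF k] flip: scaleR_sum_left)
    then have "(norm (ergodic \<theta> x k - u))\<^sup>2
        \<le> erg_norm \<theta> k * (\<Sum>j<k. erg_weight \<theta> j * (norm (x (Suc j) - u))\<^sup>2)"
      using ergodic_jensen(1)[OF convex_on_norm_square k, of "\<lambda>j. x j - u"] by simp
    also have "\<dots> \<le> erg_norm \<theta> k * B"
      unfolding B_def using erg_norm_pos[OF k] erg_weight_pos
      by (intro mult_left_mono sum_le_suminf saddle_energy(1)[OF sp]) (auto simp: less_imp_le)
    finally show ?thesis .
  qed
  have "(\<lambda>k. (norm (ergodic \<theta> x k - u))\<^sup>2) \<in> O(\<lambda>k. erg_norm \<theta> k * B)"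
    by (intro bigoI[of _ 1] eventually_sequentiallyI[of 1]) (use le in force)
  then show ?thesis using erg_norm_bigo landau_o.big_trans by blast
qed

lemma ergodic_weakly_tendsto:
  fixes u :: "nat \<Rightarrow> 'c::{real_inner, complete_space}"
  assumes "weakly_tendsto (\<lambda>k. u (Suc k)) l"
  shows "weakly_tendsto (ergodic \<theta> u) l"
  unfolding weakly_tendsto_iff_inner
proof
  fix h
  obtain m where m: "m > 0" "\<And>k. m * (real k)\<^sup>2 \<le> (\<Sum>j<k. erg_weight \<theta> j)"
    by (rule erg_weight_sum_growth) blast
  have "filterlim (\<lambda>k. m * (real k)\<^sup>2) at_top sequentially"
    using m(1) by (intro filterlim_tendsto_pos_mult_at_top[OF tendsto_const]
        filterlim_pow_at_top filterlim_real_sequentially) auto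
  then have "filterlim (\<lambda>k. \<Sum>j<k. erg_weight \<theta> j) at_top sequentially"
    by (rule filterlim_at_top_mono) (simp add: m)
  from weighted_mean_tendsto[OF _ erg_weight_pos this, of "\<lambda>k. u (Suc k) \<bullet> h" "l \<bullet> h"] assms
  show "(\<lambda>k. ergodic \<theta> u k \<bullet> h) \<longlonglongrightarrow> l \<bullet> h"
    unfolding weakly_tendsto_iff_inner by (simp add: ergodic_def erg_norm_def inner_sum_left)
qed

lemma ergodic_gap:
  assumes k: "k \<ge> 1" and u: "u \<in> edom F" and v: "v \<in> edom G"
  shows "lagrangian K F G (ergodic \<theta> x k) v - lagrangian K F G u (ergodic \<theta> y k)
    \<le> ereal (erg_norm \<theta> k * (\<Sum>j<k. erg_weight \<theta> j * gap j u v))"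
proof -
  note Fj = ergodic_jensen[OF convex_on_edom[OF F(1,2)] k, of x, OF x_edom]
  note Gj = ergodic_jensen[OF convex_on_edom[OF G(1,2)] k, of y, OF y_edom]
  define \<nu> where "\<nu> = erg_norm \<theta> k"
  define mean where "mean a = \<nu> * (\<Sum>j<k. erg_weight \<theta> j * a j)" for a :: "nat \<Rightarrow> real"
  have add: "mean (\<lambda>j. a j + b j) = mean a + mean b" and diff: "mean (\<lambda>j. a j - b j) = mean a - mean b"
    for a b by (simp_all add: mean_def distrib_left right_diff_distrib sum.distrib sum_subtractf)
  have const: "mean (\<lambda>j. c) = c" for c
    using erg_norm_weights[OF k] by (simp add: mean_def \<nu>_def flip: sum_distrib_left sum_distrib_right mult.assoc)
  have lin: "K (ergodic \<theta> x k) \<bullet> v = mean (\<lambda>j. K (x (Suc j)) \<bullet> v)"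
    "K u \<bullet> ergodic \<theta> y k = mean (\<lambda>j. K u \<bullet> y (Suc j))"
    by (simp_all add: ergodic_def mean_def \<nu>_def K.scaleR K.sum inner_sum_left inner_sum_right)
  have "mean (\<lambda>j. gap j u v) = K (ergodic \<theta> x k) \<bullet> v - K u \<bullet> ergodic \<theta> y k
      + mean (\<lambda>j. f (x (Suc j))) - f u + mean (\<lambda>j. g (y (Suc j))) - g v"
    unfolding gap_def lin add diff const ..
  then have "K (ergodic \<theta> x k) \<bullet> v + f (ergodic \<theta> x k) - g v - (K u \<bullet> ergodic \<theta> y k + f u - g (ergodic \<theta> y k))
      \<le> mean (\<lambda>j. gap j u v)"
    using Fj(1) Gj(1) unfolding mean_def \<nu>_def by linarith
  then show ?thesis
    by (simp add: lagrangian_eq Fj(2) Gj(2) u v mean_def \<nu>_def)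
qed

subsection \<open>The gap estimate\<close>

text \<open>At zero energy the resolvents return \<open>(u, v)\<close>, and the residual update is a homogeneous linear
  system, so that the energy stays zero.\<close>

lemma stationary:
  assumes sp: "saddle_point K F G u v" and "energy 0 u v = 0"
  shows "x (Suc k) = u" "y (Suc k) = v"
proof -
  have step: "resW k u = 0 \<and> resA k v = 0 \<and> resZ k v = 0 \<and> resC k u = 0" if "energy k u v = 0" for k
  proof -
    have "0 \<le> s * (norm (resU k u v))\<^sup>2" using s_pos by simp
    moreover have "s * (norm (resU k u v))\<^sup>2 + (norm (resV k u v))\<^sup>2 = 0" using that by (simp add: energy_def)
    ultimately have UV: "resU k u v = 0" "resV k u v = 0"
      using s_pos by (simp_all add: add_nonneg_eq_0_iff)
    note sg = saddle_gain(2,3)[OF sp, of k]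
    have "0 \<le> resW k u \<bullet> resA k v" using sg(1) by (simp add: inner_commute)
    from norm_le_norm_add[OF this] norm_le_norm_add[OF sg(2)] UV show ?thesis
      by (simp add: resU_split resV_split)
  qed
  have zero: "energy k u v = 0" for k
  proof (induction k)
    case (Suc k)
    have r1: "resU (Suc k) u v = - K' (resV (Suc k) u v)" and r2: "resV (Suc k) u v = s *\<^sub>R K (resU (Suc k) u v)"
      using residual_update[of k u v] step[OF Suc] by (simp_all add: K.zero K'.zero eq_neg_iff_add_eq_0)
    \<comment> \<open>a homogeneous system with the positive definite operator \<open>id + s K\<^sup>* K\<close>\<close>
    have "resU (Suc k) u v \<bullet> resU (Suc k) u v = - (s * (norm (K (resU (Suc k) u v)))\<^sup>2)"
    proof -
      have "resU (Suc k) u v \<bullet> resU (Suc k) u v = - (K (resU (Suc k) u v) \<bullet> resV (Suc k) u v)"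
        unfolding K_inner by (metis inner_minus_right r1)
      also have "\<dots> = - (K (resU (Suc k) u v) \<bullet> (s *\<^sub>R K (resU (Suc k) u v)))" using r2 by simp
      finally show ?thesis by (simp add: power2_norm_eq_inner)
    qed
    also have "\<dots> \<le> 0" using s_pos by simp
    finally have "resU (Suc k) u v = 0" by (metis inner_eq_zero_iff inner_ge_zero order_antisym)
    then show ?case using r2 by (simp add: energy_def K.zero)
  qed (rule assms)
  show "x (Suc k) = u" using step[OF zero, of k] resW_eq[of k u] by simp
  show "y (Suc k) = v" using step[OF zero, of k] by (simp add: resZ_def)
qed

lemma gap_nonpos_at_saddle:
  assumes sp: "saddle_point K F G x' y'" and "x (Suc k) = x'" "y (Suc k) = y'"
    and uv: "u \<in> edom F" "v \<in> edom G"
  shows "gap k u v \<le> 0"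
proof -
  have dom: "x' \<in> edom F" "y' \<in> edom G" using sp by (auto simp: saddle_point_def)
  have "lagrangian K F G x' v \<le> lagrangian K F G u y'"
    using sp uv unfolding saddle_point_def by (meson order_trans)
  then show ?thesis by (simp add: lagrangian_eq dom uv gap_def assms(2,3))
qed

lemma gap_bound_0_eq:
  assumes "\<rho> > 0"
  shows "gap_bound K F G \<sigma> \<tau> \<theta> x y xh yh X0 Y0 x' y' 0 \<rho> =
    (SUP (u, v) \<in> X0 \<times> Y0. ereal (energy 0 (\<rho> *\<^sub>R u + (1 - \<rho>) *\<^sub>R x') (\<rho> *\<^sub>R v + (1 - \<rho>) *\<^sub>R y') / (\<rho> * \<tau> 0)))"
proof -
  have e: "\<sigma> 0 / (2 * \<rho> * (\<sigma> 0)\<^sup>2) * (norm (xh 0 - a + \<sigma> 0 *\<^sub>R K' b))\<^sup>2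
      + 1 / (2 * \<rho> * \<tau> 0) * (norm (yh 0 - b - \<tau> 0 *\<^sub>R K a))\<^sup>2 = energy 0 a b / (\<rho> * \<tau> 0)" for a b
  proof -
    have "xh 0 - a + \<sigma> 0 *\<^sub>R K' b = \<sigma> 0 *\<^sub>R resU 0 a b"
      using params(1) by (simp add: resU_def scaleR_add_right)
    then have "(norm (xh 0 - a + \<sigma> 0 *\<^sub>R K' b))\<^sup>2 = (\<sigma> 0)\<^sup>2 * (norm (resU 0 a b))\<^sup>2"
      by (simp add: power_mult_distrib)
    then show ?thesis
      using params(1,2) assms by (simp add: energy_def s_def resV_def field_simps power2_eq_square)
  qed
  show ?thesis
    unfolding gap_bound_def Let_def by (simp only: lessThan_0 sum.empty add_0_right plus_ereal.simps(1) e)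
qed

text \<open>All weighted gap sums stay below one constant \<open>B\<close>. Unless the initial
  energy relative to \<open>(x', y')\<close> vanishes, the term of the supremum at \<open>(x', y')\<close> is a positive number divided by
  \<open>\<rho>\<close>, which exceeds \<open>B\<close> for small \<open>\<rho>\<close>; in the exceptional case no gap is positive.\<close>

lemma gap_bound_dominates:
  assumes sp: "saddle_point K F G x' y'" and mem: "x' \<in> X0" "y' \<in> Y0"
    and dom: "X0 \<subseteq> edom F" "Y0 \<subseteq> edom G" and bnd: "bounded X0" "bounded Y0"
  obtains \<rho> M where "0 < \<rho>" "\<rho> \<le> 1"
    "gap_bound K F G \<sigma> \<tau> \<theta> x y xh yh X0 Y0 x' y' 0 \<rho> = ereal M"
    "\<And>k u v. u \<in> X0 \<Longrightarrow> v \<in> Y0 \<Longrightarrow> (\<Sum>j<k. erg_weight \<theta> j * gap j u v) \<le> M"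
proof -
  obtain B where B: "\<And>k u v. u \<in> X0 \<Longrightarrow> v \<in> Y0 \<Longrightarrow> (\<Sum>j<k. erg_weight \<theta> j * gap j u v) \<le> B"
    using weighted_gap_sums_bounded[OF assms] by metis
  obtain R where R: "\<And>u. u \<in> X0 \<Longrightarrow> norm u \<le> R" "\<And>v. v \<in> Y0 \<Longrightarrow> norm v \<le> R"
  proof -
    obtain R1 R2 where "\<forall>u\<in>X0. norm u \<le> R1" "\<forall>v\<in>Y0. norm v \<le> R2" using bnd by (auto simp: bounded_iff)
    then show ?thesis by (intro that[of "max R1 R2"]) (auto intro: max.coboundedI1 max.coboundedI2)
  qed
  obtain E where E: "\<And>u v. norm u \<le> R \<Longrightarrow> norm v \<le> R \<Longrightarrow> energy 0 u v \<le> E"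
    using energy_bounded_on_bounded[of R 0] by metis
  have ex: "\<exists>M. gap_bound K F G \<sigma> \<tau> \<theta> x y xh yh X0 Y0 x' y' 0 \<rho> = ereal M \<and> energy 0 x' y' / (\<rho> * \<tau> 0) \<le> M"
    if \<rho>: "0 < \<rho>" "\<rho> \<le> 1" for \<rho>
  proof -
    let ?S = "gap_bound K F G \<sigma> \<tau> \<theta> x y xh yh X0 Y0 x' y' 0 \<rho>"
    have "?S \<le> ereal (E / (\<rho> * \<tau> 0))"
      unfolding gap_bound_0_eq[OF \<rho>(1)]
    proof (rule SUP_least, clarify)
      fix u v assume uv: "u \<in> X0" "v \<in> Y0"
      have "energy 0 (\<rho> *\<^sub>R u + (1 - \<rho>) *\<^sub>R x') (\<rho> *\<^sub>R v + (1 - \<rho>) *\<^sub>R y') \<le> E"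
        using \<rho> by (intro E norm_convex_combination_le R uv mem) auto
      then show "ereal (energy 0 (\<rho> *\<^sub>R u + (1 - \<rho>) *\<^sub>R x') (\<rho> *\<^sub>R v + (1 - \<rho>) *\<^sub>R y') / (\<rho> * \<tau> 0))
          \<le> ereal (E / (\<rho> * \<tau> 0))"
        using \<rho> params(2) by (simp add: divide_right_mono)
    qed
    moreover have "ereal (energy 0 x' y' / (\<rho> * \<tau> 0)) \<le> ?S"
    proof -
      have "(\<lambda>(u, v). ereal (energy 0 (\<rho> *\<^sub>R u + (1 - \<rho>) *\<^sub>R x') (\<rho> *\<^sub>R v + (1 - \<rho>) *\<^sub>R y') / (\<rho> * \<tau> 0))) (x', y') \<le> ?S"
        unfolding gap_bound_0_eq[OF \<rho>(1)] by (rule SUP_upper) (use mem in auto)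
      then show ?thesis by (simp flip: scaleR_add_left)
    qed
    ultimately show ?thesis by (cases ?S) auto
  qed
  show ?thesis
  proof (cases "energy 0 x' y' = 0")
    case True
    obtain M where M: "gap_bound K F G \<sigma> \<tau> \<theta> x y xh yh X0 Y0 x' y' 0 1 = ereal M" "0 \<le> M"
      using ex[of 1] True by auto
    have "(\<Sum>j<k. erg_weight \<theta> j * gap j u v) \<le> M" if "u \<in> X0" "v \<in> Y0" for k u v
    proof -
      have "(\<Sum>j<k. erg_weight \<theta> j * gap j u v) \<le> 0"
        using that dom erg_weight_pos stationary[OF sp True]
        by (intro sum_nonpos mult_nonneg_nonpos gap_nonpos_at_saddle[OF sp]) (auto simp: less_imp_le)
      then show ?thesis using M(2) by simp
    qed
    then show ?thesis using that[of 1 M] M(1) by simp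
  next
    case False
    then have e: "energy 0 x' y' > 0" using energy_nonneg[of 0 x' y'] by simp
    define \<rho> where "\<rho> = min 1 (energy 0 x' y' / (\<tau> 0 * (\<bar>B\<bar> + 1)))"
    have \<rho>: "0 < \<rho>" "\<rho> \<le> 1" using e params(2) by (auto simp: \<rho>_def)
    obtain M where M: "gap_bound K F G \<sigma> \<tau> \<theta> x y xh yh X0 Y0 x' y' 0 \<rho> = ereal M"
      "energy 0 x' y' / (\<rho> * \<tau> 0) \<le> M" using ex[OF \<rho>] by blast
    have "\<rho> * (\<tau> 0 * (\<bar>B\<bar> + 1)) \<le> energy 0 x' y' / (\<tau> 0 * (\<bar>B\<bar> + 1)) * (\<tau> 0 * (\<bar>B\<bar> + 1))"
      unfolding \<rho>_def using params(2) by (intro mult_right_mono) auto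
    also have "\<dots> = energy 0 x' y'" using params(2) by (simp add: add_nonneg_eq_0_iff)
    finally have "\<bar>B\<bar> + 1 \<le> energy 0 x' y' / (\<rho> * \<tau> 0)"
      using \<rho>(1) params(2) by (simp add: field_simps)
    then have "B \<le> M" using M(2) by linarith
    then show ?thesis using that[OF \<rho> M(1)] B order_trans by blast
  qed
qed

end

theorem theorem3:
  fixes K :: "'a::{real_inner, complete_space} \<Rightarrow> 'b::{real_inner, complete_space}"
    and F :: "'a \<Rightarrow> ereal" and G :: "'b \<Rightarrow> ereal"
    and \<gamma>1 \<gamma> :: real and \<sigma> \<tau> \<theta> :: "nat \<Rightarrow> real"
    and x xh :: "nat \<Rightarrow> 'a" and y yh :: "nat \<Rightarrow> 'b"
    and X0 :: "'a set" and Y0 :: "'b set" and x' :: 'a and y' :: 'b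
  assumes K: "bounded_linear K"
    and F: "proper F" "convex_fun F" "lower_semicontinuous F"
    and G: "proper G" "convex_fun G" "lower_semicontinuous G"
    and F_strong: "\<gamma>1 > 0" "strongly_convex \<gamma>1 F"
    and X0Y0: "X0 \<times> Y0 \<subseteq> edom F \<times> edom G" "bounded (X0 \<times> Y0)"
    and saddle: "(x', y') \<in> X0 \<times> Y0" "saddle_point K F G x' y'"
    and params: "\<sigma> 0 > 0" "\<tau> 0 > 0" "0 < \<gamma>" "\<gamma> < 2 * \<gamma>1 / (1 + \<sigma> 0 * \<tau> 0 * (onorm K)\<^sup>2)"
    and iter: "adr_iteration K F G \<gamma> \<sigma> \<tau> \<theta> x y xh yh"
  shows "(\<exists>xs ys. saddle_point K F G xs ys \<and>
            x \<longlonglongrightarrow> xs \<and> weakly_tendsto y ys \<and>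
            (\<lambda>k. (norm (ergodic \<theta> x k - xs))\<^sup>2) \<in> O(\<lambda>k. 1 / (real k)\<^sup>2) \<and>
            weakly_tendsto (ergodic \<theta> y) ys)
       \<and> (\<exists>k0 \<rho> M. 0 < \<rho> \<and> \<rho> \<le> 1 \<and>
            gap_bound K F G \<sigma> \<tau> \<theta> x y xh yh X0 Y0 x' y' k0 \<rho> = ereal M \<and>
            (\<forall>k\<ge>1. restricted_gap K F G X0 Y0 (ergodic \<theta> x k) (ergodic \<theta> y k)
                      \<le> ereal (erg_norm \<theta> k * M)) \<and>
            (\<lambda>k. erg_norm \<theta> k * M) \<in> O(\<lambda>k. 1 / (real k)\<^sup>2))"
proof (intro conjI)
  interpret accelerated_douglas_rachford K F G \<gamma>1 \<gamma> \<sigma> \<tau> \<theta> x xh y yh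
    by (rule accelerated_douglas_rachford.intro) fact+
  have mem: "x' \<in> X0" "y' \<in> Y0" using saddle(1) by auto
  have dom: "X0 \<subseteq> edom F" "Y0 \<subseteq> edom G" using X0Y0(1) mem by auto
  have bnd: "bounded X0" "bounded Y0"
    using bounded_fst[OF X0Y0(2)] bounded_snd[OF X0Y0(2)] mem by (auto simp: fst_image_times snd_image_times split: if_splits)
  obtain ys where ys: "saddle_point K F G x' ys" "weakly_tendsto (\<lambda>k. y (Suc k)) ys"
    by (rule y_weakly_tendsto[OF saddle(2)])
  have "weakly_tendsto y ys"
    unfolding weakly_tendsto_iff_inner
    by (intro allI, rule LIMSEQ_imp_Suc) (use ys(2) weakly_tendsto_iff_inner in metis)
  then show "\<exists>xs ys. saddle_point K F G xs ys \<and>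
            x \<longlonglongrightarrow> xs \<and> weakly_tendsto y ys \<and>
            (\<lambda>k. (norm (ergodic \<theta> x k - xs))\<^sup>2) \<in> O(\<lambda>k. 1 / (real k)\<^sup>2) \<and>
            weakly_tendsto (ergodic \<theta> y) ys"
    using ys(1) x_tendsto_saddle[OF ys(1)] ergodic_x_rate[OF ys(1)] ergodic_weakly_tendsto[OF ys(2)]
    by blast
  obtain \<rho> M where \<rho>: "0 < \<rho>" "\<rho> \<le> 1"
    and M: "gap_bound K F G \<sigma> \<tau> \<theta> x y xh yh X0 Y0 x' y' 0 \<rho> = ereal M"
    and sums: "\<And>k u v. u \<in> X0 \<Longrightarrow> v \<in> Y0 \<Longrightarrow> (\<Sum>j<k. erg_weight \<theta> j * gap j u v) \<le> M"
    using gap_bound_dominates[OF saddle(2) mem dom bnd] by metis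
  have "restricted_gap K F G X0 Y0 (ergodic \<theta> x k) (ergodic \<theta> y k) \<le> ereal (erg_norm \<theta> k * M)"
    if k: "k \<ge> 1" for k
    unfolding restricted_gap_def
  proof (rule SUP_least, clarify)
    fix u v assume uv: "u \<in> X0" "v \<in> Y0"
    have "lagrangian K F G (ergodic \<theta> x k) v - lagrangian K F G u (ergodic \<theta> y k)
        \<le> ereal (erg_norm \<theta> k * (\<Sum>j<k. erg_weight \<theta> j * gap j u v))"
      using ergodic_gap[OF k] uv dom by blast
    also have "\<dots> \<le> ereal (erg_norm \<theta> k * M)"
      using sums[OF uv, of k] erg_norm_pos[OF k] by (simp add: mult_left_mono)
    finally show "lagrangian K F G (ergodic \<theta> x k) v - lagrangian K F G u (ergodic \<theta> y k)
        \<le> ereal (erg_norm \<theta> k * M)" .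
  qed
  then show "\<exists>k0 \<rho> M. 0 < \<rho> \<and> \<rho> \<le> 1 \<and>
            gap_bound K F G \<sigma> \<tau> \<theta> x y xh yh X0 Y0 x' y' k0 \<rho> = ereal M \<and>
            (\<forall>k\<ge>1. restricted_gap K F G X0 Y0 (ergodic \<theta> x k) (ergodic \<theta> y k)
                      \<le> ereal (erg_norm \<theta> k * M)) \<and>
            (\<lambda>k. erg_norm \<theta> k * M) \<in> O(\<lambda>k. 1 / (real k)\<^sup>2)"
    using \<rho> M erg_norm_bigo by blast
qed

end
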